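(* The ranks of the pseudovarieties $\mathsf{MN}$, $\mathsf{PE}$, $\mathsf{NMN}_4$ and $\mathsf{TM}$ are respectively $4$, $2$, $3$ and $2$.
   Context: A pseudovariety of semigroups is a class of finite semigroups closed under subsemigroups, homomorphic images and finite direct products. A semigroup is $n$-generated if it is generated by some subset with at most $n$ elements. A pseudovariety $\mathsf V$ has rank at most $n$ if, whenever a finite semigroup $S$ is such that all its $n$-generated subsemigroups belong to $\mathsf V$, also $S\in\mathsf V$; if such an $n\ge 0$ exists, the rank of $\mathsf V$ is the minimum such $n$. For a semigroup $S$, $S^1=S$ if $S$ has an identity element, and otherwise $S^1=S\cup\{1\}$ with an adjoined identity. For $x,y\in S$ and $z_1,z_2,\ldots\in S^1$ put $\lambda_0=x$, $\rho_0=y$, $\lambda_{n+1}=\lambda_n z_{n+1}\rho_n$, $\rho_{n+1}=\rho_n z_{n+1}\lambda_n$, with $\lambda_n=\lambda_n(x,y,z_1,\ldots,z_n)$, $\rho_n=\rho_n(x,y,z_1,\ldots,z_n)$. $\mathsf{MN}$: finite semigroups $S$ for which there is $n\ge0$ with $\lambda_n(a,b,c_1,\ldots,c_n)=\rho_n(a,b,c_1,\ldots,c_n)$ for all $a,b\in S$, $c_1,\ldots,c_n\in S^1$. $\mathsf{PE}$: finite semigroups $S$ for which there is $n\ge2$ with $\lambda_n(a,b,1,1,c,c^2,\ldots,c^{n-2})=\rho_n(a,b,1,1,c,c^2,\ldots,c^{n-2})$ for all $a,b\in S$, $c\in S^1$. $\mathsf{TM}$: finite semigroups $S$ for which there is $n\ge0$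 with $\lambda_n(a,b,1,\ldots,1)=\rho_n(a,b,1,\ldots,1)$ for all $a,b\in S$. $\mathsf{BG_{nil}}$: finite block groups (finite semigroups in which each element has at most one inverse) all of whose subgroups are nilpotent. A semigroup $S$ divides a semigroup $T$, written $S\prec T$, if $S$ is a homomorphic image of a subsemigroup of $T$. Transformations are composed from left to right. $F_7$ is the $7$-element semigroup of transformations of $\{1,2,\theta\}$ generated by $u$ ($1\mapsto2$, $2\mapsto1$, $\theta\mapsto\theta$) and $e$ ($1\mapsto1$, $2\mapsto\theta$, $\theta\mapsto\theta$). $F_{12}$ is the $12$-element semigroup of transformations of $\{1,2,3,\theta\}$ fixing $\theta$ that is the union of the set consisting of the constant map to $\theta$ and of all maps $(1;i,j)$ ($1\le i,j\le3$; $i\mapsto j$ and every other point $\mapsto\theta$) with the semigroup generated by $w_1$ ($1\mapsto1$, $3\mapsto2$, $2\mapsto\theta$) and $w_2$ ($3\mapsto1$, $1\mapsto2$, $2\mapsto\theta$). $\mathsf{NMN}_4$: finite semigroups $S\in\mathsf{BG_{nil}}$ such that $F_7\not\prec S$ and $F_{12}\not\prec S$. All four classes are pseudovarieties. *)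

theory Defs
  imports "HOL-Algebra.Generated_Groups"
begin

section \<open>Finite semigroups\<close>

record 'a sgrp = "'a partial_object" +
  sgmult :: "'a \<Rightarrow> 'a \<Rightarrow> 'a"  (infixl \<open>\<cdot>\<index>\<close> 70)

locale finite_sgrp =
  fixes S :: "'a sgrp" (structure)
  assumes finite_carrier: "finite (carrier S)"
    and nonempty: "carrier S \<noteq> {}"
    and closed: "x \<in> carrier S \<Longrightarrow> y \<in> carrier S \<Longrightarrow> x \<cdot> y \<in> carrier S"
    and assoc: "x \<in> carrier S \<Longrightarrow> y \<in> carrier S \<Longrightarrow> z \<in> carrier S
                  \<Longrightarrow> (x \<cdot> y) \<cdot> z = x \<cdot> (y \<cdot> z)"

definition subsgrp :: "'a set \<Rightarrow> 'a sgrp \<Rightarrow> bool" where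
  "subsgrp T S \<longleftrightarrow> T \<subseteq> carrier S \<and> T \<noteq> {} \<and> (\<forall>x\<in>T. \<forall>y\<in>T. x \<cdot>\<^bsub>S\<^esub> y \<in> T)"

inductive_set sgrp_gen :: "'a sgrp \<Rightarrow> 'a set \<Rightarrow> 'a set" for S A where
  base: "a \<in> A \<Longrightarrow> a \<in> sgrp_gen S A"
| mult: "x \<in> sgrp_gen S A \<Longrightarrow> y \<in> sgrp_gen S A \<Longrightarrow> x \<cdot>\<^bsub>S\<^esub> y \<in> sgrp_gen S A"

definition n_generated :: "nat \<Rightarrow> 'a sgrp \<Rightarrow> bool" where
  "n_generated n S \<longleftrightarrow>
     (\<exists>A. A \<subseteq> carrier S \<and> finite A \<and> card A \<le> n \<and> sgrp_gen S A = carrier S)"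

definition divides :: "'b sgrp \<Rightarrow> 'a sgrp \<Rightarrow> bool"  (infix \<open>\<prec>\<close> 50) where
  "S \<prec> T \<longleftrightarrow>
     (\<exists>U f. subsgrp U T \<and> f ` U = carrier S \<and>
        (\<forall>x\<in>U. \<forall>y\<in>U. f (x \<cdot>\<^bsub>T\<^esub> y) = f x \<cdot>\<^bsub>S\<^esub> f y))"


section \<open>Rank of a class of finite semigroups\<close>

text \<open>Carriers are subsets of the type \<open>'a\<close>. If \<open>'a\<close> is infinite, every finite semigroup
  has an isomorphic copy in \<open>'a sgrp\<close>, so quantifying over \<open>'a sgrp\<close> covers all finite
  semigroups up to isomorphism; over a finite \<open>'a\<close> the rank could come out smaller.\<close>

definition rank_at_most :: "'a sgrp set \<Rightarrow> nat \<Rightarrow> bool" where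
  "rank_at_most V n \<longleftrightarrow>
     (\<forall>S. finite_sgrp S \<longrightarrow>
        (\<forall>T. subsgrp T S \<and> n_generated n (S\<lparr>carrier := T\<rparr>) \<longrightarrow> S\<lparr>carrier := T\<rparr> \<in> V) \<longrightarrow>
        S \<in> V)"

text \<open>A relation, not a \<open>LEAST\<close> term: \<open>has_rank V n\<close> includes that \<open>V\<close> has finite rank.\<close>

definition has_rank :: "'a sgrp set \<Rightarrow> nat \<Rightarrow> bool" where
  "has_rank V n \<longleftrightarrow> rank_at_most V n \<and> (\<forall>m. rank_at_most V m \<longrightarrow> n \<le> m)"


section \<open>The monoid \<open>S\<^sup>1\<close> and the words \<open>\<lambda>\<^sub>n\<close>, \<open>\<rho>\<^sub>n\<close>\<close>

definition is_identity :: "'a sgrp \<Rightarrow> 'a \<Rightarrow> bool" where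
  "is_identity S e \<longleftrightarrow>
     e \<in> carrier S \<and> (\<forall>x\<in>carrier S. e \<cdot>\<^bsub>S\<^esub> x = x \<and> x \<cdot>\<^bsub>S\<^esub> e = x)"

text \<open>\<open>S\<close> embeds in \<open>S\<^sup>1\<close> via \<open>Some\<close>; \<open>None\<close> is the adjoined identity, and belongs to the
  carrier only if \<open>S\<close> has no identity element.\<close>

definition S1 :: "'a sgrp \<Rightarrow> 'a option monoid" where
  "S1 S = \<lparr>
     carrier = (if \<exists>e. is_identity S e then Some ` carrier S else insert None (Some ` carrier S)),
     monoid.mult = (\<lambda>x y. case x of None \<Rightarrow> y
                         | Some a \<Rightarrow> (case y of None \<Rightarrow> x | Some b \<Rightarrow> Some (a \<cdot>\<^bsub>S\<^esub> b))),
     one = (if \<exists>e. is_identity S e then Some (THE e. is_identity S e) else None)\<rparr>"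

text \<open>The sequence \<open>z\<close> is indexed from 1; \<open>z 0\<close> is never used.\<close>

fun lam :: "('a, 'm) monoid_scheme \<Rightarrow> 'a \<Rightarrow> 'a \<Rightarrow> (nat \<Rightarrow> 'a) \<Rightarrow> nat \<Rightarrow> 'a"
and rho :: "('a, 'm) monoid_scheme \<Rightarrow> 'a \<Rightarrow> 'a \<Rightarrow> (nat \<Rightarrow> 'a) \<Rightarrow> nat \<Rightarrow> 'a" where
  "lam M x y z 0 = x"
| "rho M x y z 0 = y"
| "lam M x y z (Suc n) = lam M x y z n \<otimes>\<^bsub>M\<^esub> z (Suc n) \<otimes>\<^bsub>M\<^esub> rho M x y z n"
| "rho M x y z (Suc n) = rho M x y z n \<otimes>\<^bsub>M\<^esub> z (Suc n) \<otimes>\<^bsub>M\<^esub> lam M x y z n"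


section \<open>The classes \<open>MN\<close>, \<open>PE\<close> and \<open>TM\<close>\<close>

definition MN :: "'a sgrp set" where
  "MN = {S. finite_sgrp S \<and>
     (\<exists>n. \<forall>a\<in>carrier S. \<forall>b\<in>carrier S. \<forall>c. (\<forall>i\<in>{1..n}. c i \<in> carrier (S1 S)) \<longrightarrow>
        lam (S1 S) (Some a) (Some b) c n = rho (S1 S) (Some a) (Some b) c n)}"

text \<open>The sequence \<open>1, 1, c, c\<^sup>2, c\<^sup>3, \<dots>\<close>, indexed from 1.\<close>

definition PE_seq :: "('a, 'm) monoid_scheme \<Rightarrow> 'a \<Rightarrow> nat \<Rightarrow> 'a" where
  "PE_seq M c i = (if i \<le> 2 then \<one>\<^bsub>M\<^esub> else c [^]\<^bsub>M\<^esub> (i - 2))"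

definition PE :: "'a sgrp set" where
  "PE = {S. finite_sgrp S \<and>
     (\<exists>n\<ge>2. \<forall>a\<in>carrier S. \<forall>b\<in>carrier S. \<forall>c\<in>carrier (S1 S).
        lam (S1 S) (Some a) (Some b) (PE_seq (S1 S) c) n =
        rho (S1 S) (Some a) (Some b) (PE_seq (S1 S) c) n)}"

definition TM :: "'a sgrp set" where
  "TM = {S. finite_sgrp S \<and>
     (\<exists>n. \<forall>a\<in>carrier S. \<forall>b\<in>carrier S.
        lam (S1 S) (Some a) (Some b) (\<lambda>_. \<one>\<^bsub>S1 S\<^esub>) n =
        rho (S1 S) (Some a) (Some b) (\<lambda>_. \<one>\<^bsub>S1 S\<^esub>) n)}"


section \<open>Block groups with nilpotent subgroups\<close>

fun lower_central :: "('a, 'm) monoid_scheme \<Rightarrow> nat \<Rightarrow> 'a set" where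
  "lower_central G 0 = carrier G"
| "lower_central G (Suc n) = generate G
     (\<Union>x\<in>lower_central G n. \<Union>y\<in>carrier G.
        {x \<otimes>\<^bsub>G\<^esub> y \<otimes>\<^bsub>G\<^esub> inv\<^bsub>G\<^esub> x \<otimes>\<^bsub>G\<^esub> inv\<^bsub>G\<^esub> y})"

definition nilpotent_group :: "('a, 'm) monoid_scheme \<Rightarrow> bool" where
  "nilpotent_group G \<longleftrightarrow> group G \<and> (\<exists>n. lower_central G n = {\<one>\<^bsub>G\<^esub>})"

definition is_inverse :: "'a sgrp \<Rightarrow> 'a \<Rightarrow> 'a \<Rightarrow> bool" where
  "is_inverse S x y \<longleftrightarrow> x \<cdot>\<^bsub>S\<^esub> y \<cdot>\<^bsub>S\<^esub> x = x \<and> y \<cdot>\<^bsub>S\<^esub> x \<cdot>\<^bsub>S\<^esub> y = y"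

definition block_group :: "'a sgrp \<Rightarrow> bool" where
  "block_group S \<longleftrightarrow> finite_sgrp S \<and>
     (\<forall>x\<in>carrier S. \<forall>y\<in>carrier S. \<forall>y'\<in>carrier S.
        is_inverse S x y \<and> is_inverse S x y' \<longrightarrow> y = y')"

text \<open>A subgroup of a semigroup is a subsemigroup that is a group; its identity \<open>e\<close> need not
  be an identity of the whole semigroup.\<close>

definition BG_nil :: "'a sgrp set" where
  "BG_nil = {S. block_group S \<and>
     (\<forall>H e. H \<subseteq> carrier S \<and> group \<lparr>carrier = H, monoid.mult = sgmult S, one = e\<rparr> \<longrightarrow>
        nilpotent_group \<lparr>carrier = H, monoid.mult = sgmult S, one = e\<rparr>)}"


section \<open>The semigroups \<open>F\<^sub>7\<close>, \<open>F\<^sub>1\<^sub>2\<close> and the class \<open>NMN\<^sub>4\<close>\<close>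

text \<open>Transformations compose from left to right.\<close>

definition transf_sgrp :: "('p \<Rightarrow> 'p) sgrp" where
  "transf_sgrp = \<lparr>carrier = UNIV, sgmult = (\<lambda>f g. g \<circ> f)\<rparr>"

datatype pt2 = A1 | A2 | A\<theta>

definition F7_u :: "pt2 \<Rightarrow> pt2" where
  "F7_u = (\<lambda>p. case p of A1 \<Rightarrow> A2 | A2 \<Rightarrow> A1 | A\<theta> \<Rightarrow> A\<theta>)"

definition F7_e :: "pt2 \<Rightarrow> pt2" where
  "F7_e = (\<lambda>p. case p of A1 \<Rightarrow> A1 | A2 \<Rightarrow> A\<theta> | A\<theta> \<Rightarrow> A\<theta>)"

definition F7 :: "(pt2 \<Rightarrow> pt2) sgrp" where
  "F7 = transf_sgrp\<lparr>carrier := sgrp_gen transf_sgrp {F7_u, F7_e}\<rparr>"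

datatype pt3 = B1 | B2 | B3 | B\<theta>

text \<open>The map \<open>(1;i,j)\<close>.\<close>

definition F12_unit :: "pt3 \<Rightarrow> pt3 \<Rightarrow> pt3 \<Rightarrow> pt3" where
  "F12_unit i j = (\<lambda>p. if p = i then j else B\<theta>)"

definition F12_w1 :: "pt3 \<Rightarrow> pt3" where
  "F12_w1 = (\<lambda>p. case p of B1 \<Rightarrow> B1 | B2 \<Rightarrow> B\<theta> | B3 \<Rightarrow> B2 | B\<theta> \<Rightarrow> B\<theta>)"

definition F12_w2 :: "pt3 \<Rightarrow> pt3" where
  "F12_w2 = (\<lambda>p. case p of B1 \<Rightarrow> B2 | B2 \<Rightarrow> B\<theta> | B3 \<Rightarrow> B1 | B\<theta> \<Rightarrow> B\<theta>)"

definition F12 :: "(pt3 \<Rightarrow> pt3) sgrp" where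
  "F12 = transf_sgrp\<lparr>carrier :=
     {\<lambda>_. B\<theta>} \<union> {F12_unit i j | i j. i \<in> {B1, B2, B3} \<and> j \<in> {B1, B2, B3}}
       \<union> sgrp_gen transf_sgrp {F12_w1, F12_w2}\<rparr>"

definition NMN4 :: "'a sgrp set" where
  "NMN4 = {S. S \<in> BG_nil \<and> \<not> F7 \<prec> S \<and> \<not> F12 \<prec> S}"

end

theory Submission
  imports Defs "HOL-Algebra.Coset"
begin

text \<open>
  A finite group in which \<open>\<lambda>\<^sub>n(a, c\<^sup>-\<^sup>1, 1, 1, c, c\<^sup>2, \<dots>) = \<rho>\<^sub>n(\<dots>)\<close> for some \<open>n\<close>, for each \<open>a\<close> and \<open>c\<close>, is
  nilpotent: in a minimal counterexample either a nontrivial abelian normal subgroup meets the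
  centre, because on it the condition is the Engel condition, or the group is simple with nilpotent
  proper subgroups, which is impossible by Schmidt's count of the elements of maximal subgroups.

  In a finite semigroup outside \<open>MN\<close> there is an infinite sequence with \<open>\<lambda>\<^sub>n \<noteq> \<rho>\<^sub>n\<close> for all \<open>n\<close>, and
  \<open>\<lambda>\<^sub>n, \<rho>\<^sub>n\<close> eventually stay in one \<open>J\<close>-class; start it there, at \<open>x, y\<close>. If \<open>x\<close> and \<open>y\<close> are \<open>H\<close>-related,
  the sequence lives in a non-nilpotent subgroup, which has a two-generated witness by the
  result on groups. Otherwise \<open>x\<close>, \<open>y\<close>, \<open>z\<^sub>1\<close>, \<open>z\<^sub>2\<close> generate a witness, as \<open>z\<^sub>1, z\<^sub>2, z\<^sub>1, z\<^sub>2, \<dots>\<close> keeps all products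
  in the \<open>J\<close>-class. For \<open>PE\<close> the sequence consists of powers of \<open>c\<close>; in a block group \<open>c\<close> then swaps two
  \<open>L\<close>-classes, and \<open>c\<close> together with one element of the \<open>J\<close>-class generates a witness.

  For \<open>NMN4\<close> the bound 3 holds because \<open>F7\<close> and \<open>F12\<close> are three-generated and non-nilpotent groups
  have two-generated witnesses. The bounds are sharp because of left zero bands, of \<open>F12\<close>, which is
  aperiodic and not two-generated, and of a semigroup of partial injections of four points.
\<close>

section \<open>Lower central series and the words in groups\<close>

text \<open>A counterexample gives, for each n, a sequence failing at n. Equality of the two words
  persists, so compactness over the finite alphabet yields one sequence that fails forever, and only
  such a sequence can be followed into a J-class. There a product inherits the R-class of its first
  factor and the L-class of its last: the R-classes of the words freeze and their L-classes swap at
  each step. Whether a product stays in the J-class depends on these classes alone, which is why two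
  alternating letters can replace the whole sequence. For PE, distinct idempotents that are R- or
  L-related generate a failing band of two elements, so R- and L-classes may be taken to have at
  most one idempotent; this is where the rigidity of block groups enters. Two obstacles shape the
  formal setting. The monoid S^1 depends on whether S has an identity, which a subsemigroup need not
  share; all conditions are therefore moved to a monoid with an identity always adjoined. And
  quotient groups live on sets of elements, so an induction on group order would change types;
  extremal choices of subgroups and normal subgroups inside one group replace it.\<close>

abbreviation (input) lam_eq_rho :: "('a, 'm) monoid_scheme \<Rightarrow> 'a \<Rightarrow> 'a \<Rightarrow> (nat \<Rightarrow> 'a) \<Rightarrow> nat \<Rightarrow> bool" where
  "lam_eq_rho M x y z n \<equiv> lam M x y z n = rho M x y z n"

text \<open>Equal words stay equal, since both recursions then form the same product. This lets
  exponents be enlarged freely and pointwise bounds be merged into uniform ones.\<close>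

lemma lam_rho_eq_mono:
  assumes "lam_eq_rho M x y z m" "m \<le> n"
  shows "lam_eq_rho M x y z n"
  using assms(2,1) by (induction n rule: dec_induct) auto

text \<open>The exponent may depend on \<open>a\<close> and \<open>c\<close>. This pointwise form
  passes to subgroups and images and can be tested inside subgroups containing \<open>a\<close> and
  \<open>c\<close>.\<close>

definition engel_like :: "('a, 'm) monoid_scheme \<Rightarrow> bool" where
  "engel_like G \<longleftrightarrow> (\<forall>a\<in>carrier G. \<forall>c\<in>carrier G. \<exists>n.
     lam_eq_rho G a (inv\<^bsub>G\<^esub> c) (PE_seq G c) n)"

context group begin

lemma inv_cancel_left [simp]:
  "x \<in> carrier G \<Longrightarrow> y \<in> carrier G \<Longrightarrow> inv x \<otimes> (x \<otimes> y) = y"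
  "x \<in> carrier G \<Longrightarrow> y \<in> carrier G \<Longrightarrow> x \<otimes> (inv x \<otimes> y) = y"
  by (simp_all flip: m_assoc)

lemma lam_rho_closed:
  assumes "x \<in> carrier G" "y \<in> carrier G" "\<And>i. z i \<in> carrier G"
  shows "lam G x y z n \<in> carrier G \<and> rho G x y z n \<in> carrier G"
  by (induction n) (use assms in auto)

lemma PE_seq_closed: "c \<in> carrier G \<Longrightarrow> PE_seq G c i \<in> carrier G"
  by (simp add: PE_seq_def)

lemma lower_central_subgroup: "subgroup (lower_central G n) G"
proof (induction n)
  case 0 then show ?case by (simp add: subgroup_self)
next
  case (Suc n)
  have "lower_central G n \<subseteq> carrier G"
    using Suc by (rule subgroup.subset)
  then have "(\<Union>x\<in>lower_central G n. \<Union>y\<in>carrier G. {x \<otimes> y \<otimes> inv x \<otimes> inv y}) \<subseteq> carrier G"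
    by (intro UN_least) (simp add: subset_iff)
  from generate_is_subgroup[OF this] show ?case by simp
qed

lemma lower_central_closed: "x \<in> lower_central G n \<Longrightarrow> x \<in> carrier G"
  by (rule subgroup.mem_carrier[OF lower_central_subgroup])

lemma lower_central_comm:
  assumes "x \<in> lower_central G n" "y \<in> carrier G"
  shows "x \<otimes> y \<otimes> inv x \<otimes> inv y \<in> lower_central G (Suc n)"
  unfolding lower_central.simps by (rule generate.incl) (use assms in blast)

text \<open>Induction shows that any sequence of subgroups with this commutator property dominates
  the lower central series. Taking preimages or images of another lower central series for
  \<open>Z\<close> gives the two lemmas on homomorphisms below.\<close>

lemma lower_central_least:
  assumes "Z 0 = carrier G" "\<And>i. subgroup (Z i) G"
    and "\<And>i x y. x \<in> Z i \<Longrightarrow> y \<in> carrier G \<Longrightarrow> x \<otimes> y \<otimes> inv x \<otimes> inv y \<in> Z (Suc i)"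
  shows "lower_central G n \<subseteq> Z n"
proof (induction n)
  case (Suc n)
  show ?case unfolding lower_central.simps
    by (rule generate_subgroup_incl[OF _ assms(2)]) (use Suc assms(3) in blast)
qed (simp add: assms)

lemma lower_central_hom_vimage:
  assumes "group K" "h \<in> hom G K"
  shows "lower_central G n \<subseteq> {x \<in> carrier G. h x \<in> lower_central K n}"
proof (rule lower_central_least)
  interpret K: group K by fact
  interpret h: group_hom G K h using assms by unfold_locales auto
  show "{x \<in> carrier G. h x \<in> lower_central K 0} = carrier G" by auto
  show "subgroup {x \<in> carrier G. h x \<in> lower_central K i} G" for i
  proof -
    interpret L: subgroup "lower_central K i" K by (rule K.lower_central_subgroup)
    show ?thesis by (rule subgroupI) auto
  qed
  show "x \<otimes> y \<otimes> inv x \<otimes> inv y \<in> {x \<in> carrier G. h x \<in> lower_central K (Suc i)}"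
    if "x \<in> {x \<in> carrier G. h x \<in> lower_central K i}" "y \<in> carrier G" for i x y
    using that K.lower_central_comm[of "h x" i "h y"] by simp
qed

lemma lower_central_hom_image:
  assumes "group K" "h \<in> hom G K" "h ` carrier G = carrier K"
  shows "lower_central K n \<subseteq> h ` lower_central G n"
proof -
  interpret K: group K by fact
  interpret h: group_hom G K h using assms by unfold_locales auto
  show ?thesis
  proof (rule K.lower_central_least)
    show "h ` lower_central G 0 = carrier K" by (simp add: assms)
    show "subgroup (h ` lower_central G i) K" for i
      by (rule h.subgroup_img_is_subgroup[OF lower_central_subgroup])
    fix i x y assume x: "x \<in> h ` lower_central G i" and y: "y \<in> carrier K"
    obtain a where a: "x = h a" "a \<in> lower_central G i" using x by blast
    obtain b where b: "y = h b" "b \<in> carrier G" using y assms(3) by blast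
    note ab = a b
    have "x \<otimes>\<^bsub>K\<^esub> y \<otimes>\<^bsub>K\<^esub> inv\<^bsub>K\<^esub> x \<otimes>\<^bsub>K\<^esub> inv\<^bsub>K\<^esub> y = h (a \<otimes> b \<otimes> inv a \<otimes> inv b)"
      using ab lower_central_closed[OF ab(2)] by simp
    then show "x \<otimes>\<^bsub>K\<^esub> y \<otimes>\<^bsub>K\<^esub> inv\<^bsub>K\<^esub> x \<otimes>\<^bsub>K\<^esub> inv\<^bsub>K\<^esub> y \<in> h ` lower_central G (Suc i)"
      using lower_central_comm[OF ab(2,4)] by blast
  qed
qed

lemma nilpotent_hom_image:
  assumes "nilpotent_group G" "group K" "h \<in> hom G K" "h ` carrier G = carrier K"
  shows "nilpotent_group K"
proof -
  interpret K: group K by fact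
  interpret h: group_hom G K h using assms by unfold_locales auto
  obtain n where n: "lower_central G n = {\<one>}"
    using assms(1) by (auto simp: nilpotent_group_def)
  have "lower_central K n \<subseteq> {\<one>\<^bsub>K\<^esub>}"
    using lower_central_hom_image[OF assms(2-4), of n] n by simp
  moreover have "\<one>\<^bsub>K\<^esub> \<in> lower_central K n"
    by (rule subgroup.one_closed[OF K.lower_central_subgroup])
  ultimately show ?thesis using assms(2) by (auto simp: nilpotent_group_def)
qed

lemma nilpotentI: "lower_central G n \<subseteq> {\<one>} \<Longrightarrow> nilpotent_group G"
  using subgroup.one_closed[OF lower_central_subgroup, of n] is_group
  unfolding nilpotent_group_def by blast

lemma nilpotent_if_lower_central_central:
  assumes "\<And>x y. x \<in> lower_central G n \<Longrightarrow> y \<in> carrier G \<Longrightarrow> x \<otimes> y = y \<otimes> x"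
  shows "nilpotent_group G"
proof (rule nilpotentI)
  have "x \<otimes> y \<otimes> inv x \<otimes> inv y = \<one>" if "x \<in> lower_central G n" "y \<in> carrier G" for x y
    using assms[OF that] that lower_central_closed[OF that(1)] by (simp add: m_assoc)
  then have "(\<Union>x\<in>lower_central G n. \<Union>y\<in>carrier G. {x \<otimes> y \<otimes> inv x \<otimes> inv y}) \<subseteq> {\<one>}"
    by blast
  from generate_subgroup_incl[OF this triv_subgroup]
  show "lower_central G (Suc n) \<subseteq> {\<one>}" by simp
qed

text \<open>With q = l^-1 r, the next quotient is the commutator of q with (w r)^-1, whatever the
  letter w is. Each step of the words thus moves the quotient one term down the series.\<close>

lemma rho_inv_lam_lower_central:
  assumes "x \<in> carrier G" "y \<in> carrier G" "\<And>i. z i \<in> carrier G"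
  shows "inv (rho G x y z n) \<otimes> lam G x y z n \<in> lower_central G n"
proof (induction n)
  case 0 then show ?case using assms by simp
next
  case (Suc n)
  define l r w where "l = lam G x y z n" "r = rho G x y z n" "w = z (Suc n)"
  have lr: "l \<in> carrier G" "r \<in> carrier G" "w \<in> carrier G"
    using lam_rho_closed[OF assms] assms l_r_w_def by auto
  have q: "inv r \<otimes> l \<in> lower_central G n" using Suc l_r_w_def by simp
  then have q': "inv l \<otimes> r \<in> lower_central G n"
    using subgroup.m_inv_closed[OF lower_central_subgroup q] lr by (simp add: inv_mult_group)
  have "inv (rho G x y z (Suc n)) \<otimes> lam G x y z (Suc n)
      = (inv l \<otimes> r) \<otimes> inv (w \<otimes> r) \<otimes> inv (inv l \<otimes> r) \<otimes> inv (inv (w \<otimes> r))"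
    using lr by (simp add: m_assoc inv_mult_group flip: l_r_w_def)
  then show ?case using lower_central_comm[OF q', of "inv (w \<otimes> r)"] lr by simp
qed

lemma nilpotent_imp_lam_eq_rho:
  assumes "nilpotent_group G"
  shows "\<exists>n. \<forall>x\<in>carrier G. \<forall>y\<in>carrier G. \<forall>z. (\<forall>i. z i \<in> carrier G)
      \<longrightarrow> lam_eq_rho G x y z n"
proof -
  obtain n where n: "lower_central G n = {\<one>}"
    using assms by (auto simp: nilpotent_group_def)
  have "lam_eq_rho G x y z n"
    if "x \<in> carrier G" "y \<in> carrier G" "\<And>i. z i \<in> carrier G" for x y z
  proof -
    have "inv (rho G x y z n) \<otimes> lam G x y z n = \<one>"
      using rho_inv_lam_lower_central[OF that, where n=n] n by simp
    then show ?thesis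
      using lam_rho_closed[OF that, where n=n] inv_cancel_left(2)[of "rho G x y z n" "lam G x y z n"]
      by simp
  qed
  then show ?thesis by blast
qed

text \<open>The last term of the series not inside \<open>D\<close>: it has an element outside
  \<open>D\<close> all of whose commutators fall into \<open>D\<close>. It drives the normalizer,
  centre and centralizer arguments below.\<close>

lemma lower_central_jump:
  assumes "\<not> carrier G \<subseteq> D" "lower_central G n \<subseteq> D"
  obtains i where "\<not> lower_central G i \<subseteq> D" "lower_central G (Suc i) \<subseteq> D"
proof -
  define m where "m = (LEAST m. lower_central G m \<subseteq> D)"
  have m: "lower_central G m \<subseteq> D" unfolding m_def using assms(2) by (rule LeastI)
  obtain i where i: "m = Suc i" using m assms(1) by (cases m) auto
  have "\<not> lower_central G i \<subseteq> D"
    using not_less_Least[of i "\<lambda>m. lower_central G m \<subseteq> D"] i unfolding m_def by simp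
  with m i that show thesis by simp
qed

text \<open>An element of the last lower central term not inside \<open>D\<close> works, because g d
  g^-1 = [g, d] d.\<close>

lemma nilpotent_normalizer:
  assumes "nilpotent_group G" "subgroup D G" "D \<noteq> carrier G"
  obtains g where "g \<in> carrier G" "g \<notin> D" "\<And>d. d \<in> D \<Longrightarrow> g \<otimes> d \<otimes> inv g \<in> D"
proof -
  interpret D: subgroup D G by fact
  obtain n where n: "lower_central G n = {\<one>}"
    using assms(1) by (auto simp: nilpotent_group_def)
  obtain i where i: "\<not> lower_central G i \<subseteq> D" "lower_central G (Suc i) \<subseteq> D"
    by (rule lower_central_jump[of D n]) (use n assms(3) D.subset in auto)
  then obtain g where g: "g \<in> lower_central G i" "g \<notin> D" by auto
  have gG: "g \<in> carrier G" using g lower_central_closed by blast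
  have "g \<otimes> d \<otimes> inv g \<in> D" if d: "d \<in> D" for d
  proof -
    have "g \<otimes> d \<otimes> inv g = (g \<otimes> d \<otimes> inv g \<otimes> inv d) \<otimes> d"
      using d gG by (simp add: m_assoc)
    then show ?thesis using lower_central_comm[OF g(1), of d] d i by (metis D.m_closed D.mem_carrier subsetD)
  qed
  with g gG that show thesis by blast
qed

lemma nilpotent_center_nontrivial:
  assumes "nilpotent_group G" "carrier G \<noteq> {\<one>}"
  obtains x where "x \<in> carrier G" "x \<noteq> \<one>" "\<And>y. y \<in> carrier G \<Longrightarrow> x \<otimes> y = y \<otimes> x"
proof -
  obtain n where n: "lower_central G n = {\<one>}"
    using assms(1) by (auto simp: nilpotent_group_def)
  obtain i where i: "\<not> lower_central G i \<subseteq> {\<one>}" "lower_central G (Suc i) \<subseteq> {\<one>}"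
    by (rule lower_central_jump[of "{\<one>}" n]) (use n assms(2) one_closed in auto)
  then obtain x where x: "x \<in> lower_central G i" "x \<noteq> \<one>" by auto
  have xG: "x \<in> carrier G" using x lower_central_closed by blast
  have "x \<otimes> y = y \<otimes> x" if y: "y \<in> carrier G" for y
  proof -
    have "x \<otimes> y \<otimes> inv x \<otimes> inv y = \<one>" using lower_central_comm[OF x(1) y] i by auto
    then have "x \<otimes> y \<otimes> inv x \<otimes> inv y \<otimes> (y \<otimes> x) = y \<otimes> x" using xG y by simp
    then show ?thesis using xG y by (simp add: m_assoc)
  qed
  with x xG that show thesis by blast
qed

end

section \<open>The Engel condition on abelian normal subgroups\<close>

context group begin

text \<open>The choice \<open>y = c\<^sup>-\<^sup>1\<close> makes all \<open>\<lambda>\<^sub>n\<close> and \<open>\<rho>\<^sub>n\<close> congruent to \<open>c\<^sup>-\<^sup>n\<close> modulo \<open>A\<close>, so that the powers of \<open>c\<close> in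
  the sequence turn \<open>\<lambda>\<^sub>n \<rho>\<^sub>n\<^sup>-\<^sup>1\<close> into an iterated commutator of \<open>a\<close> with \<open>c\<close>.\<close>

lemma lam_rho_engel:
  assumes A: "subgroup A G" "\<And>b g. b \<in> A \<Longrightarrow> g \<in> carrier G \<Longrightarrow> g \<otimes> b \<otimes> inv g \<in> A"
      "\<And>b b'. b \<in> A \<Longrightarrow> b' \<in> A \<Longrightarrow> b \<otimes> b' = b' \<otimes> b"
    and a: "a \<in> A" and c: "c \<in> carrier G"
  defines "\<delta> \<equiv> \<lambda>b. b \<otimes> inv (inv c \<otimes> b \<otimes> c)"
  shows "\<exists>l\<in>A. \<exists>r\<in>A. lam G a (inv c) (PE_seq G c) (n + 2) = l \<otimes> inv (c [^] (n + 2)) \<and>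
      rho G a (inv c) (PE_seq G c) (n + 2) = r \<otimes> inv (c [^] (n + 2)) \<and>
      l \<otimes> inv r = (\<delta> ^^ (n + 2)) a"
proof -
  interpret A: subgroup A G by fact
  have conj: "inv c \<otimes> b \<otimes> c \<in> A" if "b \<in> A" for b using A(2)[OF that, of "inv c"] c by simp
  show ?thesis
  proof (induction n)
    \<comment> \<open>The first two letters are 1. From here on the letters are powers of
      \<open>c\<close>, and both words are elements of \<open>A\<close> times \<open>c\<close> to
      the power -(n + 2).\<close>
    case 0
    define s where "s = inv c \<otimes> a \<otimes> c"
    define t where "t = inv c \<otimes> s \<otimes> c"
    have st: "s \<in> A" "t \<in> A" using conj a s_def t_def by auto
    have [simp]: "a \<in> carrier G" "s \<in> carrier G" "t \<in> carrier G" "c \<in> carrier G"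
      using st a c by auto
    have d1: "\<delta> a = a \<otimes> inv s" by (simp add: \<delta>_def s_def)
    have "\<delta> (\<delta> a) = a \<otimes> inv s \<otimes> (t \<otimes> inv s)"
      by (simp add: d1) (simp add: \<delta>_def t_def s_def inv_mult_group m_assoc)
    also have "\<dots> = a \<otimes> t \<otimes> inv (s \<otimes> s)"
      using A(3)[of "inv s" "t \<otimes> inv s"] st by (simp add: m_assoc inv_mult_group)
    finally have d2: "\<delta> (\<delta> a) = a \<otimes> t \<otimes> inv (s \<otimes> s)" .
    show ?case
      by (rule bexI[of _ "a \<otimes> t"], rule bexI[of _ "s \<otimes> s"])
        (use st a d2 in \<open>simp_all add: numeral_2_eq_2 PE_seq_def, simp_all add: s_def t_def m_assoc inv_mult_group\<close>)
  next
    case (Suc n)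
    then obtain l r where lr: "l \<in> A" "r \<in> A"
      "lam G a (inv c) (PE_seq G c) (n + 2) = l \<otimes> inv (c [^] (n + 2))"
      "rho G a (inv c) (PE_seq G c) (n + 2) = r \<otimes> inv (c [^] (n + 2))"
      "l \<otimes> inv r = (\<delta> ^^ (n + 2)) a" by blast
    define l' where "l' = inv c \<otimes> l \<otimes> c"
    define r' where "r' = inv c \<otimes> r \<otimes> c"
    have lr': "l' \<in> A" "r' \<in> A" using conj lr l'_def r'_def by auto
    have [simp]: "l \<in> carrier G" "r \<in> carrier G" "l' \<in> carrier G" "r' \<in> carrier G" "c \<in> carrier G"
      using lr lr' c by auto
    have "(\<delta> ^^ (Suc n + 2)) a = \<delta> (l \<otimes> inv r)" by (simp add: lr(5))
    also have "\<dots> = l \<otimes> inv r \<otimes> (r' \<otimes> inv l')"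
      by (simp add: \<delta>_def l'_def r'_def inv_mult_group m_assoc)
    also have "\<dots> = l \<otimes> r' \<otimes> inv (r \<otimes> l')"
      using A(3)[of "inv r" "r' \<otimes> inv l'"] lr(1,2) lr' by (simp add: m_assoc inv_mult_group)
    finally have d: "l \<otimes> r' \<otimes> inv (r \<otimes> l') = (\<delta> ^^ (Suc n + 2)) a" ..
    \<comment> \<open>The letter at index n + 3 is \<open>c\<close> to the power n + 1. Against the
      factor of exponent -(n + 2) on its left it leaves one c^-1, which conjugates the next element
      of \<open>A\<close>; this amounts to one application of \<open>\<delta>\<close>.\<close>
    have w: "PE_seq G c (Suc (n + 2)) = c [^] Suc n" by (simp add: PE_seq_def)
    have c2: "inv (c [^] (n + 2)) \<otimes> c [^] Suc n = inv c"
      by (simp add: inv_mult_group m_assoc numeral_2_eq_2)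
    have step: "u \<otimes> inv (c [^] (n + 2)) \<otimes> c [^] Suc n \<otimes> (v \<otimes> inv (c [^] (n + 2)))
        = u \<otimes> (inv c \<otimes> v \<otimes> c) \<otimes> inv (c [^] (Suc n + 2))"
      if "u \<in> carrier G" "v \<in> carrier G" for u v
    proof -
      have "u \<otimes> inv (c [^] (n + 2)) \<otimes> c [^] Suc n \<otimes> (v \<otimes> inv (c [^] (n + 2)))
         = u \<otimes> (inv (c [^] (n + 2)) \<otimes> c [^] Suc n) \<otimes> (v \<otimes> inv (c [^] (n + 2)))"
        using that by (simp add: m_assoc)
      also have "\<dots> = u \<otimes> (inv c \<otimes> v \<otimes> c) \<otimes> inv (c [^] (Suc n + 2))"
        unfolding c2 using that by (simp add: m_assoc inv_mult_group)
      finally show ?thesis .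
    qed
    have "lam G a (inv c) (PE_seq G c) (Suc n + 2) = l \<otimes> r' \<otimes> inv (c [^] (Suc n + 2))"
      unfolding add_Suc lam.simps w lr(3,4) using step[of l r] by (simp only: r'_def add_Suc) simp
    moreover have "rho G a (inv c) (PE_seq G c) (Suc n + 2) = r \<otimes> l' \<otimes> inv (c [^] (Suc n + 2))"
      unfolding add_Suc rho.simps w lr(3,4) using step[of r l] by (simp only: l'_def add_Suc) simp
    moreover have "l \<otimes> r' \<in> A" "r \<otimes> l' \<in> A" using lr(1,2) lr' by auto
    ultimately show ?case using d by blast
  qed
qed

text \<open>The iterates of \<open>\<delta>\<close> on \<open>a\<close> reach 1, and the last
  iterate \<open>b\<close> different from 1 satisfies \<open>\<delta> b = \<one>\<close>, which says
  that \<open>b\<close> commutes with \<open>c\<close>.\<close>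

lemma engel_like_fixed_point:
  assumes "engel_like G"
    and A: "subgroup A G" "\<And>b g. b \<in> A \<Longrightarrow> g \<in> carrier G \<Longrightarrow> g \<otimes> b \<otimes> inv g \<in> A"
      "\<And>b b'. b \<in> A \<Longrightarrow> b' \<in> A \<Longrightarrow> b \<otimes> b' = b' \<otimes> b"
    and "A \<noteq> {\<one>}" and c: "c \<in> carrier G"
  obtains b where "b \<in> A" "b \<noteq> \<one>" "c \<otimes> b = b \<otimes> c"
proof -
  interpret A: subgroup A G by fact
  obtain a where a: "a \<in> A" "a \<noteq> \<one>" using \<open>A \<noteq> {\<one>}\<close> A.one_closed by blast
  define \<delta> where "\<delta> = (\<lambda>b. b \<otimes> inv (inv c \<otimes> b \<otimes> c))"
  have "\<delta> b \<in> A" if "b \<in> A" for b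
    using A(2)[OF that, of "inv c"] c that by (simp add: \<delta>_def)
  then have \<delta>A: "(\<delta> ^^ k) a \<in> A" for k by (induction k) (auto simp: a)
  obtain n where n: "lam_eq_rho G a (inv c) (PE_seq G c) n"
    using assms(1) A.mem_carrier[OF a(1)] c unfolding engel_like_def by blast
  from lam_rho_eq_mono[OF this, of "n + 2"] lam_rho_engel[OF A a(1) c, of n]
  obtain l r where lr: "l \<in> A" "r \<in> A" "l \<otimes> inv (c [^] (n + 2)) = r \<otimes> inv (c [^] (n + 2))"
     "l \<otimes> inv r = (\<delta> ^^ (n + 2)) a" unfolding \<delta>_def by auto
  have "l = r" using lr(1-3) c by (metis A.mem_carrier right_cancel inv_closed nat_pow_closed)
  then have ex: "(\<delta> ^^ (n + 2)) a = \<one>" using lr by simp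
  define k where "k = (LEAST k. (\<delta> ^^ k) a = \<one>)"
  have k: "(\<delta> ^^ k) a = \<one>" unfolding k_def using ex by (rule LeastI)
  then obtain j where j: "k = Suc j" using a by (cases k) auto
  define b where "b = (\<delta> ^^ j) a"
  have b: "b \<in> A" "b \<noteq> \<one>"
    using \<delta>A not_less_Least[of j "\<lambda>k. (\<delta> ^^ k) a = \<one>"] j by (auto simp: b_def k_def)
  have bG: "b \<in> carrier G" using b by auto
  have "\<delta> b = \<one>" using k j by (simp add: b_def)
  then have "b \<otimes> inv (inv c \<otimes> b \<otimes> c) \<otimes> (inv c \<otimes> b \<otimes> c) = inv c \<otimes> b \<otimes> c"
    using bG c by (simp add: \<delta>_def)
  then have "b = inv c \<otimes> b \<otimes> c" using bG c by (simp add: m_assoc)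
  then have "c \<otimes> b = c \<otimes> (inv c \<otimes> b \<otimes> c)" by simp
  then have "c \<otimes> b = b \<otimes> c" using bG c by (simp add: m_assoc)
  with b that show thesis by blast
qed

section \<open>Central elements inside an abelian normal subgroup\<close>

lemma centralizer_subgroup:
  assumes "X \<subseteq> carrier G"
  shows "subgroup {g \<in> carrier G. \<forall>x\<in>X. g \<otimes> x = x \<otimes> g} G"
proof (rule subgroupI)
  fix a assume "a \<in> {g \<in> carrier G. \<forall>x\<in>X. g \<otimes> x = x \<otimes> g}"
  then have a: "a \<in> carrier G" "\<And>x. x \<in> X \<Longrightarrow> a \<otimes> x = x \<otimes> a" by auto
  have "inv a \<otimes> x = x \<otimes> inv a" if x: "x \<in> X" for x
  proof -
    have xG: "x \<in> carrier G" using x assms by blast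
    have "inv a \<otimes> x = inv a \<otimes> (x \<otimes> a) \<otimes> inv a" using a(1) xG by (simp add: m_assoc)
    also have "\<dots> = x \<otimes> inv a" unfolding a(2)[OF x, symmetric] using a(1) xG by simp
    finally show ?thesis .
  qed
  then show "inv a \<in> {g \<in> carrier G. \<forall>x\<in>X. g \<otimes> x = x \<otimes> g}" using a(1) by simp
  fix b assume "b \<in> {g \<in> carrier G. \<forall>x\<in>X. g \<otimes> x = x \<otimes> g}"
  then have b: "b \<in> carrier G" "\<And>x. x \<in> X \<Longrightarrow> b \<otimes> x = x \<otimes> b" by auto
  have "a \<otimes> b \<otimes> x = x \<otimes> (a \<otimes> b)" if x: "x \<in> X" for x
  proof -
    have xG: "x \<in> carrier G" using x assms by blast
    have "a \<otimes> b \<otimes> x = a \<otimes> (b \<otimes> x)" using a(1) b(1) xG by (simp add: m_assoc)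
    also have "\<dots> = (a \<otimes> x) \<otimes> b" unfolding b(2)[OF x] using a(1) b(1) xG by (simp add: m_assoc)
    also have "\<dots> = x \<otimes> (a \<otimes> b)" unfolding a(2)[OF x] using a(1) b(1) xG by (simp add: m_assoc)
    finally show ?thesis .
  qed
  then show "a \<otimes> b \<in> {g \<in> carrier G. \<forall>x\<in>X. g \<otimes> x = x \<otimes> g}" using a(1) b(1) by simp
qed (use assms in \<open>auto intro!: exI[of _ \<one>]\<close>)

text \<open>Take a smallest nontrivial normal subgroup \<open>B\<close> inside \<open>A\<close> and
  its centralizer \<open>D\<close>, which contains \<open>A\<close> and hence a term of the lower
  central series. If \<open>D\<close> were proper, an element \<open>c\<close> outside
  \<open>D\<close> whose commutators all lie in \<open>D\<close> would have a normal subgroup of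
  fixed points in \<open>B\<close>: nontrivial by the Engel condition, proper because
  \<open>c\<close> is not in \<open>D\<close>. So \<open>B\<close> is central.\<close>

lemma engel_like_center_nontrivial:
  assumes fin: "finite (carrier G)" and eng: "engel_like G"
    and A: "subgroup A G" "\<And>b g. b \<in> A \<Longrightarrow> g \<in> carrier G \<Longrightarrow> g \<otimes> b \<otimes> inv g \<in> A"
      "\<And>b b'. b \<in> A \<Longrightarrow> b' \<in> A \<Longrightarrow> b \<otimes> b' = b' \<otimes> b"
    and "A \<noteq> {\<one>}" and lc: "lower_central G n \<subseteq> A"
  obtains x where "x \<in> carrier G" "x \<noteq> \<one>" "\<And>y. y \<in> carrier G \<Longrightarrow> x \<otimes> y = y \<otimes> x"
proof -
  define F where "F B \<longleftrightarrow> subgroup B G \<and> (\<forall>b\<in>B. \<forall>g\<in>carrier G. g \<otimes> b \<otimes> inv g \<in> B) \<and> B \<subseteq> A \<and> B \<noteq> {\<one>}"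
    for B
  have "F A" using assms by (simp add: F_def)
  from ex_has_least_nat[of F, OF this, of card]
  obtain B where B: "F B" and min: "\<And>B'. F B' \<Longrightarrow> card B \<le> card B'" by blast
  interpret B: subgroup B G using B by (simp add: F_def)
  have conj: "g \<otimes> b \<otimes> inv g \<in> B" if "b \<in> B" "g \<in> carrier G" for b g
    using B that by (simp add: F_def)
  have BA: "B \<subseteq> A" "B \<noteq> {\<one>}" using B by (auto simp: F_def)
  define D where "D = {g \<in> carrier G. \<forall>b\<in>B. g \<otimes> b = b \<otimes> g}"
  have "A \<subseteq> D" using subgroup.subset[OF A(1)] A(3) BA by (auto simp: D_def)
  have "carrier G \<subseteq> D"
  proof (rule ccontr)
    assume "\<not> carrier G \<subseteq> D"
    then obtain i where i: "\<not> lower_central G i \<subseteq> D" "lower_central G (Suc i) \<subseteq> D"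
      using lower_central_jump lc \<open>A \<subseteq> D\<close> by (metis subset_trans)
    then obtain c where c: "c \<in> lower_central G i" "c \<notin> D" by blast
    have cG: "c \<in> carrier G" using c(1) by (rule lower_central_closed)
    define B' where "B' = {b \<in> B. c \<otimes> b = b \<otimes> c}"
    have "B' = B \<inter> {g \<in> carrier G. \<forall>x\<in>{c}. g \<otimes> x = x \<otimes> g}" by (auto simp: B'_def)
    then have "subgroup B' G"
      using subgroups_Inter_pair[OF B.subgroup_axioms centralizer_subgroup[of "{c}"]] cG by simp
    moreover have "g \<otimes> b \<otimes> inv g \<in> B'" if b: "b \<in> B'" and g: "g \<in> carrier G" for b g
    proof -
      \<comment> \<open>\<open>d\<close> is the commutator with c g = g c d. It centralizes
        \<open>B\<close>, so conjugation by \<open>g\<close> preserves commuting with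
        \<open>c\<close>.\<close>
      define d where "d = inv c \<otimes> inv g \<otimes> c \<otimes> g"
      have "inv c \<in> lower_central G i"
        using c(1) by (rule subgroup.m_inv_closed[OF lower_central_subgroup])
      from lower_central_comm[OF this, of "inv g"] have "d \<in> D"
        using g cG i by (auto simp: d_def)
      then have d: "d \<in> carrier G" "d \<otimes> b = b \<otimes> d" using b by (auto simp: D_def B'_def)
      have bG: "b \<in> carrier G" "c \<otimes> b = b \<otimes> c" using b by (auto simp: B'_def)
      have cg: "c \<otimes> g = g \<otimes> (c \<otimes> d)" using cG g by (simp add: d_def m_assoc)
      have "c \<otimes> (g \<otimes> b \<otimes> inv g) = (c \<otimes> g) \<otimes> b \<otimes> inv g" using cG g bG by (simp add: m_assoc)
      also have "\<dots> = g \<otimes> c \<otimes> (d \<otimes> b) \<otimes> inv g" unfolding cg using cG g bG(1) d(1) by (simp add: m_assoc)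
      also have "\<dots> = g \<otimes> (c \<otimes> b) \<otimes> d \<otimes> inv g" unfolding d(2) using cG g bG(1) d(1) by (simp add: m_assoc)
      also have "\<dots> = g \<otimes> b \<otimes> (c \<otimes> d) \<otimes> inv g" unfolding bG(2) using cG g bG(1) d(1) by (simp add: m_assoc)
      also have "\<dots> = g \<otimes> b \<otimes> inv g \<otimes> c" using cG g bG(1) by (simp add: d_def m_assoc)
      finally show ?thesis using conj[OF _ g] b by (simp add: B'_def)
    qed
    moreover have "B' \<noteq> {\<one>}"
    proof -
      obtain b where "b \<in> B" "b \<noteq> \<one>" "c \<otimes> b = b \<otimes> c"
        using engel_like_fixed_point[OF eng B.subgroup_axioms conj _ BA(2) cG] A(3) BA(1) by blast
      then show ?thesis by (auto simp: B'_def)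
    qed
    ultimately have "F B'" using BA(1) by (auto simp: F_def B'_def)
    then have "card B \<le> card B'" by (rule min)
    moreover have "B' \<subset> B" using c cG by (auto simp: B'_def D_def)
    moreover have "finite B" using fin B.subset by (rule rev_finite_subset)
    ultimately show False using psubset_card_mono[of B B'] by simp
  qed
  then have comm: "g \<otimes> b = b \<otimes> g" if "g \<in> carrier G" "b \<in> B" for g b
    using that by (auto simp: D_def)
  obtain x where x: "x \<in> B" "x \<noteq> \<one>" using BA(2) B.one_closed by blast
  show thesis
  proof (rule that[OF _ x(2)])
    show "x \<otimes> y = y \<otimes> x" if "y \<in> carrier G" for y using comm[OF that x(1)] by simp
  qed (use x(1) in auto)
qed

lemma finite_closed_subgroup:
  assumes "H \<subseteq> carrier G" "finite H" "H \<noteq> {}" "\<And>x y. x \<in> H \<Longrightarrow> y \<in> H \<Longrightarrow> x \<otimes> y \<in> H"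
  shows "subgroup H G"
proof -
  have surj: "(\<lambda>y. x \<otimes> y) ` H = H" if "x \<in> H" for x
  proof (rule endo_inj_surj[OF assms(2)])
    show "inj_on (\<lambda>y. x \<otimes> y) H"
      using that assms(1) by (intro inj_onI) (metis inv_cancel_left(1) subsetD)
  qed (use that assms in auto)
  have one: "\<one> \<in> H"
  proof -
    obtain x where x: "x \<in> H" using assms(3) by blast
    then obtain y where y: "y \<in> H" "x = x \<otimes> y" using surj[OF x] by (metis imageE)
    have xy: "x \<in> carrier G" "y \<in> carrier G" using x y assms(1) by auto
    have "y = inv x \<otimes> (x \<otimes> y)" using xy by simp
    also have "\<dots> = \<one>" using y(2)[symmetric] xy by simp
    finally show ?thesis using y by simp
  qed
  show ?thesis
  proof (rule subgroupI)
    fix x assume x: "x \<in> H"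
    obtain y where "y \<in> H" "\<one> = x \<otimes> y" using surj[OF x] one by (metis imageE)
    moreover have "inv x \<otimes> (x \<otimes> y) = y" using calculation x assms(1) by (intro inv_cancel_left) auto
    moreover have "inv x \<otimes> \<one> = inv x" using x assms(1) by auto
    ultimately show "inv x \<in> H" by simp
  qed (use assms in auto)
qed

end

section \<open>Simple groups with nilpotent proper subgroups\<close>

text \<open>These assumptions are contradictory, and the context exists to derive that.
  \<open>centerless\<close> excludes the groups of prime order, which satisfy all the
  others.\<close>

locale simple_schmidt_group = group G for G (structure) +
  assumes fin: "finite (carrier G)"
    and proper_nilpotent: "subgroup H G \<Longrightarrow> H \<noteq> carrier G \<Longrightarrow> nilpotent_group (G\<lparr>carrier := H\<rparr>)"
    and simple: "subgroup N G \<Longrightarrow> (\<And>n g. n \<in> N \<Longrightarrow> g \<in> carrier G \<Longrightarrow> g \<otimes> n \<otimes> inv g \<in> N)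
        \<Longrightarrow> N = {\<one>} \<or> N = carrier G"
    and centerless: "x \<in> carrier G \<Longrightarrow> (\<And>y. y \<in> carrier G \<Longrightarrow> x \<otimes> y = y \<otimes> x) \<Longrightarrow> x = \<one>"
    and nontrivial: "carrier G \<noteq> {\<one>}"
begin

section \<open>Maximal subgroups and their intersections\<close>

definition maxi :: "'a set \<Rightarrow> bool" where
  "maxi M \<longleftrightarrow> subgroup M G \<and> M \<noteq> carrier G \<and>
     (\<forall>K. subgroup K G \<longrightarrow> M \<subseteq> K \<longrightarrow> K \<noteq> carrier G \<longrightarrow> K = M)"

lemma maxi_subgroup: "maxi M \<Longrightarrow> subgroup M G" by (simp add: maxi_def)

lemma finite_subgroup: "subgroup H G \<Longrightarrow> finite H"
  using subgroup.subset[of H G] fin finite_subset by blast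

lemma ex_maxi:
  assumes "subgroup H G" "H \<noteq> carrier G"
  obtains M where "maxi M" "H \<subseteq> M"
proof -
  define F where "F K \<longleftrightarrow> subgroup K G \<and> K \<noteq> carrier G \<and> H \<subseteq> K" for K
  have bound: "\<forall>K. F K \<longrightarrow> card K < Suc (card (carrier G))"
    unfolding F_def less_Suc_eq_le using fin subgroup.subset card_mono by metis
  have "F H" using assms by (simp add: F_def)
  from ex_has_greatest_nat[of F, OF this bound]
  obtain M where M: "F M" "\<And>K. F K \<Longrightarrow> card K \<le> card M" by blast
  have "K = M" if "subgroup K G" "M \<subseteq> K" "K \<noteq> carrier G" for K
  proof -
    have "F K" using that M(1) unfolding F_def by blast
    then have "card K \<le> card M" by (rule M(2))
    then show ?thesis using that(2) finite_subgroup[OF that(1)] card_seteq by blast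
  qed
  then have "maxi M" using M(1) unfolding maxi_def F_def by blast
  moreover have "H \<subseteq> M" using M(1) by (simp add: F_def)
  ultimately show thesis by (rule that)
qed

text \<open>The centralizer of \<open>x\<close> contains \<open>x\<close> and is proper unless
  \<open>x\<close> is central, hence trivial; the identity lies in every maximal subgroup.\<close>

lemma mem_maxi:
  assumes "x \<in> carrier G"
  obtains M where "maxi M" "x \<in> M"
proof -
  define C where "C = {y \<in> carrier G. \<forall>z\<in>{x}. y \<otimes> z = z \<otimes> y}"
  have "subgroup C G" unfolding C_def by (rule centralizer_subgroup) (use assms in simp)
  show thesis
  proof (cases "C = carrier G")
    case False
    obtain M where "maxi M" "C \<subseteq> M" by (rule ex_maxi[OF \<open>subgroup C G\<close> False])
    then show thesis using that[of M] assms by (auto simp: C_def)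
  next
    case True
    have "x \<otimes> y = y \<otimes> x" if "y \<in> carrier G" for y
      using that[folded True] by (simp add: C_def)
    then have "x = \<one>" by (rule centerless[OF assms])
    moreover obtain M where "maxi M" by (rule ex_maxi[OF triv_subgroup]) (use nontrivial in auto)
    ultimately show thesis using that[of M] subgroup.one_closed[OF maxi_subgroup] by blast
  qed
qed

text \<open>Only an inclusion of conjugates is required; in a finite group this is the usual
  normalizer.\<close>

definition normer :: "'a set \<Rightarrow> 'a set" where
  "normer D = {g \<in> carrier G. \<forall>d\<in>D. g \<otimes> d \<otimes> inv g \<in> D}"

lemma normer_subgroup:
  assumes "subgroup D G"
  shows "subgroup (normer D) G" "D \<subseteq> normer D"
proof -
  interpret D: subgroup D G by fact
  show "subgroup (normer D) G"
  proof (rule finite_closed_subgroup)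
    show "normer D \<subseteq> carrier G" "finite (normer D)" using fin by (auto simp: normer_def)
    show "normer D \<noteq> {}" by (auto simp: normer_def intro!: exI[of _ \<one>])
    fix x y assume x: "x \<in> normer D" and y: "y \<in> normer D"
    have xy: "x \<in> carrier G" "y \<in> carrier G" using x y by (auto simp: normer_def)
    have "x \<otimes> y \<otimes> d \<otimes> inv (x \<otimes> y) \<in> D" if d: "d \<in> D" for d
    proof -
      have "y \<otimes> d \<otimes> inv y \<in> D" using y d by (simp add: normer_def)
      then have "x \<otimes> (y \<otimes> d \<otimes> inv y) \<otimes> inv x \<in> D" using x by (simp add: normer_def)
      then show ?thesis using xy D.mem_carrier[OF d] by (simp add: m_assoc inv_mult_group)
    qed
    then show "x \<otimes> y \<in> normer D" using xy by (simp add: normer_def)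
  qed
  show "D \<subseteq> normer D" by (auto simp: normer_def)
qed

lemma normer_proper:
  assumes "subgroup D G" "D \<noteq> {\<one>}" "D \<noteq> carrier G"
  shows "normer D \<noteq> carrier G"
proof
  assume *: "normer D = carrier G"
  have "D = {\<one>} \<or> D = carrier G"
  proof (rule simple[OF assms(1)])
    show "g \<otimes> d \<otimes> inv g \<in> D" if "d \<in> D" "g \<in> carrier G" for d g
      using that(1) that(2)[folded *] by (simp add: normer_def)
  qed
  with assms show False by blast
qed

text \<open>In the nilpotent group \<open>M\<close>, a proper subgroup is strictly contained in its
  normalizer.\<close>

lemma normer_grows:
  assumes "subgroup D G" "maxi M" "D \<subset> M"
  obtains g where "g \<in> M" "g \<notin> D" "g \<in> normer D"
proof -
  have M: "subgroup M G" "M \<noteq> carrier G" using assms(2) by (auto simp: maxi_def)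
  interpret M: group "G\<lparr>carrier := M\<rparr>" using M(1) by (rule subgroup_imp_group)
  have "subgroup D (G\<lparr>carrier := M\<rparr>)" using subgroup_incl assms M by blast
  then obtain g where g: "g \<in> M" "g \<notin> D"
     "\<And>d. d \<in> D \<Longrightarrow> g \<otimes> d \<otimes> inv\<^bsub>G\<lparr>carrier := M\<rparr>\<^esub> g \<in> D"
    using M.nilpotent_normalizer[OF proper_nilpotent[OF M], of D] assms(3) by auto
  have "g \<in> normer D"
    using g m_inv_consistent[OF M(1) g(1)] subgroup.mem_carrier[OF M(1) g(1)]
    by (simp add: normer_def)
  with g that show thesis by blast
qed

text \<open>For a pair with largest intersection \<open>D\<close>, both subgroups meet the normalizer of \<open>D\<close> in more than
  \<open>D\<close>, so both equal any maximal subgroup containing that normalizer.\<close>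

lemma maxi_inter_trivial:
  assumes "maxi M1" "maxi M2" "M1 \<noteq> M2"
  shows "M1 \<inter> M2 = {\<one>}"
proof (rule ccontr)
  assume contra: "M1 \<inter> M2 \<noteq> {\<one>}"
  define F where "F P \<longleftrightarrow> (case P of (M, N) \<Rightarrow> maxi M \<and> maxi N \<and> M \<noteq> N)" for P
  define c where "c = (\<lambda>P :: 'a set \<times> 'a set. card (fst P \<inter> snd P))"
  have bound: "\<forall>P. F P \<longrightarrow> c P < Suc (card (carrier G))"
  proof (intro allI impI)
    fix P assume "F P"
    then have "subgroup (fst P) G" by (auto simp: F_def maxi_def)
    from subgroup.subset[OF this] show "c P < Suc (card (carrier G))" unfolding c_def less_Suc_eq_le
      by (intro card_mono[OF fin]) blast
  qed
  have "F (M1, M2)" using assms by (simp add: F_def)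
  from ex_has_greatest_nat[of F, OF this bound]
  obtain N1 N2 where "F (N1, N2)" and mx: "\<And>P. F P \<Longrightarrow> c P \<le> c (N1, N2)" by fast
  then have N: "maxi N1" "maxi N2" "N1 \<noteq> N2" by (auto simp: F_def)
  define D where "D = N1 \<inter> N2"
  have D: "subgroup D G" unfolding D_def
    using N subgroups_Inter_pair maxi_subgroup by blast
  have "D \<noteq> {\<one>}"
  proof
    assume D1: "D = {\<one>}"
    have "card (M1 \<inter> M2) \<le> card D" using mx[OF \<open>F (M1, M2)\<close>] by (simp add: c_def D_def)
    moreover have "{\<one>} \<subseteq> M1 \<inter> M2"
      using assms subgroup.one_closed[OF maxi_subgroup] by blast
    moreover have "finite (M1 \<inter> M2)" using assms finite_subgroup[OF maxi_subgroup] by blast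
    ultimately have "{\<one>} = M1 \<inter> M2" using D1 by (intro card_seteq) auto
    with contra show False by simp
  qed
  have DN: "D \<subset> N1" "D \<subset> N2"
    using N unfolding D_def maxi_def by blast+
  have "D \<noteq> carrier G" using DN(1) subgroup.subset[OF maxi_subgroup[OF N(1)]] by blast
  obtain M3 where M3: "maxi M3" "normer D \<subseteq> M3"
    by (rule ex_maxi[OF normer_subgroup(1)[OF D] normer_proper[OF D \<open>D \<noteq> {\<one>}\<close> \<open>D \<noteq> carrier G\<close>]])
  have "N = M3" if mN: "maxi N" "D \<subset> N" for N
  proof (rule ccontr)
    assume "N \<noteq> M3"
    then have "c (N, M3) \<le> c (N1, N2)" using mx[of "(N, M3)"] mN M3 by (simp add: F_def)
    moreover obtain g where g: "g \<in> N" "g \<notin> D" "g \<in> normer D" by (rule normer_grows[OF D mN])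
    have "insert g D \<subseteq> N \<inter> M3" using mN g M3 normer_subgroup(2)[OF D] by blast
    then have "card (insert g D) \<le> card (N \<inter> M3)"
      using finite_subgroup[OF maxi_subgroup[OF mN(1)]] by (intro card_mono) auto
    then have "Suc (card D) \<le> card (N \<inter> M3)" using g(2) finite_subgroup[OF D] by simp
    ultimately show False by (simp add: c_def D_def)
  qed
  from this[OF N(1) DN(1)] this[OF N(2) DN(2)] N(3) show False by simp
qed

lemma maxi_self_normalizing:
  assumes "maxi M" "M \<noteq> {\<one>}"
  shows "normer M = M"
proof -
  have M: "subgroup M G" "M \<noteq> carrier G" using assms(1) by (auto simp: maxi_def)
  show ?thesis
    using assms(1) normer_subgroup[OF M(1)] normer_proper[OF M(1) assms(2) M(2)] unfolding maxi_def
    by blast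
qed

lemma conj_subgroup:
  assumes "subgroup M G" "g \<in> carrier G"
  shows "subgroup ((\<lambda>m. g \<otimes> m \<otimes> inv g) ` M) G"
proof -
  interpret M: subgroup M G by fact
  show ?thesis
  proof (rule finite_closed_subgroup)
    show "finite ((\<lambda>m. g \<otimes> m \<otimes> inv g) ` M)" using finite_subgroup[OF assms(1)] by simp
    show "(\<lambda>m. g \<otimes> m \<otimes> inv g) ` M \<noteq> {}" using M.one_closed by blast
    fix x y assume "x \<in> (\<lambda>m. g \<otimes> m \<otimes> inv g) ` M" "y \<in> (\<lambda>m. g \<otimes> m \<otimes> inv g) ` M"
    then obtain m n where mn: "m \<in> M" "n \<in> M" "x = g \<otimes> m \<otimes> inv g" "y = g \<otimes> n \<otimes> inv g" by blast
    then have "x \<otimes> y = g \<otimes> (m \<otimes> n) \<otimes> inv g" using assms(2) by (simp add: m_assoc)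
    then show "x \<otimes> y \<in> (\<lambda>m. g \<otimes> m \<otimes> inv g) ` M" using mn by blast
  qed (use assms(2) in auto)
qed

lemma maxi_conj:
  assumes "maxi M" "g \<in> carrier G"
  shows "maxi ((\<lambda>m. g \<otimes> m \<otimes> inv g) ` M)"
proof -
  have M: "subgroup M G" "M \<noteq> carrier G" using assms(1) by (auto simp: maxi_def)
  note MG = subgroup.subset[OF M(1)]
  let ?c = "\<lambda>g m. g \<otimes> m \<otimes> inv g"
  have cc: "?c (inv g) (?c g m) = m" "?c g (?c (inv g) m) = m" if "m \<in> carrier G" for m
    using that assms(2) by (simp_all add: m_assoc)
  have "?c g ` M \<noteq> carrier G"
  proof
    assume *: "?c g ` M = carrier G"
    have "carrier G \<subseteq> M"
    proof
      fix x assume x: "x \<in> carrier G"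
      then have "?c g x \<in> ?c g ` M" using * assms(2) by simp
      then obtain m where "m \<in> M" "?c g x = ?c g m" by blast
      then show "x \<in> M" using cc(1)[OF x] cc(1)[of m] MG by auto
    qed
    then show False using M MG by blast
  qed
  moreover have "K = ?c g ` M" if K: "subgroup K G" "?c g ` M \<subseteq> K" "K \<noteq> carrier G" for K
  proof -
    note KG = subgroup.subset[OF K(1)]
    have sub: "subgroup (?c (inv g) ` K) G" using conj_subgroup[OF K(1) inv_closed[OF assms(2)]] .
    have "M \<subseteq> ?c (inv g) ` K"
    proof
      fix m assume m: "m \<in> M"
      then have "?c g m \<in> K" using K(2) by blast
      moreover have "m = ?c (inv g) (?c g m)" using cc(1)[of m] m MG by auto
      ultimately show "m \<in> ?c (inv g) ` K" by (rule rev_image_eqI)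
    qed
    moreover have "?c (inv g) ` K \<noteq> carrier G"
    proof
      assume *: "?c (inv g) ` K = carrier G"
      have "carrier G \<subseteq> K"
      proof
        fix x assume x: "x \<in> carrier G"
        then have "?c (inv g) x \<in> ?c (inv g) ` K" using * assms(2) by simp
        then obtain m where "m \<in> K" "?c (inv g) x = ?c (inv g) m" by blast
        then show "x \<in> K" using cc(2)[OF x] cc(2)[of m] KG by auto
      qed
      then show False using K KG by blast
    qed
    ultimately have "?c (inv g) ` K = M" using assms(1) sub unfolding maxi_def by blast
    then have "?c g ` M = ?c g ` ?c (inv g) ` K" by simp
    also have "\<dots> = (\<lambda>x. x) ` K" unfolding image_image using cc(2) KG by (intro image_cong) auto
    finally show ?thesis by simp
  qed
  ultimately show ?thesis unfolding maxi_def using conj_subgroup[OF M(1) assms(2)] by blast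
qed

section \<open>Counting the nontrivial elements of conjugate maximal subgroups\<close>

definition conjs :: "'a set \<Rightarrow> 'a set" where
  "conjs M = (\<lambda>(g, m). g \<otimes> m \<otimes> inv g) ` (carrier G \<times> (M - {\<one>}))"

text \<open>Conjugates of maximal subgroups are maximal, and distinct maximal subgroups meet
  trivially; a common nontrivial element therefore identifies the two.\<close>

lemma conj_eq_imp_coset:
  assumes "maxi M" "maxi N" "m \<in> M - {\<one>}" "n \<in> N - {\<one>}" "g \<in> carrier G" "h \<in> carrier G"
    and eq: "g \<otimes> m \<otimes> inv g = h \<otimes> n \<otimes> inv h"
  shows "(\<lambda>m. inv h \<otimes> g \<otimes> m \<otimes> inv (inv h \<otimes> g)) ` M = N"
proof -
  define k where "k = inv h \<otimes> g"
  have k: "k \<in> carrier G" using assms by (simp add: k_def)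
  have mn: "m \<in> carrier G" "n \<in> carrier G"
    using assms subgroup.mem_carrier[OF maxi_subgroup] by blast+
  have "k \<otimes> m \<otimes> inv k = inv h \<otimes> (g \<otimes> m \<otimes> inv g) \<otimes> h"
    using assms(5,6) mn by (simp add: k_def m_assoc inv_mult_group)
  also have "\<dots> = n" unfolding eq using assms(5,6) mn by (simp add: m_assoc)
  finally have "n \<in> (\<lambda>m. k \<otimes> m \<otimes> inv k) ` M \<inter> N" using assms(3,4) by blast
  then have "(\<lambda>m. k \<otimes> m \<otimes> inv k) ` M \<inter> N \<noteq> {\<one>}" using assms(4) by blast
  then show ?thesis using maxi_inter_trivial[OF maxi_conj[OF assms(1) k] assms(2)] by (auto simp: k_def)
qed

text \<open>Count the pairs (g, m) with m nontrivial by the value g m g^-1. A fibre is parametrized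
  by \<open>M\<close>, sending k to (g k, k^-1 m k): the first components of two pairs with equal
  value differ by an element normalizing \<open>M\<close>, and \<open>M\<close> is
  self-normalizing.\<close>

lemma card_conjs:
  assumes "maxi M" "M \<noteq> {\<one>}"
  shows "card (conjs M) * card M = card (carrier G) * (card M - 1)"
proof -
  interpret M: subgroup M G using assms(1) by (rule maxi_subgroup)
  have finM: "finite M" by (rule finite_subgroup[OF M.subgroup_axioms])
  define X where "X = carrier G \<times> (M - {\<one>})"
  define f where "f = (\<lambda>(g, m). g \<otimes> m \<otimes> inv g)"
  have fX: "finite X" using fin finM by (simp add: X_def)
  have E: "conjs M = f ` X" by (simp add: conjs_def f_def X_def)
  have fibre: "card {p \<in> X. f p = e} = card M" if e: "e \<in> f ` X" for e
  proof -
    obtain g m where gm: "g \<in> carrier G" "m \<in> M" "m \<noteq> \<one>" "e = g \<otimes> m \<otimes> inv g"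
      using e by (auto simp: X_def f_def)
    have "bij_betw (\<lambda>k. (g \<otimes> k, inv k \<otimes> m \<otimes> k)) M {p \<in> X. f p = e}"
    proof (rule bij_betw_imageI)
      show "inj_on (\<lambda>k. (g \<otimes> k, inv k \<otimes> m \<otimes> k)) M"
        using gm by (intro inj_onI) (metis inv_cancel_left(1) M.mem_carrier prod.inject)
      show "(\<lambda>k. (g \<otimes> k, inv k \<otimes> m \<otimes> k)) ` M = {p \<in> X. f p = e}"
      proof (intro equalityI subsetI)
        fix p assume "p \<in> (\<lambda>k. (g \<otimes> k, inv k \<otimes> m \<otimes> k)) ` M"
        then obtain k where k: "k \<in> M" "p = (g \<otimes> k, inv k \<otimes> m \<otimes> k)" by blast
        have "inv k \<otimes> m \<otimes> k \<noteq> \<one>"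
        proof
          assume "inv k \<otimes> m \<otimes> k = \<one>"
          then have "k \<otimes> (inv k \<otimes> m \<otimes> k) \<otimes> inv k = \<one>" using k by simp
          then show False using gm k M.mem_carrier[OF k(1)] M.mem_carrier[OF gm(2)] by (simp add: m_assoc)
        qed
        then show "p \<in> {p \<in> X. f p = e}"
          using gm k M.mem_carrier[OF k(1)] M.mem_carrier[OF gm(2)]
          by (simp add: X_def f_def m_assoc inv_mult_group)
      next
        fix p assume "p \<in> {p \<in> X. f p = e}"
        then obtain h n where p: "p = (h, n)" "h \<in> carrier G" "n \<in> M - {\<one>}"
            "h \<otimes> n \<otimes> inv h = g \<otimes> m \<otimes> inv g"
          using gm(4) by (auto simp: X_def f_def)
        define k where "k = inv g \<otimes> h"
        have "(\<lambda>m. k \<otimes> m \<otimes> inv k) ` M = M"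
          unfolding k_def using conj_eq_imp_coset[OF assms(1) assms(1) p(3) _ p(2) gm(1) p(4)] gm by blast
        then have "k \<in> normer M" using gm p by (auto simp: normer_def k_def)
        then have k: "k \<in> M" using maxi_self_normalizing[OF assms] by simp
        have n: "n \<in> carrier G" "m \<in> carrier G" using p gm by auto
        have "inv k \<otimes> m \<otimes> k = inv h \<otimes> (g \<otimes> m \<otimes> inv g) \<otimes> h"
          using gm(1) p(2) n by (simp add: k_def m_assoc inv_mult_group)
        also have "\<dots> = n" unfolding p(4)[symmetric] using p(2) n by (simp add: m_assoc)
        finally have "p = (g \<otimes> k, inv k \<otimes> m \<otimes> k)" using p gm(1) by (simp add: k_def)
        then show "p \<in> (\<lambda>k. (g \<otimes> k, inv k \<otimes> m \<otimes> k)) ` M" using k by blast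
      qed
    qed
    from bij_betw_same_card[OF this] show ?thesis by simp
  qed
  have "card X = card (\<Union>e\<in>f ` X. {p \<in> X. f p = e})" by (rule arg_cong[of _ _ card]) auto
  also have "\<dots> = (\<Sum>e\<in>f ` X. card {p \<in> X. f p = e})"
    by (rule card_UN_disjoint) (use fX in auto)
  also have "\<dots> = card (f ` X) * card M" using fibre by simp
  finally show ?thesis unfolding E using finM by (simp add: X_def card_cartesian_product)
qed

text \<open>Since |M| is at least 2, the conjugates of a nontrivial maximal subgroup supply at least
  |G|/2 nontrivial elements, but not all |G| - 1 of them. A missed element lies in a maximal
  subgroup \<open>N\<close> none of whose conjugates shares a nontrivial element with those of
  \<open>M\<close>, so \<open>N\<close> supplies another |G|/2: too many.\<close>

lemma no_simple_schmidt_group: False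
proof -
  have conjs_sub: "conjs M \<subseteq> carrier G - {\<one>}" if M: "maxi M" for M
  proof
    fix x assume "x \<in> conjs M"
    then obtain g m where gm: "g \<in> carrier G" "m \<in> M" "m \<noteq> \<one>" "x = g \<otimes> m \<otimes> inv g"
      by (auto simp: conjs_def)
    have mG: "m \<in> carrier G" using subgroup.mem_carrier[OF maxi_subgroup[OF M] gm(2)] .
    have "x \<noteq> \<one>"
    proof
      assume "x = \<one>"
      then have "inv g \<otimes> (g \<otimes> m \<otimes> inv g) \<otimes> g = \<one>" using gm by simp
      then show False using gm mG by (simp add: m_assoc)
    qed
    then show "x \<in> carrier G - {\<one>}" using gm mG by simp
  qed
  have mem_conjs: "m \<in> conjs M" if "maxi M" "m \<in> M" "m \<noteq> \<one>" for m M
    using that subgroup.mem_carrier[OF maxi_subgroup[OF that(1)] that(2)] unfolding conjs_def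
    by (intro rev_image_eqI[of "(\<one>, m)"]) auto
  let ?N = "card (carrier G)"
  have half: "?N \<le> 2 * card (conjs M)" "2 \<le> card M" if M: "maxi M" "M \<noteq> {\<one>}" for M
  proof -
    have "{\<one>} \<subset> M" using M subgroup.one_closed[OF maxi_subgroup] by blast
    from psubset_card_mono[OF finite_subgroup[OF maxi_subgroup[OF M(1)]] this]
    show c2: "2 \<le> card M" by simp
    have "?N * card M \<le> ?N * (2 * (card M - 1))" using c2 by (intro mult_left_mono) auto
    also have "\<dots> = 2 * card (conjs M) * card M" using card_conjs[OF M] by simp
    finally show "?N \<le> 2 * card (conjs M)" using c2 by simp
  qed
  obtain x0 where x0: "x0 \<in> carrier G" "x0 \<noteq> \<one>" using nontrivial one_closed by blast
  obtain M where M: "maxi M" "x0 \<in> M" by (rule mem_maxi[OF x0(1)])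
  then have M1: "M \<noteq> {\<one>}" using x0 by blast
  have "conjs M \<noteq> carrier G - {\<one>}"
  proof
    assume "conjs M = carrier G - {\<one>}"
    then have "card (conjs M) = ?N - 1" using fin by simp
    \<comment> \<open>Cancelling in this equation gives |G| = |M|, although \<open>M\<close> is
      proper.\<close>
    then have "(?N - 1) * card M = ?N * (card M - 1)" using card_conjs[OF M(1) M1] by simp
    moreover have "0 < ?N" using fin card_gt_0_iff x0(1) by blast
    ultimately have "?N = card M" using half(2)[OF M(1) M1]
      by (cases ?N; cases "card M") (auto simp: algebra_simps)
    then have "M = carrier G"
      using subgroup.subset[OF maxi_subgroup[OF M(1)]] fin by (intro card_subset_eq) auto
    then show False using M(1) by (simp add: maxi_def)
  qed
  then obtain x where x: "x \<in> carrier G" "x \<noteq> \<one>" "x \<notin> conjs M" using conjs_sub[OF M(1)] by blast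
  obtain N where N: "maxi N" "x \<in> N" by (rule mem_maxi[OF x(1)])
  then have N1: "N \<noteq> {\<one>}" using x by blast
  have "conjs M \<inter> conjs N = {}"
  proof (rule ccontr)
    assume "conjs M \<inter> conjs N \<noteq> {}"
    then obtain y where "y \<in> conjs M" "y \<in> conjs N" by blast
    then obtain g m h n where *: "g \<in> carrier G" "m \<in> M - {\<one>}" "h \<in> carrier G" "n \<in> N - {\<one>}"
       "g \<otimes> m \<otimes> inv g = h \<otimes> n \<otimes> inv h" unfolding conjs_def by auto
    from conj_eq_imp_coset[OF M(1) N(1) *(2,4,1,3,5)] N(2)
    obtain m' where m': "m' \<in> M" "x = (inv h \<otimes> g) \<otimes> m' \<otimes> inv (inv h \<otimes> g)" by blast
    have "m' \<noteq> \<one>" using m' x * by auto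
    then have "x \<in> conjs M" using m' * unfolding conjs_def by force
    with x show False by blast
  qed
  then have "card (conjs M) + card (conjs N) = card (conjs M \<union> conjs N)"
    using conjs_sub M(1) N(1) fin by (intro card_Un_disjoint[symmetric]) (meson finite_Diff finite_subset)+
  also have "\<dots> \<le> card (carrier G - {\<one>})"
    using conjs_sub[OF M(1)] conjs_sub[OF N(1)] fin by (intro card_mono) auto
  also have "\<dots> < ?N" using fin by (intro psubset_card_mono) auto
  finally show False using half(1)[OF M(1) M1] half(1)[OF N(1) N1] by linarith
qed

end

section \<open>Nilpotency from the Engel-type identities\<close>

lemma lam_rho_carrier_update:
  "lam (G\<lparr>carrier := H\<rparr>) x y z n = lam G x y z n \<and> rho (G\<lparr>carrier := H\<rparr>) x y z n = rho G x y z n"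
  by (induction n) auto

lemma (in group_hom) hom_lam_rho:
  assumes "x \<in> carrier G" "y \<in> carrier G" "\<And>i. z i \<in> carrier G"
  shows "lam H (h x) (h y) (\<lambda>i. h (z i)) n = h (lam G x y z n) \<and>
         rho H (h x) (h y) (\<lambda>i. h (z i)) n = h (rho G x y z n)"
  by (induction n) (use G.lam_rho_closed[OF assms] assms in auto)

lemma (in group_hom) engel_like_image:
  assumes "engel_like G" "h ` carrier G = carrier H"
  shows "engel_like H"
  unfolding engel_like_def
proof (intro ballI)
  fix a c assume ac: "a \<in> carrier H" "c \<in> carrier H"
  obtain a' where a': "a' \<in> carrier G" "a = h a'" using ac(1) assms(2) by blast
  obtain c' where c': "c' \<in> carrier G" "c = h c'" using ac(2) assms(2) by blast
  obtain n where n: "lam_eq_rho G a' (inv\<^bsub>G\<^esub> c') (PE_seq G c') n"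
    using assms(1) a' c' unfolding engel_like_def by blast
  have "PE_seq H c = (\<lambda>i. h (PE_seq G c' i))"
    using c' by (auto simp: PE_seq_def hom_nat_pow)
  then have "lam_eq_rho H a (inv\<^bsub>H\<^esub> c) (PE_seq H c) n"
    using hom_lam_rho[of a' "inv\<^bsub>G\<^esub> c'" "PE_seq G c'" n] n a' c' G.PE_seq_closed[OF c'(1)] by simp
  then show "\<exists>n. lam_eq_rho H a (inv\<^bsub>H\<^esub> c) (PE_seq H c) n" by blast
qed

lemma (in group_hom) subgroup_vimage:
  assumes "subgroup K H"
  shows "subgroup {g \<in> carrier G. h g \<in> K} G"
proof -
  interpret K: subgroup K H by fact
  show ?thesis by (rule G.subgroupI) (auto intro: exI[of _ "\<one>\<^bsub>G\<^esub>"])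
qed

lemma (in group_hom) nilpotent_subgroup_image:
  assumes "subgroup K H" "h ` carrier G = carrier H"
    and "nilpotent_group (G\<lparr>carrier := {g \<in> carrier G. h g \<in> K}\<rparr>)"
  shows "nilpotent_group (H\<lparr>carrier := K\<rparr>)"
proof (rule group.nilpotent_hom_image)
  interpret K: subgroup K H by fact
  let ?K = "{g \<in> carrier G. h g \<in> K}"
  show "nilpotent_group (G\<lparr>carrier := ?K\<rparr>)" by fact
  show "group (G\<lparr>carrier := ?K\<rparr>)" using subgroup_vimage[OF assms(1)] by (rule G.subgroup_imp_group)
  show "group (H\<lparr>carrier := K\<rparr>)" using assms(1) by (rule H.subgroup_imp_group)
  show "h \<in> hom (G\<lparr>carrier := ?K\<rparr>) (H\<lparr>carrier := K\<rparr>)" by (rule homI) auto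
  show "h ` carrier (G\<lparr>carrier := ?K\<rparr>) = carrier (H\<lparr>carrier := K\<rparr>)"
  proof -
    have "y \<in> h ` ?K" if y: "y \<in> K" for y
    proof -
      obtain g where "g \<in> carrier G" "y = h g" using y assms(2) K.mem_carrier by blast
      with y show ?thesis by blast
    qed
    then show ?thesis by auto
  qed
qed

context group begin

lemma engel_like_subgroup:
  assumes "engel_like G" "subgroup H G"
  shows "engel_like (G\<lparr>carrier := H\<rparr>)"
  unfolding engel_like_def
proof (intro ballI)
  fix a c assume "a \<in> carrier (G\<lparr>carrier := H\<rparr>)" "c \<in> carrier (G\<lparr>carrier := H\<rparr>)"
  then have ac: "a \<in> H" "c \<in> H" "a \<in> carrier G" "c \<in> carrier G"
    using subgroup.subset[OF assms(2)] by auto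
  have "PE_seq (G\<lparr>carrier := H\<rparr>) c = PE_seq G c"
    by (auto simp: PE_seq_def fun_eq_iff simp flip: nat_pow_consistent)
  moreover obtain n where "lam_eq_rho G a (inv c) (PE_seq G c) n"
    using assms(1) ac unfolding engel_like_def by blast
  ultimately show "\<exists>n. lam_eq_rho (G\<lparr>carrier := H\<rparr>) a (inv\<^bsub>G\<lparr>carrier := H\<rparr>\<^esub> c) (PE_seq (G\<lparr>carrier := H\<rparr>) c) n"
    using m_inv_consistent[OF assms(2) ac(2)] by (auto simp: lam_rho_carrier_update)
qed

text \<open>\<open>quot\<close> expresses nilpotency of the quotient by \<open>N\<close> inside
  \<open>G\<close> itself, without forming a quotient group; it excludes a nontrivial centre of
  \<open>G\<close>. The centre \<open>A\<close> of a proper nontrivial normal subgroup is nontrivial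
  by nilpotency and normal in \<open>G\<close>, so the Engel condition would produce a nontrivial
  centre of \<open>G\<close>. What remains is the simple case.\<close>

lemma engel_like_minimal_nilpotent:
  assumes fin: "finite (carrier G)" and eng: "engel_like G"
    and sub: "\<And>H. subgroup H G \<Longrightarrow> H \<noteq> carrier G \<Longrightarrow> nilpotent_group (G\<lparr>carrier := H\<rparr>)"
    and quot: "\<And>N. subgroup N G \<Longrightarrow> (\<And>n g. n \<in> N \<Longrightarrow> g \<in> carrier G \<Longrightarrow> g \<otimes> n \<otimes> inv g \<in> N)
        \<Longrightarrow> N \<noteq> {\<one>} \<Longrightarrow> \<exists>n. lower_central G n \<subseteq> N"
  shows "nilpotent_group G"
proof (rule ccontr)
  assume nn: "\<not> nilpotent_group G"
  have centerless: "x = \<one>" if x: "x \<in> carrier G" "\<And>y. y \<in> carrier G \<Longrightarrow> x \<otimes> y = y \<otimes> x" for x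
  proof (rule ccontr)
    assume "x \<noteq> \<one>"
    define Z where "Z = {z \<in> carrier G. \<forall>y\<in>carrier G. z \<otimes> y = y \<otimes> z}"
    have "subgroup Z G" unfolding Z_def by (rule centralizer_subgroup) simp
    moreover have "g \<otimes> z \<otimes> inv g \<in> Z" if z: "z \<in> Z" and g: "g \<in> carrier G" for z g
    proof -
      have "z \<in> carrier G" "g \<otimes> z = z \<otimes> g" using z g by (auto simp: Z_def)
      then have "g \<otimes> z \<otimes> inv g = z" using g by (simp add: m_assoc)
      with z show ?thesis by simp
    qed
    moreover have "Z \<noteq> {\<one>}" using x \<open>x \<noteq> \<one>\<close> by (auto simp: Z_def)
    ultimately obtain n where "lower_central G n \<subseteq> Z" using quot by blast
    then have "nilpotent_group G"
      by (intro nilpotent_if_lower_central_central[of n]) (auto simp: Z_def)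
    with nn show False by simp
  qed
  have "simple_schmidt_group G"
  proof (unfold_locales)
    show "carrier G \<noteq> {\<one>}" using nn nilpotentI[of 0] by auto
    fix N assume N: "subgroup N G" "\<And>n g. n \<in> N \<Longrightarrow> g \<in> carrier G \<Longrightarrow> g \<otimes> n \<otimes> inv g \<in> N"
    show "N = {\<one>} \<or> N = carrier G"
    proof (rule ccontr)
      assume contra: "\<not> (N = {\<one>} \<or> N = carrier G)"
      interpret N: subgroup N G by fact
      interpret H: group "G\<lparr>carrier := N\<rparr>" using N(1) by (rule subgroup_imp_group)
      have "nilpotent_group (G\<lparr>carrier := N\<rparr>)" using sub N(1) contra by simp
      from H.nilpotent_center_nontrivial[OF this]
      obtain x where x: "x \<in> N" "x \<noteq> \<one>" "\<And>y. y \<in> N \<Longrightarrow> x \<otimes> y = y \<otimes> x" using contra by auto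
      define A where "A = {z \<in> N. \<forall>y\<in>N. z \<otimes> y = y \<otimes> z}"
      have "A = N \<inter> {g \<in> carrier G. \<forall>x\<in>N. g \<otimes> x = x \<otimes> g}" by (auto simp: A_def)
      then have A: "subgroup A G"
        using subgroups_Inter_pair[OF N(1) centralizer_subgroup[OF N.subset]] by simp
      have Ac: "g \<otimes> a \<otimes> inv g \<in> A" if a: "a \<in> A" and g: "g \<in> carrier G" for a g
      proof -
        have aN: "a \<in> N" "a \<in> carrier G" using a by (auto simp: A_def)
        have "g \<otimes> a \<otimes> inv g \<otimes> y = y \<otimes> (g \<otimes> a \<otimes> inv g)" if y: "y \<in> N" for y
        proof -
          have y': "inv g \<otimes> y \<otimes> g \<in> N" using N(2)[OF y, of "inv g"] g by simp
          have "g \<otimes> a \<otimes> inv g \<otimes> y = g \<otimes> (a \<otimes> (inv g \<otimes> y \<otimes> g)) \<otimes> inv g"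
            using g aN(2) y by (simp add: m_assoc)
          also have "a \<otimes> (inv g \<otimes> y \<otimes> g) = (inv g \<otimes> y \<otimes> g) \<otimes> a" using a y' by (simp add: A_def)
          also have "g \<otimes> \<dots> \<otimes> inv g = y \<otimes> (g \<otimes> a \<otimes> inv g)"
            using g aN(2) y by (simp add: m_assoc)
          finally show ?thesis .
        qed
        then show ?thesis using N(2)[OF aN(1) g] by (simp add: A_def)
      qed
      have A1: "A \<noteq> {\<one>}" using x by (auto simp: A_def)
      have "\<exists>n. lower_central G n \<subseteq> A" by (rule quot[OF A _ A1]) (rule Ac)
      then obtain n where n: "lower_central G n \<subseteq> A" by blast
      have comm: "b \<otimes> b' = b' \<otimes> b" if "b \<in> A" "b' \<in> A" for b b'
        using that unfolding A_def by blast
      show False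
      proof (rule engel_like_center_nontrivial[OF fin eng A Ac comm A1 n])
        fix z assume z: "z \<in> carrier G" "z \<noteq> \<one>" "\<And>y. y \<in> carrier G \<Longrightarrow> z \<otimes> y = y \<otimes> z"
        from centerless[OF z(1,3)] z(2) show False by simp
      qed
    qed
  qed (use fin sub centerless in auto)
  then show False by (rule simple_schmidt_group.no_simple_schmidt_group)
qed

text \<open>Choose a normal subgroup \<open>N\<close> of largest order with non-nilpotent quotient.
  Normal subgroups strictly above \<open>N\<close> then have nilpotent quotients, so
  \<open>G Mod N\<close> meets the hypotheses of \<open>engel_like_minimal_nilpotent\<close>; a
  single passage to a quotient is enough.\<close>

lemma engel_like_schmidt_nilpotent:
  assumes fin: "finite (carrier G)" and eng: "engel_like G"
    and sub: "\<And>H. subgroup H G \<Longrightarrow> H \<noteq> carrier G \<Longrightarrow> nilpotent_group (G\<lparr>carrier := H\<rparr>)"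
  shows "nilpotent_group G"
proof (rule ccontr)
  assume nn: "\<not> nilpotent_group G"
  define F where "F N \<longleftrightarrow> N \<lhd> G \<and> (\<forall>n. \<not> lower_central G n \<subseteq> N)" for N
  have "F {\<one>}" using one_is_normal nn nilpotentI by (auto simp: F_def)
  moreover have bound: "\<forall>N. F N \<longrightarrow> card N < Suc (card (carrier G))"
    using fin by (auto simp: F_def less_Suc_eq_le normal_imp_subgroup intro!: card_mono
        dest!: normal_imp_subgroup subgroup.subset)
  ultimately obtain N where N: "F N" "\<And>K. F K \<Longrightarrow> card K \<le> card N"
    using ex_has_greatest_nat[of F "{\<one>}" card] by blast
  interpret normal N G using N by (simp add: F_def)
  interpret Q: group "G Mod N" by (rule factorgroup_is_group)
  define h where "h = (\<lambda>a. N #> a)"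
  have hom: "h \<in> hom G (G Mod N)" unfolding h_def by (rule r_coset_hom_Mod)
  interpret h: group_hom G "G Mod N" h using hom by unfold_locales
  have surj: "h ` carrier G = carrier (G Mod N)" by (simp add: h_def carrier_FactGroup)
  have kernel: "g \<in> N" if "g \<in> carrier G" "h g = \<one>\<^bsub>G Mod N\<^esub>" for g
    using that rcos_self[OF that(1) subgroup_axioms] by (simp add: h_def)
  have "nilpotent_group (G Mod N)"
  proof (rule Q.engel_like_minimal_nilpotent)
    show "finite (carrier (G Mod N))" using fin surj by (metis finite_imageI)
    show "engel_like (G Mod N)" by (rule h.engel_like_image[OF eng surj])
  next
    fix H assume H: "subgroup H (G Mod N)" "H \<noteq> carrier (G Mod N)"
    interpret H: subgroup H "G Mod N" by fact
    define K where "K = {g \<in> carrier G. h g \<in> H}"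
    have K: "subgroup K G" unfolding K_def by (rule h.subgroup_vimage[OF H(1)])
    have "K \<noteq> carrier G"
    proof
      assume "K = carrier G"
      then have "h ` carrier G \<subseteq> H" by (auto simp: K_def)
      then show False using H(2) surj H.subset by auto
    qed
    then have "nilpotent_group (G\<lparr>carrier := K\<rparr>)" using sub K by blast
    then show "nilpotent_group ((G Mod N)\<lparr>carrier := H\<rparr>)"
      unfolding K_def by (rule h.nilpotent_subgroup_image[OF H(1) surj])
  next
    fix M assume M: "subgroup M (G Mod N)" "M \<noteq> {\<one>\<^bsub>G Mod N\<^esub>}"
      "\<And>n g. n \<in> M \<Longrightarrow> g \<in> carrier (G Mod N)
         \<Longrightarrow> g \<otimes>\<^bsub>G Mod N\<^esub> n \<otimes>\<^bsub>G Mod N\<^esub> inv\<^bsub>G Mod N\<^esub> g \<in> M"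
    interpret M: subgroup M "G Mod N" by fact
    define K where "K = {g \<in> carrier G. h g \<in> M}"
    have K: "subgroup K G" unfolding K_def by (rule h.subgroup_vimage[OF M(1)])
    have "K \<lhd> G"
    proof -
      have "x \<otimes> k \<otimes> inv x \<in> K" if "x \<in> carrier G" "k \<in> K" for x k
        using that M(3)[of "h k" "h x"] by (auto simp: K_def)
      then show ?thesis using K normal_inv_iff by blast
    qed
    have "N \<subseteq> K"
    proof
      fix g assume g: "g \<in> N"
      then have "h g = \<one>\<^bsub>G Mod N\<^esub>" using rcos_const[OF is_group g] by (simp add: h_def)
      then show "g \<in> K" using g M.one_closed by (simp add: K_def)
    qed
    moreover have "\<not> K \<subseteq> N"
    proof -
      obtain y where y: "y \<in> M" "y \<noteq> \<one>\<^bsub>G Mod N\<^esub>" using M(2) M.one_closed by blast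
      then obtain g where g: "g \<in> carrier G" "y = h g" using surj M.mem_carrier by blast
      have "g \<notin> N"
        using y(2) g(2) rcos_const[OF is_group, of g] by (auto simp: h_def)
      then show ?thesis using y g by (auto simp: K_def)
    qed
    ultimately have "card N < card K"
      using subgroup.subset[OF K] fin by (intro psubset_card_mono) (auto intro: finite_subset)
    then have "\<not> F K" using N(2) leD by blast
    then obtain n where n: "lower_central G n \<subseteq> K" using \<open>K \<lhd> G\<close> by (auto simp: F_def)
    have "lower_central (G Mod N) n \<subseteq> h ` lower_central G n"
      by (rule lower_central_hom_image[OF Q.is_group hom surj])
    also have "\<dots> \<subseteq> M" using n by (auto simp: K_def)
    finally show "\<exists>n. lower_central (G Mod N) n \<subseteq> M" by blast
  qed
  then obtain n where "lower_central (G Mod N) n = {\<one>\<^bsub>G Mod N\<^esub>}" by (auto simp: nilpotent_group_def)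
  then have "lower_central G n \<subseteq> N"
    using lower_central_hom_vimage[OF Q.is_group hom, of n] kernel by blast
  with N(1) show False by (simp add: F_def)
qed

text \<open>A non-nilpotent subgroup of least order has only nilpotent proper subgroups and inherits
  the Engel-type condition.\<close>

theorem engel_like_imp_nilpotent:
  assumes fin: "finite (carrier G)" and eng: "engel_like G"
  shows "nilpotent_group G"
proof (rule ccontr)
  assume nn: "\<not> nilpotent_group G"
  define F where "F H \<longleftrightarrow> subgroup H G \<and> \<not> nilpotent_group (G\<lparr>carrier := H\<rparr>)" for H
  have "F (carrier G)" using nn subgroup_self by (simp add: F_def)
  from ex_has_least_nat[of F, OF this, of card]
  obtain H where H: "F H" "\<And>K. F K \<Longrightarrow> card H \<le> card K" by blast
  have sH: "subgroup H G" using H by (simp add: F_def)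
  interpret H: group "G\<lparr>carrier := H\<rparr>" using sH by (rule subgroup_imp_group)
  have finH: "finite H" using subgroup.subset[OF sH] fin by (rule finite_subset)
  have "nilpotent_group (G\<lparr>carrier := H\<rparr>)"
  proof (rule H.engel_like_schmidt_nilpotent)
    show "engel_like (G\<lparr>carrier := H\<rparr>)" by (rule engel_like_subgroup[OF eng sH])
    fix K assume K: "subgroup K (G\<lparr>carrier := H\<rparr>)" "K \<noteq> carrier (G\<lparr>carrier := H\<rparr>)"
    have "K \<subset> H" using subgroup.subset[OF K(1)] K(2) by auto
    then have "card K < card H" using finH by (rule psubset_card_mono[rotated])
    then have "\<not> F K" using H(2) leD by blast
    then show "nilpotent_group (G\<lparr>carrier := H, carrier := K\<rparr>)"
      using incl_subgroup[OF sH K(1)] by (simp add: F_def)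
  qed (use finH in simp)
  with H(1) show False by (simp add: F_def)
qed

end

section \<open>Green's relations in finite monoids\<close>

lemma lam_rho_shift:
  "lam M x y z (m + n) = lam M (lam M x y z m) (rho M x y z m) (\<lambda>i. z (m + i)) n \<and>
   rho M x y z (m + n) = rho M (lam M x y z m) (rho M x y z m) (\<lambda>i. z (m + i)) n"
  by (induction n) auto

text \<open>\<open>I\<close> plays the semigroup and \<open>C\<close> the monoid with identity
  \<open>u\<close>. Associativity and the unit laws hold on the whole type, so products can be
  rearranged without membership conditions.\<close>

locale fin_monoid =
  fixes mul :: "'b \<Rightarrow> 'b \<Rightarrow> 'b" (infixl \<open>\<star>\<close> 70) and u :: 'b and I :: "'b set"
  assumes assoc: "x \<star> y \<star> z = x \<star> (y \<star> z)"
    and unit [simp]: "u \<star> x = x" "x \<star> u = x"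
    and finite_I: "finite I"
    and I_closed: "x \<in> I \<Longrightarrow> y \<in> I \<Longrightarrow> x \<star> y \<in> I"
begin

definition C :: "'b set" where "C = insert u I"

definition M :: "'b monoid" where "M = \<lparr>carrier = C, monoid.mult = (\<star>), one = u\<rparr>"

lemma M_simps [simp]: "carrier M = C" "x \<otimes>\<^bsub>M\<^esub> y = x \<star> y" "\<one>\<^bsub>M\<^esub> = u"
  by (simp_all add: M_def)

lemma finite_C: "finite C" by (simp add: C_def finite_I)

lemma C_closed [simp]: "x \<in> C \<Longrightarrow> y \<in> C \<Longrightarrow> x \<star> y \<in> C" "u \<in> C"
  by (auto simp: C_def I_closed)

lemma I_ideal: "x \<in> I \<Longrightarrow> y \<in> C \<Longrightarrow> x \<star> y \<in> I" "x \<in> I \<Longrightarrow> y \<in> C \<Longrightarrow> y \<star> x \<in> I"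
  by (auto simp: C_def I_closed)

lemma I_C: "x \<in> I \<Longrightarrow> x \<in> C" by (simp add: C_def)

lemma monoid_M: "monoid M" by (rule monoidI) (auto simp: assoc)

sublocale M: monoid M by (rule monoid_M)

lemma pow_simps [simp]: "c [^]\<^bsub>M\<^esub> (0::nat) = u" "c [^]\<^bsub>M\<^esub> Suc n = c [^]\<^bsub>M\<^esub> n \<star> c"
  using M.nat_pow_0[of c] M.nat_pow_Suc[of c n] by simp_all

lemma pow_C [simp]: "c \<in> C \<Longrightarrow> c [^]\<^bsub>M\<^esub> (n::nat) \<in> C"
  by (induction n) auto

lemma pow_Suc2: "c [^]\<^bsub>M\<^esub> Suc n = c \<star> c [^]\<^bsub>M\<^esub> n"
proof (induction n)
  case (Suc n)
  then show ?case by (simp add: assoc)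
qed simp

lemma pow_add: "c [^]\<^bsub>M\<^esub> (m + n :: nat) = c [^]\<^bsub>M\<^esub> m \<star> c [^]\<^bsub>M\<^esub> n"
  by (induction n) (auto simp: assoc)

text \<open>Powers repeat from exponent i on with period p, so a positive multiple of p that is at
  least i gives an idempotent. The exponent is a successor because the stability arguments split off
  one factor.\<close>

lemma idempotent_power:
  assumes "c \<in> C"
  obtains k :: nat where "c [^]\<^bsub>M\<^esub> Suc k \<star> c [^]\<^bsub>M\<^esub> Suc k = c [^]\<^bsub>M\<^esub> Suc k"
proof -
  have "\<not> inj_on (\<lambda>n::nat. c [^]\<^bsub>M\<^esub> n) UNIV"
  proof
    assume "inj_on (\<lambda>n::nat. c [^]\<^bsub>M\<^esub> n) UNIV"
    moreover have "range (\<lambda>n::nat. c [^]\<^bsub>M\<^esub> n) \<subseteq> C" using assms by auto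
    ultimately show False using finite_C finite_imageD infinite_UNIV_nat finite_subset by blast
  qed
  then obtain i j :: nat where "i < j" "c [^]\<^bsub>M\<^esub> i = c [^]\<^bsub>M\<^esub> j"
    unfolding inj_on_def by (metis linorder_neqE_nat)
  then obtain p where p: "0 < p" "c [^]\<^bsub>M\<^esub> i = c [^]\<^bsub>M\<^esub> (i + p)"
    by (metis less_imp_add_positive)
  have step: "c [^]\<^bsub>M\<^esub> (i + a) = c [^]\<^bsub>M\<^esub> (i + a + p)" for a
    using p(2) pow_add[of c i a] pow_add[of c "i + p" a] by (simp add: ac_simps)
  have per: "c [^]\<^bsub>M\<^esub> (i + a) = c [^]\<^bsub>M\<^esub> (i + a + b * p)" for a b
  proof (induction b)
    case (Suc b) then show ?case using step[of "a + b * p"] by (simp add: ac_simps)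
  qed simp
  define n where "n = Suc i * p"
  have "i \<le> n" using p(1) unfolding n_def by (cases p) auto
  then obtain a where a: "n = i + a" using le_Suc_ex by blast
  have "c [^]\<^bsub>M\<^esub> n \<star> c [^]\<^bsub>M\<^esub> n = c [^]\<^bsub>M\<^esub> (i + a + Suc i * p)"
    using a n_def by (simp flip: pow_add)
  also have "\<dots> = c [^]\<^bsub>M\<^esub> n" using per[of a "Suc i"] a by simp
  finally have "c [^]\<^bsub>M\<^esub> n \<star> c [^]\<^bsub>M\<^esub> n = c [^]\<^bsub>M\<^esub> n" .
  moreover have "n = Suc (n - 1)" using p(1) by (simp add: n_def)
  ultimately show thesis using that[of "n - 1"] by simp
qed

section \<open>Green's relations and stability\<close>

definition leJ where "leJ x y \<longleftrightarrow> (\<exists>s\<in>C. \<exists>t\<in>C. x = s \<star> y \<star> t)"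
definition R where "R x y \<longleftrightarrow> x \<in> C \<and> y \<in> C \<and> (\<exists>t\<in>C. x = y \<star> t) \<and> (\<exists>t\<in>C. y = x \<star> t)"
definition L where "L x y \<longleftrightarrow> x \<in> C \<and> y \<in> C \<and> (\<exists>t\<in>C. x = t \<star> y) \<and> (\<exists>t\<in>C. y = t \<star> x)"

lemma leJ_refl: "leJ x x" unfolding leJ_def by (rule bexI[of _ u], rule bexI[of _ u]) auto

lemma leJ_trans: "leJ x y \<Longrightarrow> leJ y z \<Longrightarrow> leJ x z"
  unfolding leJ_def
proof (elim bexE)
  fix s t s' t' assume *: "s \<in> C" "t \<in> C" "s' \<in> C" "t' \<in> C" "x = s \<star> y \<star> t" "y = s' \<star> z \<star> t'"
  show "\<exists>s\<in>C. \<exists>t\<in>C. x = s \<star> z \<star> t"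
    by (rule bexI[of _ "s \<star> s'"], rule bexI[of _ "t' \<star> t"]) (use * in \<open>auto simp: assoc\<close>)
qed

lemma leJ_mult:
  assumes "a \<in> C" "b \<in> C" shows "leJ (a \<star> b) a" "leJ (a \<star> b) b"
  unfolding leJ_def
   apply (rule bexI[of _ u], rule bexI[of _ b]) using assms apply auto[3]
  apply (rule bexI[of _ a], rule bexI[of _ u]) using assms by auto

lemma R_refl: "x \<in> C \<Longrightarrow> R x x" unfolding R_def by (auto intro: bexI[of _ u])
lemma L_refl: "x \<in> C \<Longrightarrow> L x x" unfolding L_def by (auto intro: bexI[of _ u])
lemma R_sym: "R x y \<Longrightarrow> R y x" unfolding R_def by blast
lemma L_sym: "L x y \<Longrightarrow> L y x" unfolding L_def by blast
lemma right_multiple_trans: "\<exists>t\<in>C. x = y \<star> t \<Longrightarrow> \<exists>t\<in>C. y = z \<star> t \<Longrightarrow> \<exists>t\<in>C. x = z \<star> t"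
proof (elim bexE)
  fix t t' assume "t \<in> C" "t' \<in> C" "x = y \<star> t" "y = z \<star> t'"
  then show "\<exists>t\<in>C. x = z \<star> t" by (intro bexI[of _ "t' \<star> t"]) (auto simp: assoc)
qed

lemma left_multiple_trans: "\<exists>t\<in>C. x = t \<star> y \<Longrightarrow> \<exists>t\<in>C. y = t \<star> z \<Longrightarrow> \<exists>t\<in>C. x = t \<star> z"
proof (elim bexE)
  fix t t' assume "t \<in> C" "t' \<in> C" "x = t \<star> y" "y = t' \<star> z"
  then show "\<exists>t\<in>C. x = t \<star> z" by (intro bexI[of _ "t \<star> t'"]) (auto simp: assoc)
qed

lemma R_trans: "R x y \<Longrightarrow> R y z \<Longrightarrow> R x z"
  unfolding R_def by (auto dest: right_multiple_trans intro: right_multiple_trans)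
lemma L_trans: "L x y \<Longrightarrow> L y z \<Longrightarrow> L x z"
  unfolding L_def by (auto intro: left_multiple_trans)
lemma R_C: "R x y \<Longrightarrow> x \<in> C" "R x y \<Longrightarrow> y \<in> C" by (auto simp: R_def)
lemma L_C: "L x y \<Longrightarrow> x \<in> C" "L x y \<Longrightarrow> y \<in> C" by (auto simp: L_def)
lemma L_cong:
  assumes "L x y" "w \<in> C" shows "L (x \<star> w) (y \<star> w)"
proof -
  obtain s t where st: "s \<in> C" "t \<in> C" "x = s \<star> y" "y = t \<star> x" using assms(1) by (auto simp: L_def)
  have "s \<star> (y \<star> w) = x \<star> w" "t \<star> (x \<star> w) = y \<star> w"
    unfolding assoc[symmetric] st(3,4)[symmetric] by (rule refl)+
  with st(1,2) L_C[OF assms(1)] assms(2) show ?thesis unfolding L_def by (metis C_closed(1))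
qed

text \<open>Iterating gives x = s^n x w^n for all n. At an exponent where w^n is idempotent, x w^n =
  x, and one factor \<open>w\<close> can be split off. This is stability of finite
  semigroups.\<close>

lemma stable_right:
  assumes "x \<in> C" "s \<in> C" "w \<in> C" "x = s \<star> (x \<star> w)"
  shows "\<exists>t\<in>C. x = x \<star> w \<star> t"
proof -
  have pw: "x = s [^]\<^bsub>M\<^esub> n \<star> x \<star> w [^]\<^bsub>M\<^esub> n" for n :: nat
  proof (induction n)
    case (Suc n)
    have "s [^]\<^bsub>M\<^esub> Suc n \<star> x \<star> w [^]\<^bsub>M\<^esub> Suc n = s [^]\<^bsub>M\<^esub> n \<star> (s \<star> (x \<star> w)) \<star> w [^]\<^bsub>M\<^esub> n"
      unfolding pow_Suc2[of w] by (simp add: assoc)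
    also have "\<dots> = x" using assms(4) Suc by simp
    finally show ?case by simp
  qed simp
  obtain k :: nat where k: "w [^]\<^bsub>M\<^esub> Suc k \<star> w [^]\<^bsub>M\<^esub> Suc k = w [^]\<^bsub>M\<^esub> Suc k"
    by (rule idempotent_power[OF assms(3)])
  have "x \<star> w [^]\<^bsub>M\<^esub> Suc k = s [^]\<^bsub>M\<^esub> Suc k \<star> x \<star> (w [^]\<^bsub>M\<^esub> Suc k \<star> w [^]\<^bsub>M\<^esub> Suc k)"
    using pw[of "Suc k"] by (metis assoc)
  also have "\<dots> = x" unfolding k using pw[of "Suc k"] by simp
  finally have "x = x \<star> w \<star> w [^]\<^bsub>M\<^esub> k" unfolding pow_Suc2 by (simp add: assoc)
  then show ?thesis using assms(3) by auto
qed

lemma stable_left: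
  assumes "x \<in> C" "s \<in> C" "w \<in> C" "x = s \<star> x \<star> w"
  shows "\<exists>t\<in>C. x = t \<star> (s \<star> x)"
proof -
  have pw: "x = s [^]\<^bsub>M\<^esub> n \<star> x \<star> w [^]\<^bsub>M\<^esub> n" for n :: nat
  proof (induction n)
    case (Suc n)
    have "s [^]\<^bsub>M\<^esub> Suc n \<star> x \<star> w [^]\<^bsub>M\<^esub> Suc n = s [^]\<^bsub>M\<^esub> n \<star> (s \<star> x \<star> w) \<star> w [^]\<^bsub>M\<^esub> n"
      unfolding pow_Suc2[of w] by (simp add: assoc)
    also have "\<dots> = x" using assms(4) Suc by simp
    finally show ?case by simp
  qed simp
  obtain k :: nat where k: "s [^]\<^bsub>M\<^esub> Suc k \<star> s [^]\<^bsub>M\<^esub> Suc k = s [^]\<^bsub>M\<^esub> Suc k"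
    by (rule idempotent_power[OF assms(2)])
  have "s [^]\<^bsub>M\<^esub> Suc k \<star> x = (s [^]\<^bsub>M\<^esub> Suc k \<star> s [^]\<^bsub>M\<^esub> Suc k) \<star> x \<star> w [^]\<^bsub>M\<^esub> Suc k"
    using pw[of "Suc k"] by (metis assoc)
  also have "\<dots> = x" unfolding k using pw[of "Suc k"] by simp
  finally have "x = s [^]\<^bsub>M\<^esub> k \<star> (s \<star> x)" by (simp add: assoc)
  then show ?thesis using assms(2) by auto
qed

lemma R_if_leJ:
  assumes "x \<in> C" "w \<in> C" "leJ x (x \<star> w)" shows "R (x \<star> w) x"
proof -
  obtain s t where st: "s \<in> C" "t \<in> C" "x = s \<star> (x \<star> w) \<star> t" using assms(3) by (auto simp: leJ_def)
  then have "x = s \<star> (x \<star> (w \<star> t))" by (simp add: assoc)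
  from stable_right[OF assms(1) st(1) _ this] assms(2) st(2)
  obtain t' where "t' \<in> C" "x = x \<star> (w \<star> t) \<star> t'" by auto
  then have "x = x \<star> w \<star> (t \<star> t')" "t \<star> t' \<in> C" using st by (auto simp: assoc)
  then show ?thesis using assms(1,2) unfolding R_def by auto
qed

lemma L_if_leJ:
  assumes "x \<in> C" "w \<in> C" "leJ x (w \<star> x)" shows "L (w \<star> x) x"
proof -
  obtain s t where st: "s \<in> C" "t \<in> C" "x = s \<star> (w \<star> x) \<star> t" using assms(3) by (auto simp: leJ_def)
  then have "x = (s \<star> w) \<star> x \<star> t" by (simp add: assoc)
  from stable_left[OF assms(1) _ st(2) this] assms(2) st(1)
  obtain t' where "t' \<in> C" "x = t' \<star> ((s \<star> w) \<star> x)" by auto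
  then have "x = (t' \<star> s) \<star> (w \<star> x)" "t' \<star> s \<in> C" using st by (auto simp: assoc)
  then show ?thesis using assms(1,2) unfolding L_def by auto
qed

lemma leJ_cong: "L p p' \<Longrightarrow> R q q' \<Longrightarrow> leJ (p \<star> q) (p' \<star> q')"
  unfolding L_def R_def leJ_def by (metis assoc)

lemma R_leJ: "R x y \<Longrightarrow> leJ x y" unfolding R_def leJ_def by (metis C_closed(2) unit(1))
lemma L_leJ: "L x y \<Longrightarrow> leJ x y" unfolding L_def leJ_def by (metis C_closed(2) unit(2))

end

section \<open>Products inside one J-class\<close>

locale J_class = fin_monoid +
  fixes j assumes j: "j \<in> I"
begin

definition J where "J = {x \<in> C. leJ x j \<and> leJ j x}"

lemma J_C: "x \<in> J \<Longrightarrow> x \<in> C" by (simp add: J_def)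

lemma J_I: assumes "x \<in> J" shows "x \<in> I"
proof -
  obtain s t where "s \<in> C" "t \<in> C" "x = s \<star> j \<star> t" using assms by (auto simp: J_def leJ_def)
  then show ?thesis using I_ideal j by simp
qed

lemma J_leJ: "x \<in> J \<Longrightarrow> y \<in> J \<Longrightarrow> leJ x y" using leJ_trans by (auto simp: J_def)

lemma J_between: "x \<in> J \<Longrightarrow> y \<in> J \<Longrightarrow> leJ x w \<Longrightarrow> leJ w y \<Longrightarrow> w \<in> C \<Longrightarrow> w \<in> J"
  unfolding J_def using leJ_trans by blast

lemma J_R: "p \<in> J \<Longrightarrow> q \<in> C \<Longrightarrow> p \<star> q \<in> J \<Longrightarrow> R (p \<star> q) p"
  using R_if_leJ J_leJ J_C by blast

lemma J_L: "q \<in> J \<Longrightarrow> p \<in> C \<Longrightarrow> p \<star> q \<in> J \<Longrightarrow> L (p \<star> q) q"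
  using L_if_leJ J_leJ J_C by blast

lemma J_product:
  assumes "p \<in> J" "q \<in> J" "w \<in> C" "p \<star> w \<star> q \<in> J"
  shows "R (p \<star> w \<star> q) p" "L (p \<star> w \<star> q) q"
  using J_R[of p "w \<star> q"] J_L[of q "p \<star> w"] assms J_C by (simp_all add: assoc)

lemma J_R_closed: "p \<in> J \<Longrightarrow> R p q \<Longrightarrow> q \<in> J"
  using J_between[of p p q] R_leJ R_sym R_C by blast

lemma J_L_closed: "p \<in> J \<Longrightarrow> L p q \<Longrightarrow> q \<in> J"
  using J_between[of p p q] L_leJ L_sym L_C by blast

text \<open>Changing the left factor within its L-class and the right factor within its R-class
  affects the product by outer factors only, and these can be undone. Staying in \<open>J\<close> is
  thus a matter of these two classes alone.\<close>

lemma J_mult_cong: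
  assumes "p \<star> q \<in> J" "L p p'" "R q q'" shows "p' \<star> q' \<in> J"
proof (rule J_between[OF assms(1) assms(1)])
  show "leJ (p \<star> q) (p' \<star> q')" by (rule leJ_cong[OF assms(2,3)])
  show "leJ (p' \<star> q') (p \<star> q)" by (rule leJ_cong[OF L_sym[OF assms(2)] R_sym[OF assms(3)]])
  show "p' \<star> q' \<in> C" using assms L_C R_C by simp
qed

lemma J_left_factor: "p \<in> J \<Longrightarrow> w \<in> C \<Longrightarrow> q \<in> C \<Longrightarrow> p \<star> w \<star> q \<in> J \<Longrightarrow> p \<star> w \<in> J"
  by (rule J_between[of "p \<star> w \<star> q" p]) (auto simp: J_C leJ_mult)

lemma J_right_factor: "q \<in> J \<Longrightarrow> w \<in> C \<Longrightarrow> p \<in> C \<Longrightarrow> p \<star> (w \<star> q) \<in> J \<Longrightarrow> w \<star> q \<in> J"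
  by (rule J_between[of "p \<star> (w \<star> q)" q]) (auto simp: J_C leJ_mult)

text \<open>One half of the Clifford-Miller theorem. From p = p q t, an idempotent power of q t acts
  as a right identity on \<open>p\<close> and starts with \<open>q\<close>. It lies J-between
  \<open>p\<close> and \<open>q\<close>, hence in \<open>J\<close>, where stability gives both
  relations.\<close>

lemma J_idempotent:
  assumes "p \<in> J" "q \<in> J" "p \<star> q \<in> J"
  obtains e where "e \<in> C" "e \<star> e = e" "L e p" "R e q"
proof -
  have "R (p \<star> q) p" using assms J_R J_C by blast
  then obtain t where t: "t \<in> C" "p = p \<star> q \<star> t" by (auto simp: R_def)
  have qt: "q \<star> t \<in> C" using t assms J_C by simp
  obtain k :: nat where k: "(q \<star> t) [^]\<^bsub>M\<^esub> Suc k \<star> (q \<star> t) [^]\<^bsub>M\<^esub> Suc k = (q \<star> t) [^]\<^bsub>M\<^esub> Suc k"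
    by (rule idempotent_power[OF qt])
  define e where "e = (q \<star> t) [^]\<^bsub>M\<^esub> Suc k"
  have eC: "e \<in> C" using qt pow_C unfolding e_def by blast
  have pe: "p \<star> (q \<star> t) [^]\<^bsub>M\<^esub> n = p" for n :: nat
  proof (induction n)
    case (Suc n)
    have "p \<star> (q \<star> t) [^]\<^bsub>M\<^esub> Suc n = (p \<star> (q \<star> t) [^]\<^bsub>M\<^esub> n) \<star> q \<star> t" by (simp add: assoc)
    then show ?case using Suc t(2) by simp
  qed simp
  have pe: "p \<star> e = p" unfolding e_def by (rule pe)
  have eq: "e = q \<star> (t \<star> (q \<star> t) [^]\<^bsub>M\<^esub> k)" unfolding e_def pow_Suc2 by (simp add: assoc)
  have tk: "t \<star> (q \<star> t) [^]\<^bsub>M\<^esub> k \<in> C" using t qt by simp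
  have "leJ p e" using leJ_mult(2)[of p e] pe eC assms(1) J_C by simp
  moreover have "leJ e q" unfolding eq using leJ_mult(1) tk assms J_C by blast
  ultimately have eJ: "e \<in> J" using J_between assms eC by blast
  have "R e q" unfolding eq using J_R[OF assms(2) tk] eJ eq by simp
  moreover have "L p e" using J_L[OF eJ _, of p] assms(1) J_C pe by simp
  moreover have "e \<star> e = e" unfolding e_def by (rule k)
  ultimately show thesis using that eC L_sym by blast
qed

text \<open>The first assumption of the next two lemmas is what a block group provides.\<close>

lemma L_if_common_right_factor:
  assumes "\<And>e f. e \<in> C \<Longrightarrow> f \<in> C \<Longrightarrow> e \<star> e = e \<Longrightarrow> f \<star> f = f \<Longrightarrow> R e f \<Longrightarrow> e = f"
    and "p \<in> J" "p' \<in> J" "q \<in> J" "p \<star> q \<in> J" "p' \<star> q \<in> J"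
  shows "L p p'"
proof -
  obtain e where e: "e \<in> C" "e \<star> e = e" "L e p" "R e q" by (rule J_idempotent[OF assms(2,4,5)])
  obtain f where f: "f \<in> C" "f \<star> f = f" "L f p'" "R f q" by (rule J_idempotent[OF assms(3,4,6)])
  have "e = f" using assms(1) e f R_trans R_sym by blast
  then show ?thesis using e f L_trans L_sym by blast
qed

lemma R_if_common_left_factor:
  assumes "\<And>e f. e \<in> C \<Longrightarrow> f \<in> C \<Longrightarrow> e \<star> e = e \<Longrightarrow> f \<star> f = f \<Longrightarrow> L e f \<Longrightarrow> e = f"
    and "q \<in> J" "q' \<in> J" "p \<in> J" "p \<star> q \<in> J" "p \<star> q' \<in> J"
  shows "R q q'"
proof -
  obtain e where e: "e \<in> C" "e \<star> e = e" "L e p" "R e q" by (rule J_idempotent[OF assms(4,2,5)])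
  obtain f where f: "f \<in> C" "f \<star> f = f" "L f p" "R f q'" by (rule J_idempotent[OF assms(4,3,6)])
  have "e = f" using assms(1) e f L_trans L_sym by blast
  then show ?thesis using e f R_trans R_sym by blast
qed

end

section \<open>Sequences inside a J-class\<close>

context fin_monoid begin

lemma lam_rho_I:
  assumes "x \<in> I" "y \<in> I" "\<And>i. z i \<in> C"
  shows "lam M x y z n \<in> I \<and> rho M x y z n \<in> I"
  by (induction n) (use assms in \<open>auto simp: I_ideal I_C\<close>)

text \<open>The numbers of elements J-below the two words cannot increase along the sequence. From a
  step \<open>N\<close> minimizing their sum, each word keeps its J-class; and since a word at step
  \<open>N + 1\<close> has both words at step \<open>N\<close> as factors, the two classes
  coincide.\<close>

lemma eventually_one_J_class:
  assumes "x \<in> I" "y \<in> I" "\<And>i. z i \<in> C"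
  obtains N where "\<And>n. N \<le> n \<Longrightarrow> leJ (lam M x y z n) (lam M x y z N) \<and> leJ (lam M x y z N) (lam M x y z n)
     \<and> leJ (rho M x y z n) (lam M x y z N) \<and> leJ (lam M x y z N) (rho M x y z n)"
proof -
  let ?l = "lam M x y z" and ?r = "rho M x y z"
  define D where "D a = {b \<in> C. leJ b a}" for a
  have lrC: "?l n \<in> C" "?r n \<in> C" for n using lam_rho_I[OF assms] I_C by auto
  have step: "leJ (?l (Suc n)) (?l n)" "leJ (?l (Suc n)) (?r n)" "leJ (?r (Suc n)) (?l n)"
    "leJ (?r (Suc n)) (?r n)" for n
    using leJ_mult(1)[of "?l n" "z (Suc n) \<star> ?r n"] leJ_mult(2)[of "?l n \<star> z (Suc n)" "?r n"]
      leJ_mult(1)[of "?r n" "z (Suc n) \<star> ?l n"] leJ_mult(2)[of "?r n \<star> z (Suc n)" "?l n"]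
    by (simp_all add: lrC assms assoc)
  have down: "leJ (?l n) (?l m) \<and> leJ (?r n) (?r m)" if "m \<le> n" for m n
    using that
  proof (induction n rule: dec_induct)
    case base show ?case by (simp add: leJ_refl)
  next
    case (step n)
    then show ?case using leJ_trans \<open>leJ (?l (Suc n)) (?l n)\<close> \<open>leJ (?r (Suc n)) (?r n)\<close> by blast
  qed
  have D_eq: "leJ a b" if "leJ b a" "card (D a) = card (D b)" "a \<in> C" "b \<in> C" for a b
  proof -
    have "D b \<subseteq> D a" unfolding D_def using leJ_trans that(1) by blast
    then have "D b = D a" using that(2) finite_C by (intro card_subset_eq) (auto simp: D_def)
    moreover have "a \<in> D a" using that leJ_refl by (simp add: D_def)
    ultimately show ?thesis by (auto simp: D_def)
  qed
  have D_mono: "card (D b) \<le> card (D a)" if "leJ b a" for a b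
    using finite_C leJ_trans that by (intro card_mono) (auto simp: D_def)
  define \<mu> where "\<mu> n = card (D (?l n)) + card (D (?r n))" for n
  obtain N where N: "\<And>n. \<mu> N \<le> \<mu> n"
    using ex_has_least_nat[of "\<lambda>_. True" 0 \<mu>] by blast
  have main: "leJ (?l N) (?l n) \<and> leJ (?r N) (?r n)" if "N \<le> n" for n
  proof -
    have "card (D (?l n)) \<le> card (D (?l N))" "card (D (?r n)) \<le> card (D (?r N))"
      using down[OF that] D_mono by auto
    then have "card (D (?l N)) = card (D (?l n))" "card (D (?r N)) = card (D (?r n))"
      using N[of n] by (auto simp: \<mu>_def)
    then show ?thesis using D_eq down[OF that] lrC by blast
  qed
  have lr: "leJ (?l N) (?r N)" "leJ (?r N) (?l N)"
    using main[of "Suc N"] step[of N] leJ_trans by (meson le_SucI order_refl)+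
  show thesis
    by (rule that[of N]) (use main down lr leJ_trans in blast)
qed

text \<open>The set \<open>T\<close> ranges over the subsemigroups containing \<open>a\<close> and \<open>c\<close>, so this says that the
  subsemigroup generated by \<open>a\<close> and \<open>c\<close> violates the identities of \<open>PE\<close>.\<close>

definition PE_obstruction :: bool where
  "PE_obstruction \<longleftrightarrow> (\<exists>a\<in>I. \<exists>c\<in>I. \<forall>T\<subseteq>I. a \<in> T \<longrightarrow> c \<in> T \<longrightarrow> (\<forall>p\<in>T. \<forall>q\<in>T. p \<star> q \<in> T) \<longrightarrow>
     (\<exists>a'\<in>T. \<exists>b'\<in>T. \<exists>c'\<in>T. \<forall>n. \<not> lam_eq_rho M a' b' (PE_seq M c') n))"

end

text \<open>\<open>x\<close> and \<open>y\<close> are the two words at a late step of a failing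
  sequence and \<open>z\<close> is the sequence from there on.\<close>

locale J_seq = J_class +
  fixes x y :: 'a and z :: "nat \<Rightarrow> 'a"
  assumes z: "z i \<in> C" and lrJ: "lam M x y z n \<in> J" "rho M x y z n \<in> J"
    and lr_neq: "\<not> lam_eq_rho M x y z n"
begin

abbreviation "l \<equiv> lam M x y z"
abbreviation "r \<equiv> rho M x y z"

lemma xy: "x \<in> J" "y \<in> J" using lrJ[of 0] by auto

text \<open>By stability each new word is R-related to its first factor, so the R-classes are fixed
  forever.\<close>

lemma lr_R: "R (l n) x \<and> R (r n) y"
proof (induction n)
  case 0 then show ?case using R_refl J_C xy by simp
next
  case (Suc n)
  have "R (l (Suc n)) (l n)" using J_R[OF lrJ(1), of "z (Suc n) \<star> r n"] lrJ(1)[of "Suc n"] z J_C[OF lrJ(2)]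
    by (simp add: assoc)
  moreover have "R (r (Suc n)) (r n)" using J_R[OF lrJ(2), of "z (Suc n) \<star> l n"] lrJ(2)[of "Suc n"] z J_C[OF lrJ(1)]
    by (simp add: assoc)
  ultimately show ?case using Suc R_trans by blast
qed

text \<open>The last factor of each new word is the other word, so the L-classes are exchanged at
  every step.\<close>

lemma lr_L: "L (l (Suc n)) (r n)" "L (r (Suc n)) (l n)"
  using J_L[OF lrJ(2), of "l n \<star> z (Suc n)"] lrJ(1)[of "Suc n"] J_L[OF lrJ(1), of "r n \<star> z (Suc n)"]
    lrJ(2)[of "Suc n"] z J_C[OF lrJ(1)] J_C[OF lrJ(2)] by simp_all

lemma z1: "x \<star> z 1 \<star> y \<in> J" "y \<star> z 1 \<star> x \<in> J"
  using lrJ[of 1] by simp_all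

text \<open>After one step the L-classes are exchanged. The product
  \<open>l 1 \<star> z 2 \<star> r 1\<close> is therefore decided by the L-class and the R-class of
  \<open>y\<close>, and the other product by those of \<open>x\<close>.\<close>

lemma z2: "y \<star> z 2 \<star> y \<in> J" "x \<star> z 2 \<star> x \<in> J"
proof -
  have "l 1 \<star> z 2 \<star> r 1 \<in> J" "r 1 \<star> z 2 \<star> l 1 \<in> J" using lrJ[of 2] by (simp_all add: numeral_2_eq_2)
  moreover have "L (l 1) y" "L (r 1) x" using lr_L[of 0] by simp_all
  ultimately show "y \<star> z 2 \<star> y \<in> J" "x \<star> z 2 \<star> x \<in> J"
    using J_mult_cong L_cong z lr_R by blast+
qed

text \<open>At even steps the words have their original L-classes, and
  \<open>x \<star> z 1 \<star> y\<close> and \<open>y \<star> z 1 \<star> x\<close> decide the next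
  products; at odd steps the classes are exchanged, and \<open>y \<star> z 2 \<star> y\<close> and
  \<open>x \<star> z 2 \<star> x\<close> decide. All four lie in \<open>J\<close>, so the
  alternating sequence never leaves it, and equal words would make \<open>x\<close> and
  \<open>y\<close> both R- and L-related.\<close>

lemma two_step_sequence:
  assumes "\<not> (R x y \<and> L x y)"
  defines "w \<equiv> \<lambda>i. if odd i then z 1 else z 2"
  shows "\<not> lam_eq_rho M x y w n"
proof -
  let ?l = "lam M x y w" and ?r = "rho M x y w"
  have inv: "?l n \<in> J \<and> ?r n \<in> J \<and> R (?l n) x \<and> R (?r n) y \<and>
     (if even n then L (?l n) x \<and> L (?r n) y else L (?l n) y \<and> L (?r n) x)" for n
  proof (induction n)
    case 0 show ?case using xy R_refl L_refl J_C by simp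
  next
    case (Suc n)
    have w: "w (Suc n) \<in> C" using z by (simp add: w_def)
    have ln: "?l n \<star> w (Suc n) \<star> ?r n \<in> J \<and> ?r n \<star> w (Suc n) \<star> ?l n \<in> J"
    proof (cases "even n")
      case True
      then have "w (Suc n) = z 1" by (simp add: w_def)
      moreover have "L x (?l n)" "L y (?r n)" "R x (?l n)" "R y (?r n)"
        using Suc True L_sym R_sym by auto
      ultimately show ?thesis using J_mult_cong L_cong z z1 by metis
    next
      case False
      then have "w (Suc n) = z 2" by (simp add: w_def)
      moreover have "L y (?l n)" "L x (?r n)" "R x (?l n)" "R y (?r n)"
        using Suc False L_sym R_sym by auto
      ultimately show ?thesis using J_mult_cong L_cong z z2 by metis
    qed
    have J: "?l n \<in> J" "?r n \<in> J" "?l n \<in> C" "?r n \<in> C" using Suc J_C by auto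
    have "R (?l (Suc n)) (?l n)" "R (?r (Suc n)) (?r n)"
      using J_R[OF J(1), of "w (Suc n) \<star> ?r n"] J_R[OF J(2), of "w (Suc n) \<star> ?l n"] ln w J
      by (simp_all add: assoc)
    moreover have "L (?l (Suc n)) (?r n)" "L (?r (Suc n)) (?l n)"
      using J_L[OF J(2), of "?l n \<star> w (Suc n)"] J_L[OF J(1), of "?r n \<star> w (Suc n)"] ln w J
      by simp_all
    ultimately show ?case using ln Suc R_trans L_trans by (auto split: if_splits; blast)
  qed
  show ?thesis
  proof
    assume "?l n = ?r n"
    then have "R x y \<and> L x y" using inv[of n] R_trans R_sym L_trans L_sym by (metis (full_types))
    with assms(1) show False by simp
  qed
qed

text \<open>On the common \<open>H\<close>-class \<open>K\<close> of \<open>x\<close> and \<open>y\<close> the product \<open>p \<star> z 1 \<star> q\<close> defines a group, isomorphic to the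
  subgroup \<open>K \<star> z 1\<close>; the given sequence shows that it is not nilpotent.\<close>

lemma H_class_obstruction:
  assumes Rxy: "R x y" and Lxy: "L x y"
  shows PE_obstruction
proof -
  define K where "K = {k. R k x \<and> L k x}"
  define w where "w = z 1"
  have wC: "w \<in> C" by (simp add: w_def z)
  have KC: "k \<in> C" if "k \<in> K" for k using that R_C by (auto simp: K_def)
  have KJ: "k \<in> J" if "k \<in> K" for k using that xy J_R_closed R_sym by (auto simp: K_def)
  have xK: "x \<in> K" "y \<in> K" using xy J_C R_refl L_refl Rxy Lxy R_sym L_sym by (auto simp: K_def)
  have lK: "l n \<in> K \<and> r n \<in> K" for n
  proof (induction n)
    case (Suc n)
    have "R (r (Suc n)) x" using lr_R Rxy R_sym R_trans by blast
    then show ?case using Suc lr_R lr_L[of n] L_trans unfolding K_def by blast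
  qed (use xK in simp)
  have KK: "R p q" "L p q" if "p \<in> K" "q \<in> K" for p q
    using that R_trans R_sym L_trans L_sym unfolding K_def by blast+
  have Kz: "p \<star> z (Suc i) \<star> q \<in> K" if p: "p \<in> K" and q: "q \<in> K" for p q i
  proof -
    have lrK: "l i \<in> K" "r i \<in> K" using lK by auto
    have "l i \<star> z (Suc i) \<star> r i \<in> J" using lrJ(1)[of "Suc i"] by simp
    then have J: "p \<star> z (Suc i) \<star> q \<in> J"
      by (rule J_mult_cong[OF _ L_cong[OF KK(2)[OF lrK(1) p] z] KK(1)[OF lrK(2) q]])
    have "R (p \<star> z (Suc i) \<star> q) p"
      using J_R[OF KJ[OF p], of "z (Suc i) \<star> q"] J z KC q by (simp add: assoc)
    moreover have "L (p \<star> z (Suc i) \<star> q) q"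
      using J_L[OF KJ[OF q], of "p \<star> z (Suc i)"] J z KC p by simp
    ultimately show ?thesis using p q R_trans L_trans unfolding K_def by blast
  qed
  have Kw: "p \<star> w \<star> q \<in> K" if "p \<in> K" "q \<in> K" for p q
    using Kz[OF that, of 0] by (simp add: w_def)
  \<comment> \<open>Right division for the sandwich product: a witness \<open>t\<close> relating
    \<open>q\<close> to \<open>a \<star> w \<star> a\<close> is replaced by
    \<open>a \<star> t\<close>, which lies in \<open>K\<close>.\<close>
  have rdiv: "\<exists>q'\<in>K. q = a \<star> w \<star> q'" if a: "a \<in> K" and q: "q \<in> K" for a q
  proof -
    obtain t where t: "t \<in> C" "q = a \<star> w \<star> a \<star> t" using KK(1)[OF q Kw[OF a a]] by (auto simp: R_def)
    have at: "a \<star> t \<in> C" using t KC a by simp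
    have q': "q = (a \<star> w) \<star> (a \<star> t)" using t by (simp add: assoc)
    have "leJ q (a \<star> t)" unfolding q' using leJ_mult(2) at wC KC a by simp
    then have atJ: "a \<star> t \<in> J" using J_between[OF KJ[OF q] KJ[OF a] _ leJ_mult(1) at] t KC a by blast
    have "R (a \<star> t) a" using J_R[OF KJ[OF a] t(1) atJ] .
    moreover have "L q (a \<star> t)" using J_L[OF atJ, of "a \<star> w"] q' KJ[OF q] wC KC a by simp
    ultimately have "a \<star> t \<in> K" using a q R_trans L_trans L_sym unfolding K_def by blast
    with q' show ?thesis by blast
  qed
  have ldiv: "\<exists>q'\<in>K. q = q' \<star> w \<star> a" if a: "a \<in> K" and q: "q \<in> K" for a q
  proof -
    obtain t where t: "t \<in> C" "q = t \<star> (a \<star> w \<star> a)" using KK(2)[OF q Kw[OF a a]] by (auto simp: L_def)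
    have ta: "t \<star> a \<in> C" using t KC a by simp
    have q': "q = (t \<star> a) \<star> (w \<star> a)" using t by (simp add: assoc)
    have "leJ q (t \<star> a)" unfolding q' using leJ_mult(1) ta wC KC a by simp
    then have taJ: "t \<star> a \<in> J" using J_between[OF KJ[OF q] KJ[OF a] _ leJ_mult(2) ta] t KC a by blast
    have "L (t \<star> a) a" using J_L[OF KJ[OF a] t(1) taJ] .
    moreover have "R q (t \<star> a)" using J_R[OF taJ, of "w \<star> a"] q' KJ[OF q] wC KC a by simp
    ultimately have "t \<star> a \<in> K" using a q R_trans L_trans R_sym unfolding K_def by blast
    moreover have "q = t \<star> a \<star> w \<star> a" using q' by (simp add: assoc)
    ultimately show ?thesis by blast
  qed
  obtain e where e: "e \<in> K" "x = x \<star> w \<star> e" using rdiv xK by blast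
  have er: "k \<star> w \<star> e = k" if k: "k \<in> K" for k
  proof -
    obtain q where "k = q \<star> w \<star> x" using ldiv[OF xK(1) k] by blast
    then show ?thesis using e(2) by (metis assoc)
  qed
  obtain f where f: "f \<in> K" "x = f \<star> w \<star> x" using ldiv xK by blast
  have fl: "f \<star> w \<star> k = k" if k: "k \<in> K" for k
  proof -
    obtain q where "k = x \<star> w \<star> q" using rdiv[OF xK(1) k] by blast
    then show ?thesis using f(2) by (metis assoc)
  qed
  have "f = e" using er[OF f(1)] fl[OF e(1)] by simp
  then have el: "e \<star> w \<star> k = k" if "k \<in> K" for k using fl that by simp
  define G where "G = \<lparr>carrier = K, monoid.mult = (\<lambda>p q. p \<star> w \<star> q), one = e\<rparr>"
  have G [simp]: "carrier G = K" "p \<otimes>\<^bsub>G\<^esub> q = p \<star> w \<star> q" "\<one>\<^bsub>G\<^esub> = e" for p q by (simp_all add: G_def)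
  have "group G"
  proof (rule groupI)
    fix p assume "p \<in> carrier G"
    then show "\<exists>q\<in>carrier G. q \<otimes>\<^bsub>G\<^esub> p = \<one>\<^bsub>G\<^esub>" using ldiv[of p e] e(1) by auto
  qed (use Kw e(1) el in \<open>auto simp: assoc\<close>)
  interpret G: group G by fact
  have finK: "finite K" using finite_C KC by (meson finite_subset subsetI)
  \<comment> \<open>Letters are moved into \<open>K\<close> so that p w (g i) w q = p (z i) q, as
    \<open>e\<close> is the identity of the sandwich product. Letters start at index 1, and only for
    those are products known to stay in \<open>K\<close>; index 0 gets a default value.\<close>
  define g where "g i = (if i = 0 then e else e \<star> z i \<star> e)" for i
  have gK: "g i \<in> K" for i using Kz[OF e(1) e(1)] e(1) by (cases i) (auto simp: g_def)
  have lamG: "lam G x y g n = l n \<and> rho G x y g n = r n" for n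
  proof (induction n)
    case (Suc n)
    have "p \<star> w \<star> g (Suc n) \<star> w \<star> q = p \<star> z (Suc n) \<star> q" if "p \<in> K" "q \<in> K" for p q
    proof -
      have "p \<star> w \<star> g (Suc n) \<star> w \<star> q = (p \<star> w \<star> e) \<star> z (Suc n) \<star> (e \<star> w \<star> q)"
        by (simp add: g_def assoc)
      then show ?thesis using er el that by simp
    qed
    then show ?case using Suc lK[of n] by simp
  qed simp
  have "\<not> nilpotent_group G"
  proof
    assume "nilpotent_group G"
    then obtain n where n: "\<forall>x\<in>K. \<forall>y\<in>K. \<forall>z. (\<forall>i. z i \<in> K) \<longrightarrow> lam_eq_rho G x y z n"
      using G.nilpotent_imp_lam_eq_rho by auto
    have "lam_eq_rho G x y g n" using n xK gK by blast
    then show False using lamG[of n] lr_neq by simp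
  qed
  then have "\<not> engel_like G" using G.engel_like_imp_nilpotent finK by auto
  then obtain a c where ac: "a \<in> K" "c \<in> K"
    "\<And>n. \<not> lam_eq_rho G a (inv\<^bsub>G\<^esub> c) (PE_seq G c) n"
    unfolding engel_like_def by auto
  \<comment> \<open>This turns the sandwich product into the given one; multiplying by
    \<open>e\<close> on the right undoes it on \<open>K\<close>.\<close>
  define \<phi> where "\<phi> k = k \<star> w" for k
  have \<phi>I: "\<phi> k \<in> I" if "k \<in> K" for k using J_I[OF KJ[OF that]] wC by (simp add: \<phi>_def I_ideal)
  have \<phi>_mult: "\<phi> p \<star> \<phi> q = \<phi> (p \<star> w \<star> q)" for p q by (simp add: \<phi>_def assoc)
  have \<phi>_inj: "p = q" if "p \<in> K" "q \<in> K" "\<phi> p = \<phi> q" for p q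
  proof -
    have "p \<star> w \<star> e = q \<star> w \<star> e" using that(3) unfolding \<phi>_def by (rule arg_cong)
    then show ?thesis unfolding er[OF that(1)] er[OF that(2)] .
  qed
  have pow: "\<phi> c [^]\<^bsub>M\<^esub> Suc k = \<phi> (c [^]\<^bsub>G\<^esub> Suc k)" for k :: nat
  proof (induction k)
    case 0 then show ?case using el[OF ac(2)] by (simp add: G.nat_pow_Suc)
  next
    case (Suc k)
    have "\<phi> c [^]\<^bsub>M\<^esub> Suc (Suc k) = \<phi> c [^]\<^bsub>M\<^esub> Suc k \<star> \<phi> c" by (rule pow_simps)
    also have "\<dots> = \<phi> (c [^]\<^bsub>G\<^esub> Suc k) \<star> \<phi> c" unfolding Suc ..
    also have "\<dots> = \<phi> (c [^]\<^bsub>G\<^esub> Suc (Suc k))" unfolding \<phi>_mult by (simp add: G.nat_pow_Suc)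
    finally show ?case .
  qed
  \<comment> \<open>The letter 1 of the monoid is not claimed to be the image of \<open>e\<close>,
    but both act alike to the right of an image, and letters occur only there.\<close>
  have seq: "\<phi> p \<star> PE_seq M (\<phi> c) i = \<phi> (p \<star> w \<star> PE_seq G c i)" if "p \<in> K" for p i
  proof (cases "i \<le> 2")
    case True then show ?thesis using er[OF that] by (simp add: PE_seq_def)
  next
    case False
    then obtain k where "i - 2 = Suc k" by (metis Suc_diff_le diff_is_0_eq not_less_eq_eq old.nat.exhaust)
    then show ?thesis using False pow[of k] \<phi>_mult by (simp only: PE_seq_def) simp
  qed
  have ci: "inv\<^bsub>G\<^esub> c \<in> K" using ac(2) G.inv_closed by simp
  have img: "lam M (\<phi> a) (\<phi> (inv\<^bsub>G\<^esub> c)) (PE_seq M (\<phi> c)) n = \<phi> (lam G a (inv\<^bsub>G\<^esub> c) (PE_seq G c) n) \<and>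
    rho M (\<phi> a) (\<phi> (inv\<^bsub>G\<^esub> c)) (PE_seq M (\<phi> c)) n = \<phi> (rho G a (inv\<^bsub>G\<^esub> c) (PE_seq G c) n)" for n
  proof (induction n)
    case (Suc n)
    have "lam G a (inv\<^bsub>G\<^esub> c) (PE_seq G c) n \<in> K \<and> rho G a (inv\<^bsub>G\<^esub> c) (PE_seq G c) n \<in> K"
      using G.lam_rho_closed[of a "inv\<^bsub>G\<^esub> c" "PE_seq G c" n] ac ci G.PE_seq_closed[of c] by simp
    then show ?case using Suc by (simp add: seq \<phi>_mult)
  qed simp
  show ?thesis unfolding PE_obstruction_def
  proof (rule bexI[OF _ \<phi>I[OF ac(1)]], rule bexI[OF _ \<phi>I[OF ac(2)]], intro allI impI)
    fix T assume T: "T \<subseteq> I" "\<phi> a \<in> T" "\<phi> c \<in> T" "\<forall>p\<in>T. \<forall>q\<in>T. p \<star> q \<in> T"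
    \<comment> \<open>\<open>T\<close> is only known to contain the images of \<open>a\<close> and
      \<open>c\<close>. The elements of \<open>K\<close> with image in \<open>T\<close> form a
      finite closed set, hence a subgroup, which brings in the inverse of \<open>c\<close>.\<close>
    define P where "P = {k \<in> K. \<phi> k \<in> T}"
    have "subgroup P G"
    proof (rule G.finite_closed_subgroup)
      show "P \<subseteq> carrier G" "finite P" "P \<noteq> {}" using finK ac T by (auto simp: P_def)
      fix p q assume "p \<in> P" "q \<in> P"
      then show "p \<otimes>\<^bsub>G\<^esub> q \<in> P" using Kw T(4) by (auto simp: P_def simp flip: \<phi>_mult)
    qed
    then have "inv\<^bsub>G\<^esub> c \<in> P" by (rule subgroup.m_inv_closed) (use ac T in \<open>simp add: P_def\<close>)
    then have "\<phi> (inv\<^bsub>G\<^esub> c) \<in> T" by (simp add: P_def)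
    moreover have "\<not> lam_eq_rho M (\<phi> a) (\<phi> (inv\<^bsub>G\<^esub> c)) (PE_seq M (\<phi> c)) n" for n
    proof -
      have "lam G a (inv\<^bsub>G\<^esub> c) (PE_seq G c) n \<in> K" "rho G a (inv\<^bsub>G\<^esub> c) (PE_seq G c) n \<in> K"
        using G.lam_rho_closed[of a "inv\<^bsub>G\<^esub> c" "PE_seq G c" n] ac ci G.PE_seq_closed[of c] by simp_all
      then show ?thesis using img[of n] \<phi>_inj ac(3)[of n] by metis
    qed
    ultimately show "\<exists>a'\<in>T. \<exists>b'\<in>T. \<exists>c'\<in>T. \<forall>n. \<not> lam_eq_rho M a' b' (PE_seq M c') n"
      using T by blast
  qed
qed

end

section \<open>Sequences of powers\<close>

text \<open>The first two letters are consecutive powers of \<open>c\<close>, as in a shifted PE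
  sequence. \<open>R_unique\<close> and \<open>L_unique\<close> are the block group property: at
  most one idempotent in each R-class and each L-class.\<close>

locale J_power_seq = J_seq +
  fixes c :: 'a and s :: nat
  assumes c: "c \<in> C" and z_power: "z 1 = c [^]\<^bsub>M\<^esub> s" "z 2 = c [^]\<^bsub>M\<^esub> Suc s"
    and R_unique: "\<And>e f. e \<in> C \<Longrightarrow> f \<in> C \<Longrightarrow> e \<star> e = e \<Longrightarrow> f \<star> f = f \<Longrightarrow> R e f \<Longrightarrow> e = f"
    and L_unique: "\<And>e f. e \<in> C \<Longrightarrow> f \<in> C \<Longrightarrow> e \<star> e = e \<Longrightarrow> f \<star> f = f \<Longrightarrow> L e f \<Longrightarrow> e = f"
begin

abbreviation "pw \<equiv> \<lambda>n::nat. c [^]\<^bsub>M\<^esub> n"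

lemma xyC: "x \<in> C" "y \<in> C" using xy J_C by auto

lemma products: "(x \<star> pw s) \<star> y \<in> J" "(y \<star> pw s) \<star> x \<in> J"
    "(y \<star> pw (Suc s)) \<star> y \<in> J" "(x \<star> pw (Suc s)) \<star> x \<in> J"
  using z1 z2 unfolding z_power .

lemma left_factors: "x \<star> pw s \<in> J" "y \<star> pw s \<in> J" "y \<star> pw (Suc s) \<in> J" "x \<star> pw (Suc s) \<in> J"
  using J_left_factor[OF xy(1) pow_C[OF c] xyC(2) products(1)] J_left_factor[OF xy(2) pow_C[OF c] xyC(1) products(2)]
    J_left_factor[OF xy(2) pow_C[OF c] xyC(2) products(3)] J_left_factor[OF xy(1) pow_C[OF c] xyC(1) products(4)]
  by auto

text \<open>Both elements have a product with \<open>y\<close> inside \<open>J\<close>, and the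
  idempotent behind such a product is determined by the R-class of \<open>y\<close>.\<close>

lemma L_xs: "L (x \<star> pw s) (y \<star> pw (Suc s))"
  by (rule L_if_common_right_factor[OF R_unique left_factors(1,3) xy(2) products(1,3)])

lemma L_ys: "L (y \<star> pw s) (x \<star> pw (Suc s))"
  by (rule L_if_common_right_factor[OF R_unique left_factors(2,4) xy(1) products(2,4)])

text \<open>Multiplying \<open>L_ys\<close> by \<open>c\<close> and comparing with
  \<open>L_xs\<close> puts \<open>x \<star> pw s\<close> and \<open>b \<star> c\<close> in one
  L-class. A further \<open>c\<close> leads back to the class of \<open>b\<close>: right
  multiplication by \<open>c\<close> swaps the classes of \<open>b\<close> and
  \<open>b \<star> c\<close>.\<close>

definition b where "b = x \<star> pw (Suc s)"

lemma bJ: "b \<in> J" using left_factors by (simp add: b_def)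

lemma bC: "b \<in> C" using bJ J_C by simp

lemma L_xs_bc: "L (x \<star> pw s) (b \<star> c)"
  using L_trans[OF L_xs L_cong[OF L_ys c, unfolded assoc, folded pow_simps(2)]] by (simp add: b_def assoc)

lemma L_b_bcc: "L (b \<star> c \<star> c) b"
  using L_sym[OF L_cong[OF L_xs_bc c]] by (simp add: b_def assoc)

text \<open>If \<open>c\<close> fixes the L-class of \<open>b\<close>, then x c^s lies in it as
  well, so x c^s x is in \<open>J\<close> along with x c^s y, and the common left factor makes
  \<open>x\<close> and \<open>y\<close> R-related. Then c^s y is a common right factor and gives the
  L-relation.\<close>

lemma H_if_L:
  assumes "L (b \<star> c) b"
  shows "R x y" "L x y"
proof -
  have Lb: "L b (x \<star> pw s)" using L_sym[OF L_trans[OF L_xs_bc assms]] .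
  have "(x \<star> pw s) \<star> x \<in> J"
    using J_mult_cong[OF _ Lb R_refl[OF xyC(1)]] products(4) by (simp add: b_def)
  from R_if_common_left_factor[OF L_unique xy left_factors(1) this products(1)]
  show Rxy: "R x y" .
  have cy: "pw s \<star> y \<in> J"
    by (rule J_right_factor[OF xy(2) pow_C[OF c] xyC(1)]) (use products(1) in \<open>simp add: assoc\<close>)
  have "(y \<star> pw s) \<star> y \<in> J"
    using J_mult_cong[OF products(2) L_refl Rxy] left_factors(2) J_C by simp
  then have "y \<star> (pw s \<star> y) \<in> J" "x \<star> (pw s \<star> y) \<in> J"
    using products(1) by (simp_all add: assoc)
  then show "L x y" using L_if_common_right_factor[OF R_unique xy cy] by blast
qed

text \<open>The words start at the generators \<open>c\<close> and \<open>b\<close> themselves and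
  lie in \<open>J\<close> from step 2 on. At step n + 2 their L-classes are those of b c^(n+1) and b
  c^(n+2), which alternate between the two distinct classes of \<open>b\<close> and
  \<open>b \<star> c\<close>.\<close>

lemma bc_obstruction:
  assumes neq: "\<not> L (b \<star> c) b"
  shows "\<not> lam_eq_rho M c b (PE_seq M c) n"
proof -
  let ?l = "lam M c b (PE_seq M c)" and ?r = "rho M c b (PE_seq M c)"
  have Rbx: "R b x" using J_R[OF xy(1) pow_C[OF c] left_factors(4)] by (simp add: b_def)
  have bb: "b \<star> b \<in> J"
    using J_mult_cong[OF products(4) _ R_sym[OF Rbx], of b] L_refl[OF bC] by (simp add: b_def)
  have bc: "b \<star> c \<in> J" using J_L_closed[OF left_factors(1) L_xs_bc] .
  have bccb: "(b \<star> c \<star> c) \<star> b \<in> J"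
    using J_mult_cong[OF bb L_sym[OF L_b_bcc] R_refl[OF bC]] .
  have cb: "c \<star> b \<in> J"
    by (rule J_right_factor[OF bJ c J_C[OF bc]]) (use bccb in \<open>simp add: assoc\<close>)
  have bccb': "(b \<star> c) \<star> (c \<star> b) \<in> J" using bccb by (simp add: assoc)
  have even_pow: "L (b \<star> pw (2 * m)) b" for m
  proof (induction m)
    case (Suc m)
    have "b \<star> pw (2 * Suc m) = b \<star> pw (2 * m) \<star> (c \<star> c)" by (simp add: assoc)
    moreover have "L (b \<star> pw (2 * m) \<star> (c \<star> c)) (b \<star> (c \<star> c))" using L_cong[OF Suc] c by simp
    ultimately show ?case using L_b_bcc L_trans by (simp add: assoc)
  qed (simp add: L_refl bC)
  have odd_pow: "L (b \<star> pw (Suc (2 * m))) (b \<star> c)" for m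
    using L_cong[OF even_pow c] by (simp add: assoc)
  have bpC: "b \<star> pw k \<in> C" for k using bC c by simp
  have pow2: "L (b \<star> pw (Suc (Suc k))) (b \<star> pw k)" for k
  proof -
    have "L (b \<star> c \<star> c \<star> pw k) (b \<star> pw k)" using L_cong[OF L_b_bcc] c by simp
    then show ?thesis unfolding pow_Suc2 by (simp add: assoc)
  qed
  have pow_add_even: "L (b \<star> pw (k + 2 * m)) (b \<star> pw k)" for k m
  proof (induction m)
    case (Suc m) then show ?case using pow2[of "k + 2 * m"] L_trans by simp
  qed (simp add: L_refl bpC)
  have inv: "?l (n + 2) \<in> J \<and> ?r (n + 2) \<in> J \<and> R (?l (n + 2)) (c \<star> b) \<and> R (?r (n + 2)) b \<and>
      L (?l (n + 2)) (b \<star> pw (n + 1)) \<and> L (?r (n + 2)) (b \<star> pw (n + 2))" for n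
  proof (induction n)
    case 0
    have l2: "?l 2 = (c \<star> b) \<star> (b \<star> c)" and r2: "?r 2 = (b \<star> c) \<star> (c \<star> b)"
      by (simp_all add: numeral_2_eq_2 PE_seq_def assoc)
    have "?r 2 \<in> J" using bccb' r2 by simp
    moreover have "R (?r 2) b" using J_R[OF bJ, of "c \<star> (c \<star> b)"] \<open>?r 2 \<in> J\<close> r2 c bC by (simp add: assoc)
    moreover have "L (?r 2) b" using J_L[OF bJ, of "b \<star> c \<star> c"] \<open>?r 2 \<in> J\<close> r2 c bC by (simp add: assoc)
    moreover have "?l 2 \<in> J"
      unfolding l2 by (rule J_mult_cong[OF bb L_sym[OF J_L[OF bJ c cb]] R_sym[OF J_R[OF bJ c bc]]])
    moreover have "R (?l 2) (c \<star> b)" "L (?l 2) (b \<star> c)"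
      using J_R[OF cb, of "b \<star> c"] J_L[OF bc, of "c \<star> b"] \<open>?l 2 \<in> J\<close> l2 J_C[OF bc] J_C[OF cb] by simp_all
    moreover have "L (?r 2) (b \<star> pw 2)"
      using L_trans[OF \<open>L (?r 2) b\<close> L_sym[OF even_pow[of 1]]] by simp
    moreover have "pw 1 = c" by simp
    ultimately show ?case unfolding add_0_left by (simp only:)
  next
    case (Suc n)
    \<comment> \<open>The letter at index n + 3 has exponent n + 1. It sends the two L-classes to
      those with exponents 2n + 2 and 2n + 3, that is of \<open>b\<close> and
      \<open>b \<star> c\<close>; the products are then decided by b b and (b c)(c b).\<close>
    let ?w = "pw (Suc n)"
    have w: "PE_seq M c (Suc (n + 2)) = ?w" by (simp add: PE_seq_def)
    have JC: "?l (n + 2) \<in> J" "?r (n + 2) \<in> J" "?l (n + 2) \<in> C" "?r (n + 2) \<in> C" "?w \<in> C"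
      using Suc J_C c by (auto simp del: pow_simps)
    have "L (?l (n + 2) \<star> ?w) (b \<star> pw (n + 1) \<star> ?w)" using Suc L_cong JC(5) by blast
    moreover have "b \<star> pw (n + 1) \<star> ?w = b \<star> pw (2 * Suc n)"
      using pow_add[of c "n + 1" "Suc n"] by (simp add: assoc mult_2 del: pow_simps)
    ultimately have "L (?l (n + 2) \<star> ?w) b" using L_trans[OF _ even_pow[of "Suc n"]] by simp
    moreover have "R (?r (n + 2)) b" using Suc by blast
    ultimately have lJ: "?l (n + 2) \<star> ?w \<star> ?r (n + 2) \<in> J" using J_mult_cong[OF bb L_sym R_sym] by blast
    have "L (?r (n + 2) \<star> ?w) (b \<star> pw (n + 2) \<star> ?w)" using Suc L_cong JC(5) by blast
    moreover have "b \<star> pw (n + 2) \<star> ?w = b \<star> pw (Suc (2 * Suc n))"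
      using pow_add[of c "n + 2" "Suc n"] by (simp add: assoc mult_2 del: pow_simps)
    ultimately have "L (?r (n + 2) \<star> ?w) (b \<star> c)" using L_trans[OF _ odd_pow[of "Suc n"]] by simp
    moreover have "R (?l (n + 2)) (c \<star> b)" using Suc by blast
    ultimately have rJ: "?r (n + 2) \<star> ?w \<star> ?l (n + 2) \<in> J" using J_mult_cong[OF bccb' L_sym R_sym] by blast
    have step: "?l (Suc n + 2) = ?l (n + 2) \<star> ?w \<star> ?r (n + 2)" "?r (Suc n + 2) = ?r (n + 2) \<star> ?w \<star> ?l (n + 2)"
      unfolding add_Suc lam.simps rho.simps w M_simps by (rule refl)+
    have RL: "R (?l (Suc n + 2)) (?l (n + 2))" "R (?r (Suc n + 2)) (?r (n + 2))"
      "L (?l (Suc n + 2)) (?r (n + 2))" "L (?r (Suc n + 2)) (?l (n + 2))"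
      unfolding step by (rule J_product[OF JC(1,2,5) lJ] J_product[OF JC(2,1,5) rJ])+
    have IH: "R (?l (n + 2)) (c \<star> b)" "R (?r (n + 2)) b" "L (?l (n + 2)) (b \<star> pw (n + 1))"
      "L (?r (n + 2)) (b \<star> pw (Suc n + 1))" using Suc by (auto simp del: pow_simps lam.simps rho.simps)
    have up: "L (b \<star> pw (n + 1)) (b \<star> pw (Suc n + 2))"
      using L_sym[OF pow2[of "n + 1"]] by (simp del: pow_simps)
    show ?case
      by (intro conjI) (use lJ rJ R_trans[OF RL(1) IH(1)] R_trans[OF RL(2) IH(2)] L_trans[OF RL(3) IH(4)]
          L_trans[OF L_trans[OF RL(4) IH(3)] up] in \<open>simp_all only: step\<close>)
  qed
  have "?l (n + 2) \<noteq> ?r (n + 2)"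
  proof
    assume eq: "?l (n + 2) = ?r (n + 2)"
    have "L (?l (n + 2)) (b \<star> pw (n + 1))" "L (?l (n + 2)) (b \<star> pw (n + 2))"
      using inv[of n] unfolding eq by blast+
    then have *: "L (b \<star> pw (n + 1)) (b \<star> pw (n + 2))" using L_trans L_sym by blast
    \<comment> \<open>Multiplying the relation by c^(n+1) makes one exponent even and the other
      odd.\<close>
    have pows: "b \<star> pw (n + 1) \<star> pw (n + 1) = b \<star> pw (2 * Suc n)"
      "b \<star> pw (n + 2) \<star> pw (n + 1) = b \<star> pw (Suc (2 * Suc n))"
      using pow_add[of c "n + 1" "n + 1"] pow_add[of c "n + 2" "n + 1"]
      by (simp_all add: assoc mult_2 del: pow_simps)
    have "L (b \<star> pw (2 * Suc n)) (b \<star> pw (Suc (2 * Suc n)))"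
      using L_cong[OF * pow_C[OF c, of "n + 1"]] unfolding pows .
    from L_trans[OF L_sym[OF odd_pow[of "Suc n"]] L_trans[OF L_sym[OF this] even_pow]]
    have "L (b \<star> c) b" .
    with neq show False by simp
  qed
  then show ?thesis using lam_rho_eq_mono[of M c b "PE_seq M c" n "n + 2"] by auto
qed

lemma power_obstruction: PE_obstruction
proof (cases "L (b \<star> c) b")
  case True
  then show ?thesis using H_class_obstruction H_if_L by blast
next
  case False
  then have "c \<noteq> u" using L_refl[OF bC] by auto
  then have cI: "c \<in> I" using c by (simp add: C_def)
  show ?thesis unfolding PE_obstruction_def
  proof (rule bexI[OF _ J_I[OF bJ]], rule bexI[OF _ cI], intro allI impI)
    fix T assume "b \<in> T" "c \<in> T"
    then show "\<exists>a'\<in>T. \<exists>b'\<in>T. \<exists>c'\<in>T. \<forall>n. \<not> lam_eq_rho M a' b' (PE_seq M c') n"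
      using bc_obstruction[OF False] by (intro bexI[of _ c] bexI[of _ b] allI)
  qed
qed

end

context fin_monoid begin

lemma eventual_J_seq:
  assumes "x \<in> I" "y \<in> I" "\<And>i. z i \<in> C" "\<And>n. \<not> lam_eq_rho M x y z n"
  obtains N where "\<And>k. N \<le> k \<Longrightarrow>
    J_seq (\<star>) u I (lam M x y z k) (lam M x y z k) (rho M x y z k) (\<lambda>i. z (k + i))"
proof -
  let ?l = "lam M x y z" and ?r = "rho M x y z"
  obtain N where N: "\<And>n. N \<le> n \<Longrightarrow> leJ (?l n) (?l N) \<and> leJ (?l N) (?l n)
     \<and> leJ (?r n) (?l N) \<and> leJ (?l N) (?r n)"
    using eventually_one_J_class[where z = z, OF assms(1-3)] by blast
  have lrI: "?l n \<in> I" "?r n \<in> I" for n using lam_rho_I[where z = z, OF assms(1-3)] by auto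
  have "J_seq (\<star>) u I (?l k) (?l k) (?r k) (\<lambda>i. z (k + i))" if "N \<le> k" for k
  proof -
    interpret J_class "(\<star>)" u I "?l k" by unfold_locales (rule lrI)
    have k: "leJ (?l k) (?l N)" "leJ (?l N) (?l k)" using N[OF that] by blast+
    have "a \<in> J" if "leJ a (?l N)" "leJ (?l N) a" "a \<in> I" for a
      unfolding J_def using leJ_trans[OF that(1) k(2)] leJ_trans[OF k(1) that(2)] I_C[OF that(3)] by simp
    then have "?l (k + n) \<in> J \<and> ?r (k + n) \<in> J" for n
      using N[of "k + n"] that lrI by simp
    then show ?thesis
      by unfold_locales (use assms(3,4) in \<open>simp_all flip: lam_rho_shift[THEN conjunct1] lam_rho_shift[THEN conjunct2]\<close>)
  qed
  then show thesis using that by blast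
qed

theorem PE_failure:
  assumes "x \<in> I" "y \<in> I" "c \<in> C" "\<And>n. \<not> lam_eq_rho M x y (PE_seq M c) n"
    and "\<And>e f. e \<in> C \<Longrightarrow> f \<in> C \<Longrightarrow> e \<star> e = e \<Longrightarrow> f \<star> f = f \<Longrightarrow> R e f \<Longrightarrow> e = f"
    and "\<And>e f. e \<in> C \<Longrightarrow> f \<in> C \<Longrightarrow> e \<star> e = e \<Longrightarrow> f \<star> f = f \<Longrightarrow> L e f \<Longrightarrow> e = f"
  shows PE_obstruction
proof -
  have z: "PE_seq M c i \<in> C" for i using assms(3) by (simp add: PE_seq_def)
  obtain N where N: "\<And>k. N \<le> k \<Longrightarrow> J_seq (\<star>) u I (lam M x y (PE_seq M c) k) (lam M x y (PE_seq M c) k)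
       (rho M x y (PE_seq M c) k) (\<lambda>i. PE_seq M c (k + i))"
    using eventual_J_seq[where z = "PE_seq M c", OF assms(1,2) z assms(4)] by blast
  \<comment> \<open>Starting at N + 2 skips the two letters 1, so that the next two letters are
    consecutive powers of \<open>c\<close>.\<close>
  have seq: "J_seq (\<star>) u I (lam M x y (PE_seq M c) (N + 2)) (lam M x y (PE_seq M c) (N + 2))
     (rho M x y (PE_seq M c) (N + 2)) (\<lambda>i. PE_seq M c (N + 2 + i))" by (rule N) simp
  have powers: "PE_seq M c (N + 2 + 1) = c [^]\<^bsub>M\<^esub> Suc N" "PE_seq M c (N + 2 + 2) = c [^]\<^bsub>M\<^esub> Suc (Suc N)"
    by (simp_all add: PE_seq_def)
  show ?thesis
    by (rule J_power_seq.power_obstruction[OF J_power_seq.intro[OF seq J_power_seq_axioms.intro[OF assms(3) powers assms(5,6)]]])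
qed

theorem MN_failure:
  assumes "x \<in> I" "y \<in> I" "\<And>i. z i \<in> C" "\<And>n. \<not> lam_eq_rho M x y z n"
  shows "PE_obstruction \<or> (\<exists>x\<in>I. \<exists>y\<in>I. \<exists>w1\<in>C. \<exists>w2\<in>C. \<forall>n.
     \<not> lam_eq_rho M x y (\<lambda>i. if odd i then w1 else w2) n)"
proof -
  obtain N where N: "\<And>k. N \<le> k \<Longrightarrow> J_seq (\<star>) u I (lam M x y z k) (lam M x y z k)
       (rho M x y z k) (\<lambda>i. z (k + i))"
    using eventual_J_seq[where z = z, OF assms] by blast
  have seq: "J_seq (\<star>) u I (lam M x y z N) (lam M x y z N) (rho M x y z N) (\<lambda>i. z (N + i))"
    by (rule N) simp
  show ?thesis
  proof (cases "R (lam M x y z N) (rho M x y z N) \<and> L (lam M x y z N) (rho M x y z N)")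
    case True
    then show ?thesis using J_seq.H_class_obstruction[OF seq] by blast
  next
    case False
    have "lam M x y z N \<in> I" "rho M x y z N \<in> I" using lam_rho_I[where z = z, OF assms(1-3)] by auto
    then show ?thesis using J_seq.two_step_sequence[OF seq False] assms(3)
      by (intro disjI2 bexI[of _ "lam M x y z N"] bexI[of _ "rho M x y z N"]
          bexI[of _ "z (N + 1)"] bexI[of _ "z (N + 2)"] allI)
  qed
qed

end

section \<open>Pointwise descriptions of the classes\<close>

fun omul :: "('a \<Rightarrow> 'a \<Rightarrow> 'a) \<Rightarrow> 'a option \<Rightarrow> 'a option \<Rightarrow> 'a option" where
  "omul f None y = y"
| "omul f (Some a) None = Some a"
| "omul f (Some a) (Some b) = Some (f a b)"

lemma omul_None [simp]: "omul f x None = x" by (cases x) auto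

text \<open>Here an identity is adjoined even if the semigroup has one. Unlike \<open>S1\<close>,
  this is stable under passing to a subsemigroup, so words computed in the two agree.\<close>

definition OM :: "('a \<Rightarrow> 'a \<Rightarrow> 'a) \<Rightarrow> 'a option monoid" where
  "OM f = \<lparr>carrier = UNIV, monoid.mult = omul f, one = None\<rparr>"

lemma OM_simps [simp]: "x \<otimes>\<^bsub>OM f\<^esub> y = omul f x y" "\<one>\<^bsub>OM f\<^esub> = None"
  by (simp_all add: OM_def)

lemma S1_mult [simp]: "x \<otimes>\<^bsub>S1 S\<^esub> y = omul (sgmult S) x y"
  by (cases x; cases y) (simp_all add: S1_def)

abbreviation (input) "with_None T \<equiv> insert None (Some ` T)"

lemma omul_with_None:
  assumes "\<And>x y. x \<in> T \<Longrightarrow> y \<in> T \<Longrightarrow> f x y \<in> T"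
  shows "x \<in> with_None T \<Longrightarrow> y \<in> with_None T \<Longrightarrow> omul f x y \<in> with_None T"
    "x \<in> Some ` T \<Longrightarrow> y \<in> with_None T \<Longrightarrow> omul f x y \<in> Some ` T"
    "x \<in> with_None T \<Longrightarrow> y \<in> Some ` T \<Longrightarrow> omul f x y \<in> Some ` T"
  using assms by auto

text \<open>Letters are compared only through their action to the right of elements of
  \<open>X\<close>, so that an identity of \<open>S\<close> and the adjoined one may replace each
  other.\<close>

lemma lam_rho_transfer:
  assumes mult: "\<And>x y. x \<in> X \<Longrightarrow> y \<in> X \<Longrightarrow> x \<otimes>\<^bsub>M\<^esub> y = x \<otimes>\<^bsub>M'\<^esub> y \<and> x \<otimes>\<^bsub>M\<^esub> y \<in> X"
    and "a \<in> X" "b \<in> X"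
    and z: "\<And>i p. 1 \<le> i \<Longrightarrow> i \<le> n \<Longrightarrow> p \<in> X \<Longrightarrow> p \<otimes>\<^bsub>M\<^esub> z i = p \<otimes>\<^bsub>M'\<^esub> z' i \<and> p \<otimes>\<^bsub>M\<^esub> z i \<in> X"
  shows "lam M a b z n = lam M' a b z' n \<and> rho M a b z n = rho M' a b z' n \<and>
     lam M a b z n \<in> X \<and> rho M a b z n \<in> X"
  using z
proof (induction n)
  case (Suc n)
  have IH: "lam M a b z n = lam M' a b z' n \<and> rho M a b z n = rho M' a b z' n \<and>
     lam M a b z n \<in> X \<and> rho M a b z n \<in> X" by (rule Suc.IH) (rule Suc.prems, simp_all)
  show ?case using Suc.prems[of "Suc n" "lam M a b z n"] Suc.prems[of "Suc n" "rho M a b z n"] IH mult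
    by (metis lam.simps(2) rho.simps(2) le_add1 plus_1_eq_Suc order_refl)
qed (use assms in simp)

text \<open>Koenig's lemma. A pair is bad if it admits a failing sequence for every n. If no
  successor of a bad pair were bad, the finitely many bounds could be combined by monotonicity, a
  contradiction; so dependent choice builds an infinite failing sequence.\<close>

lemma konig_lam_rho:
  assumes "finite W" and bad: "\<And>n. \<exists>z. (\<forall>i. z i \<in> W) \<and> \<not> lam_eq_rho M x y z n"
  shows "\<exists>z. (\<forall>i. z i \<in> W) \<and> (\<forall>n. \<not> lam_eq_rho M x y z n)"
proof -
  define Bad where "Bad p \<longleftrightarrow> (\<forall>n. \<exists>z. (\<forall>i. z i \<in> W) \<and> \<not> lam_eq_rho M (fst p) (snd p) z n)" for p
  define nxt where "nxt p w = (fst p \<otimes>\<^bsub>M\<^esub> w \<otimes>\<^bsub>M\<^esub> snd p, snd p \<otimes>\<^bsub>M\<^esub> w \<otimes>\<^bsub>M\<^esub> fst p)" for p w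
  have step: "\<exists>w\<in>W. Bad (nxt p w)" if Bp: "Bad p" for p
  proof (rule ccontr)
    assume "\<not> ?thesis"
    then have "\<forall>w\<in>W. \<exists>n. \<forall>z. (\<forall>i. z i \<in> W) \<longrightarrow>
      lam_eq_rho M (fst (nxt p w)) (snd (nxt p w)) z n"
      unfolding Bad_def by blast
    then obtain h where h: "\<And>w z. w \<in> W \<Longrightarrow> (\<forall>i. z i \<in> W) \<Longrightarrow>
      lam_eq_rho M (fst (nxt p w)) (snd (nxt p w)) z (h w)"
      by (auto dest!: bchoice)
    define N where "N = (\<Sum>w\<in>W. h w)"
    obtain z where z: "\<forall>i. z i \<in> W" "\<not> lam_eq_rho M (fst p) (snd p) z (1 + N)"
      using Bp unfolding Bad_def by blast
    have "h (z 1) \<le> N" unfolding N_def using z(1) assms(1) by (intro member_le_sum) auto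
    moreover have "lam_eq_rho M (fst (nxt p (z 1))) (snd (nxt p (z 1))) (\<lambda>i. z (1 + i)) (h (z 1))"
      by (rule h) (use z(1) in auto)
    ultimately have "lam_eq_rho M (fst (nxt p (z 1))) (snd (nxt p (z 1))) (\<lambda>i. z (1 + i)) N"
      by (rule lam_rho_eq_mono[rotated])
    then show False using z(2) lam_rho_shift[of M "fst p" "snd p" z 1 N] by (simp add: nxt_def)
  qed
  have "\<exists>s. \<forall>n. (Bad (s n) \<and> (n = 0 \<longrightarrow> s n = (x, y))) \<and> (\<exists>w\<in>W. s (Suc n) = nxt (s n) w)"
  proof (rule dependent_nat_choice)
    show "\<exists>p. Bad p \<and> (0 = (0::nat) \<longrightarrow> p = (x, y))" using bad by (auto simp: Bad_def)
    fix p and n :: nat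
    assume "Bad p \<and> (n = 0 \<longrightarrow> p = (x, y))"
    then show "\<exists>q. (Bad q \<and> (Suc n = 0 \<longrightarrow> q = (x, y))) \<and> (\<exists>w\<in>W. q = nxt p w)"
      using step[of p] by blast
  qed
  then obtain s where s: "\<And>n. Bad (s n)" "s 0 = (x, y)" "\<And>n. \<exists>w\<in>W. s (Suc n) = nxt (s n) w" by blast
  then obtain w where w: "\<And>n. w n \<in> W" "\<And>n. s (Suc n) = nxt (s n) (w n)" by metis
  \<comment> \<open>Letters are indexed from 1, choices from 0.\<close>
  define z where "z i = w (i - 1)" for i
  have "(lam M x y z n, rho M x y z n) = s n" for n
  proof (induction n)
    case (Suc n)
    then show ?case using w(2)[of n] by (simp add: nxt_def z_def flip: Suc)
  qed (simp add: s)
  moreover have "fst (s n) \<noteq> snd (s n)" for n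
    using s(1)[of n] unfolding Bad_def by (metis lam.simps(1) rho.simps(1))
  ultimately have "\<not> lam_eq_rho M x y z n" for n by (metis fst_conv snd_conv)
  then show ?thesis using w(1) by (intro exI[of _ z]) (simp add: z_def)
qed

text \<open>The sum of the individual exponents bounds them all, and equality persists.
  \<open>k\<close> accommodates the bound 2 in the definition of PE.\<close>

lemma uniform_lam_rho:
  assumes "finite A" "\<forall>a\<in>A. \<exists>n. lam_eq_rho M (X a) (Y a) (Z a) n"
  shows "\<exists>n\<ge>k. \<forall>a\<in>A. lam_eq_rho M (X a) (Y a) (Z a) n"
proof -
  obtain h where h: "\<And>a. a \<in> A \<Longrightarrow> lam_eq_rho M (X a) (Y a) (Z a) (h a)"
    using bchoice[OF assms(2)] by blast
  have "lam_eq_rho M (X a) (Y a) (Z a) (k + sum h A)" if a: "a \<in> A" for a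
    by (rule lam_rho_eq_mono[OF h[OF a]]) (use member_le_sum[of a A h] a assms(1) in simp)
  then show ?thesis by (metis le_add1)
qed

lemma one_S1:
  "\<one>\<^bsub>S1 S\<^esub> \<in> carrier (S1 S)"
  "p \<in> Some ` carrier S \<Longrightarrow> omul (sgmult S) p \<one>\<^bsub>S1 S\<^esub> = p"
  "p \<in> Some ` carrier S \<Longrightarrow> omul (sgmult S) \<one>\<^bsub>S1 S\<^esub> p = p"
proof -
  have unique: "\<exists>!e. is_identity S e" if "\<exists>e. is_identity S e"
    using that unfolding is_identity_def by metis
  have "(\<exists>e. is_identity S e \<and> \<one>\<^bsub>S1 S\<^esub> = Some e \<and> carrier (S1 S) = Some ` carrier S) \<or>
      \<one>\<^bsub>S1 S\<^esub> = None \<and> None \<in> carrier (S1 S)"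
    using theI'[OF unique] by (auto simp: S1_def)
  then show "\<one>\<^bsub>S1 S\<^esub> \<in> carrier (S1 S)"
    "p \<in> Some ` carrier S \<Longrightarrow> omul (sgmult S) p \<one>\<^bsub>S1 S\<^esub> = p"
    "p \<in> Some ` carrier S \<Longrightarrow> omul (sgmult S) \<one>\<^bsub>S1 S\<^esub> p = p"
    by (auto simp: is_identity_def)
qed

lemma carrier_S1:
  "Some ` carrier S \<subseteq> carrier (S1 S)" "carrier (S1 S) \<subseteq> with_None (carrier S)"
  by (auto simp: S1_def)

lemma (in finite_sgrp) lam_rho_S1:
  assumes "a \<in> Some ` carrier S" "b \<in> Some ` carrier S"
    and "\<And>i. 1 \<le> i \<Longrightarrow> i \<le> n \<Longrightarrow> z' i \<in> with_None (carrier S)"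
    and "\<And>i. 1 \<le> i \<Longrightarrow> i \<le> n \<Longrightarrow> z i = z' i \<or> z i = \<one>\<^bsub>S1 S\<^esub> \<and> z' i = None"
  shows "lam (S1 S) a b z n = lam (OM (sgmult S)) a b z' n \<and> rho (S1 S) a b z n = rho (OM (sgmult S)) a b z' n"
proof -
  have "lam (S1 S) a b z n = lam (OM (sgmult S)) a b z' n \<and> rho (S1 S) a b z n = rho (OM (sgmult S)) a b z' n \<and>
    lam (S1 S) a b z n \<in> Some ` carrier S \<and> rho (S1 S) a b z n \<in> Some ` carrier S"
  proof (rule lam_rho_transfer)
    fix i p assume ip: "1 \<le> i" "i \<le> n" "p \<in> Some ` carrier S"
    have "omul (sgmult S) p (z i) = omul (sgmult S) p (z' i)"
      using assms(4)[OF ip(1,2)] one_S1(2)[OF ip(3)] by auto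
    then show "p \<otimes>\<^bsub>S1 S\<^esub> z i = p \<otimes>\<^bsub>OM (sgmult S)\<^esub> z' i \<and> p \<otimes>\<^bsub>S1 S\<^esub> z i \<in> Some ` carrier S"
      using omul_with_None(2)[OF closed ip(3) assms(3)[OF ip(1,2)]] by simp
  qed (use assms(1,2) closed in auto)
  then show ?thesis by blast
qed

text \<open>The definition wants one n for all sequences, whereas on the right n may depend on the
  sequence. \<open>konig_lam_rho\<close> closes the gap for each pair, and a sum over the finitely
  many pairs does the rest.\<close>

lemma MN_iff:
  "S \<in> MN \<longleftrightarrow> finite_sgrp S \<and> (\<forall>a\<in>carrier S. \<forall>b\<in>carrier S. \<forall>z. (\<forall>i. z i \<in> with_None (carrier S)) \<longrightarrow>
     (\<exists>n. lam_eq_rho (OM (sgmult S)) (Some a) (Some b) z n))"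
  (is "_ \<longleftrightarrow> _ \<and> ?R")
proof (cases "finite_sgrp S")
  case True
  then interpret finite_sgrp S .
  have "S \<in> MN \<longleftrightarrow> ?R"
  proof
    assume "S \<in> MN"
    then obtain n where n: "\<forall>a\<in>carrier S. \<forall>b\<in>carrier S. \<forall>c. (\<forall>i\<in>{1..n}. c i \<in> carrier (S1 S)) \<longrightarrow>
        lam_eq_rho (S1 S) (Some a) (Some b) c n" unfolding MN_def by blast
    show ?R
    proof (intro ballI allI impI exI)
      fix a b and z :: "nat \<Rightarrow> _" assume ab: "a \<in> carrier S" "b \<in> carrier S" and z: "\<forall>i. z i \<in> with_None (carrier S)"
      \<comment> \<open>\<open>None\<close> need not belong to \<open>S1 S\<close>; the identity of
        \<open>S1 S\<close> acts in the same way on the words.\<close>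
      define c where "c i = (if z i = None then \<one>\<^bsub>S1 S\<^esub> else z i)" for i
      have "c i \<in> carrier (S1 S)" for i using z[rule_format, of i] one_S1(1) carrier_S1(1)[of S]
        by (auto simp: c_def)
      then have "lam_eq_rho (S1 S) (Some a) (Some b) c n" using n ab by blast
      moreover have "lam (S1 S) (Some a) (Some b) c n = lam (OM (sgmult S)) (Some a) (Some b) z n \<and>
          rho (S1 S) (Some a) (Some b) c n = rho (OM (sgmult S)) (Some a) (Some b) z n"
        by (rule lam_rho_S1) (use ab z in \<open>auto simp: c_def\<close>)
      ultimately show "lam_eq_rho (OM (sgmult S)) (Some a) (Some b) z n"
        by simp
    qed
  next
    assume R: ?R
    have "\<exists>n. \<forall>z. (\<forall>i. z i \<in> with_None (carrier S)) \<longrightarrow>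
      lam_eq_rho (OM (sgmult S)) (Some a) (Some b) z n"
      if ab: "a \<in> carrier S" "b \<in> carrier S" for a b
    proof (rule ccontr)
      assume "\<not> ?thesis"
      then have bad: "\<exists>z. (\<forall>i. z i \<in> with_None (carrier S)) \<and>
          \<not> lam_eq_rho (OM (sgmult S)) (Some a) (Some b) z n" for n by blast
      have "\<exists>z. (\<forall>i. z i \<in> with_None (carrier S)) \<and>
          (\<forall>n. \<not> lam_eq_rho (OM (sgmult S)) (Some a) (Some b) z n)"
        by (rule konig_lam_rho) (use finite_carrier bad in simp_all)
      then show False using R ab by blast
    qed
    then obtain h where h: "\<And>a b z. a \<in> carrier S \<Longrightarrow> b \<in> carrier S \<Longrightarrow> \<forall>i. z i \<in> with_None (carrier S) \<Longrightarrow>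
      lam_eq_rho (OM (sgmult S)) (Some a) (Some b) z (h a b)" by metis
    define N where "N = (\<Sum>(a, b)\<in>carrier S \<times> carrier S. h a b)"
    have "lam_eq_rho (S1 S) (Some a) (Some b) c N"
      if ab: "a \<in> carrier S" "b \<in> carrier S" and c: "\<forall>i\<in>{1..N}. c i \<in> carrier (S1 S)" for a b c
    proof -
      have "h a b \<le> N" unfolding N_def
        using member_le_sum[of "(a, b)" "carrier S \<times> carrier S" "\<lambda>(a, b). h a b"] ab finite_carrier by simp
      \<comment> \<open>Letters are controlled only up to \<open>N\<close>; beyond it
        \<open>None\<close> is a safe value.\<close>
      define z where "z i = (if i \<in> {1..N} then c i else None)" for i
      have z: "z i \<in> with_None (carrier S)" for i
        using c carrier_S1(2)[of S] unfolding z_def by (cases "i \<in> {1..N}") auto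
      have "lam_eq_rho (OM (sgmult S)) (Some a) (Some b) z N"
        using lam_rho_eq_mono[OF h[OF ab] \<open>h a b \<le> N\<close>] z by blast
      moreover have "lam (S1 S) (Some a) (Some b) c N = lam (OM (sgmult S)) (Some a) (Some b) z N \<and>
          rho (S1 S) (Some a) (Some b) c N = rho (OM (sgmult S)) (Some a) (Some b) z N"
      proof (rule lam_rho_S1)
        show "z i \<in> with_None (carrier S)" for i by (rule z)
        show "c i = z i \<or> c i = \<one>\<^bsub>S1 S\<^esub> \<and> z i = None" if "1 \<le> i" "i \<le> N" for i
          using that by (simp add: z_def)
      qed (use ab in auto)
      ultimately show ?thesis by simp
    qed
    then show "S \<in> MN" using True unfolding MN_def by blast
  qed
  with True show ?thesis by simp
qed (simp add: MN_def)

lemma PE_seq_OM_None: "PE_seq (OM f) None = (\<lambda>_. None)"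
proof -
  have "None [^]\<^bsub>OM f\<^esub> (k::nat) = None" for k by (induction k) (auto simp: nat_pow_def)
  then show ?thesis by (auto simp: PE_seq_def)
qed

lemma nat_pow_OM_Suc: "Some c [^]\<^bsub>OM f\<^esub> (Suc 0) = Some c" "x [^]\<^bsub>OM f\<^esub> Suc k = omul f (x [^]\<^bsub>OM f\<^esub> k) x"
  by (simp_all add: nat_pow_def)

lemma nat_pow_OM_closed:
  assumes "\<And>x y. x \<in> T \<Longrightarrow> y \<in> T \<Longrightarrow> f x y \<in> T" "x \<in> with_None T"
  shows "x [^]\<^bsub>OM f\<^esub> (k::nat) \<in> with_None T"
proof (induction k)
  case 0 then show ?case by (simp add: nat_pow_def)
next
  case (Suc k)
  show ?case unfolding nat_pow_OM_Suc(2) by (rule omul_with_None(1)[OF assms(1) Suc assms(2)])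
qed

lemma PE_seq_OM_closed:
  assumes "\<And>x y. x \<in> T \<Longrightarrow> y \<in> T \<Longrightarrow> f x y \<in> T" "c \<in> with_None T"
  shows "PE_seq (OM f) c i \<in> with_None T"
  using nat_pow_OM_closed[where f = f and T = T and x = c, OF assms] by (simp add: PE_seq_def)

text \<open>The monoids can disagree only at the letters 1; positive powers of an element of
  \<open>S\<close> coincide.\<close>

lemma (in finite_sgrp) PE_seq_S1:
  assumes "c \<in> carrier S"
  shows "PE_seq (S1 S) (Some c) i = PE_seq (OM (sgmult S)) (Some c) i \<or>
     PE_seq (S1 S) (Some c) i = \<one>\<^bsub>S1 S\<^esub> \<and> PE_seq (OM (sgmult S)) (Some c) i = None"
proof (cases "i \<le> 2")
  case False
  have "Some c [^]\<^bsub>S1 S\<^esub> Suc k = Some c [^]\<^bsub>OM (sgmult S)\<^esub> Suc k" for k :: nat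
  proof (induction k)
    case 0 then show ?case using one_S1(3)[of "Some c" S] assms by (simp add: nat_pow_def)
  next
    case (Suc k)
    then show ?case by (simp add: nat_pow_def)
  qed
  moreover obtain k where "i - 2 = Suc k" using False
    by (metis Suc_diff_le diff_is_0_eq not_less_eq_eq old.nat.exhaust)
  ultimately show ?thesis using False by (simp add: PE_seq_def)
qed (simp add: PE_seq_def)

lemma (in finite_sgrp) PE_pointwise:
  assumes "a \<in> carrier S" "b \<in> carrier S"
  shows "(\<forall>c\<in>carrier (S1 S). \<exists>n. lam_eq_rho (S1 S) (Some a) (Some b) (PE_seq (S1 S) c) n)
    \<longleftrightarrow> (\<forall>c\<in>with_None (carrier S). \<exists>n. lam_eq_rho (OM (sgmult S)) (Some a) (Some b) (PE_seq (OM (sgmult S)) c) n)"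
proof -
  let ?E = "\<lambda>M c. \<exists>n. lam_eq_rho M (Some a) (Some b) (PE_seq M c) n"
  let ?O = "OM (sgmult S)"
  have eq_Some: "?E (S1 S) (Some c) \<longleftrightarrow> ?E ?O (Some c)" if c: "c \<in> carrier S" for c
  proof -
    have "PE_seq ?O (Some c) i \<in> with_None (carrier S)" for i
      by (rule PE_seq_OM_closed) (use c closed in auto)
    then show ?thesis
      using lam_rho_S1[of "Some a" "Some b" _ "PE_seq ?O (Some c)" "PE_seq (S1 S) (Some c)"] assms PE_seq_S1[OF c]
      by simp
  qed
  have eq_None: "?E ?O None \<longleftrightarrow> ?E (S1 S) \<one>\<^bsub>S1 S\<^esub>"
  proof -
    have pow1: "\<one>\<^bsub>S1 S\<^esub> [^]\<^bsub>S1 S\<^esub> (k::nat) = \<one>\<^bsub>S1 S\<^esub>" for k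
    proof (induction k)
      case (Suc k)
      have "omul (sgmult S) \<one>\<^bsub>S1 S\<^esub> \<one>\<^bsub>S1 S\<^esub> = \<one>\<^bsub>S1 S\<^esub>"
        using subsetD[OF carrier_S1(2) one_S1(1)[of S]] one_S1(2)[of "\<one>\<^bsub>S1 S\<^esub>" S] by auto
      with Suc show ?case by (simp add: nat_pow_def)
    qed (simp add: nat_pow_def)
    have "PE_seq (S1 S) \<one>\<^bsub>S1 S\<^esub> i = \<one>\<^bsub>S1 S\<^esub>" for i by (simp add: PE_seq_def pow1)
    then show ?thesis
      using lam_rho_S1[of "Some a" "Some b" _ "PE_seq ?O None" "PE_seq (S1 S) \<one>\<^bsub>S1 S\<^esub>"] assms
      by (simp add: PE_seq_OM_None)
  qed
  show ?thesis
  proof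
    assume *: "\<forall>c\<in>carrier (S1 S). ?E (S1 S) c"
    show "\<forall>c\<in>with_None (carrier S). ?E ?O c"
    proof
      fix c assume "c \<in> with_None (carrier S)"
      then consider "c = None" | c' where "c = Some c'" "c' \<in> carrier S" by blast
      then show "?E ?O c"
      proof cases
        case 1
        have "?E (S1 S) \<one>\<^bsub>S1 S\<^esub>" by (rule bspec[OF * one_S1(1)])
        then show ?thesis unfolding 1 eq_None .
      next
        case 2
        then have "Some c' \<in> carrier (S1 S)" using carrier_S1(1)[of S] by blast
        then have "?E (S1 S) (Some c')" by (rule bspec[OF *])
        then show ?thesis unfolding 2(1) eq_Some[OF 2(2)] .
      qed
    qed
  next
    assume *: "\<forall>c\<in>with_None (carrier S). ?E ?O c"
    show "\<forall>c\<in>carrier (S1 S). ?E (S1 S) c"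
    proof
      fix c assume c: "c \<in> carrier (S1 S)"
      then consider "c = None" "\<one>\<^bsub>S1 S\<^esub> = None" | c' where "c = Some c'" "c' \<in> carrier S"
        by (auto simp: S1_def split: if_splits)
      then show "?E (S1 S) c"
      proof cases
        case 1
        have "?E ?O None" by (rule bspec[OF *]) simp
        then show ?thesis unfolding eq_None unfolding 1 .
      next
        case 2
        then have "?E ?O (Some c')" by (intro bspec[OF *]) simp
        then show ?thesis unfolding 2(1) eq_Some[OF 2(2)] .
      qed
    qed
  qed
qed

lemma PE_iff:
  "S \<in> PE \<longleftrightarrow> finite_sgrp S \<and> (\<forall>a\<in>carrier S. \<forall>b\<in>carrier S. \<forall>c\<in>with_None (carrier S).
     \<exists>n. lam_eq_rho (OM (sgmult S)) (Some a) (Some b) (PE_seq (OM (sgmult S)) c) n)" (is "_ \<longleftrightarrow> _ \<and> ?R")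
proof (cases "finite_sgrp S")
  case True
  then interpret finite_sgrp S .
  let ?A = "carrier S \<times> carrier S \<times> carrier (S1 S)"
  have "finite ?A" using finite_carrier finite_subset[OF carrier_S1(2)[of S]] by simp
  from uniform_lam_rho[OF this, of "S1 S" "\<lambda>(a, b, c). Some a" "\<lambda>(a, b, c). Some b"
      "\<lambda>(a, b, c). PE_seq (S1 S) c" 2]
  have "S \<in> PE \<longleftrightarrow> (\<forall>a\<in>carrier S. \<forall>b\<in>carrier S. \<forall>c\<in>carrier (S1 S). \<exists>n.
      lam_eq_rho (S1 S) (Some a) (Some b) (PE_seq (S1 S) c) n)"
    using True unfolding PE_def by fastforce
  also have "\<dots> \<longleftrightarrow> ?R" using PE_pointwise by simp
  finally show ?thesis using True by simp
qed (simp add: PE_def)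

lemma TM_iff:
  "S \<in> TM \<longleftrightarrow> finite_sgrp S \<and> (\<forall>a\<in>carrier S. \<forall>b\<in>carrier S.
     \<exists>n. lam_eq_rho (OM (sgmult S)) (Some a) (Some b) (\<lambda>_. None) n)"
  (is "_ \<longleftrightarrow> _ \<and> ?R")
proof (cases "finite_sgrp S")
  case True
  then interpret finite_sgrp S .
  have eq: "lam (S1 S) (Some a) (Some b) (\<lambda>_. \<one>\<^bsub>S1 S\<^esub>) n = lam (OM (sgmult S)) (Some a) (Some b) (\<lambda>_. None) n \<and>
     rho (S1 S) (Some a) (Some b) (\<lambda>_. \<one>\<^bsub>S1 S\<^esub>) n = rho (OM (sgmult S)) (Some a) (Some b) (\<lambda>_. None) n"
    if "a \<in> carrier S" "b \<in> carrier S" for a b n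
    by (rule lam_rho_S1) (use that in auto)
  let ?E = "\<lambda>a b n. lam_eq_rho (OM (sgmult S)) (Some a) (Some b) (\<lambda>_. None) n"
  have "S \<in> TM \<longleftrightarrow> (\<exists>n. \<forall>a\<in>carrier S. \<forall>b\<in>carrier S. ?E a b n)" using True eq by (simp add: TM_def)
  moreover have "finite (carrier S \<times> carrier S)" using finite_carrier by simp
  from uniform_lam_rho[OF this, of "OM (sgmult S)" "\<lambda>(a, b). Some a" "\<lambda>(a, b). Some b" "\<lambda>_ _. None" 0]
  have "(\<forall>a\<in>carrier S. \<forall>b\<in>carrier S. \<exists>n. ?E a b n) \<Longrightarrow> \<exists>n. \<forall>a\<in>carrier S. \<forall>b\<in>carrier S. ?E a b n" by simp
  ultimately have "S \<in> TM \<longleftrightarrow> ?R" by blast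
  then show ?thesis using True by simp
qed (simp add: TM_def)

section \<open>Upper bounds for MN, PE and TM\<close>

lemma sgrp_gen_carrier_update [simp]: "sgrp_gen (S\<lparr>carrier := T\<rparr>) A = sgrp_gen S A"
proof (intro equalityI subsetI)
  fix x assume "x \<in> sgrp_gen (S\<lparr>carrier := T\<rparr>) A"
  then show "x \<in> sgrp_gen S A" by induction (auto intro: sgrp_gen.intros)
next
  fix x assume "x \<in> sgrp_gen S A"
  then show "x \<in> sgrp_gen (S\<lparr>carrier := T\<rparr>) A"
  proof induction
    case (mult x y) then show ?case using sgrp_gen.mult[of x "S\<lparr>carrier := T\<rparr>" A y] by simp
  qed (rule sgrp_gen.base)
qed

lemma sgrp_gen_least:
  assumes "A \<subseteq> T" "\<And>x y. x \<in> T \<Longrightarrow> y \<in> T \<Longrightarrow> x \<cdot>\<^bsub>S\<^esub> y \<in> T"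
  shows "sgrp_gen S A \<subseteq> T"
proof
  fix x assume "x \<in> sgrp_gen S A"
  then show "x \<in> T" by induction (use assms in auto)
qed

lemma (in finite_sgrp) subsgrp_sgrp_gen:
  assumes "A \<subseteq> carrier S" "A \<noteq> {}"
  shows "subsgrp (sgrp_gen S A) S"
  unfolding subsgrp_def
  using assms sgrp_gen_least[OF assms(1) closed] by (auto intro: sgrp_gen.intros)

lemma n_generated_sgrp_gen:
  assumes "finite A" "card A \<le> n"
  shows "n_generated n (S\<lparr>carrier := sgrp_gen S A\<rparr>)"
  unfolding n_generated_def using assms by (intro exI[of _ A]) (auto intro: sgrp_gen.base)

lemma (in finite_sgrp) finite_sgrp_subsgrp:
  assumes "subsgrp T S" shows "finite_sgrp (S\<lparr>carrier := T\<rparr>)"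
  using assms finite_subset[of T "carrier S"] finite_carrier assoc
  by unfold_locales (auto simp: subsgrp_def subset_iff)

text \<open>With all letters 1 the words remain \<open>a\<close> and \<open>b\<close>, in one order
  or the other, so they never meet. The constant sequence is the PE sequence for c = 1.\<close>

lemma (in finite_sgrp) band_not_PE:
  assumes "a \<in> carrier S" "b \<in> carrier S" "a \<noteq> b" "a \<cdot> a = a" "b \<cdot> b = b"
    and "a \<cdot> b = a \<and> b \<cdot> a = b \<or> a \<cdot> b = b \<and> b \<cdot> a = a"
  shows "S\<lparr>carrier := sgrp_gen S {a, b}\<rparr> \<notin> PE" "S\<lparr>carrier := sgrp_gen S {a, b}\<rparr> \<notin> TM"
proof -
  have "{lam (OM (sgmult S)) (Some a) (Some b) (\<lambda>_. None) n, rho (OM (sgmult S)) (Some a) (Some b) (\<lambda>_. None) n} = {Some a, Some b}"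
    for n
  proof (induction n)
    case (Suc n)
    then show ?case using assms(4-6) by (auto simp: doubleton_eq_iff)
  qed simp
  then have neq: "\<not> lam_eq_rho (OM (sgmult S)) (Some a) (Some b) (\<lambda>_. None) n" for n
    using assms(3) unfolding doubleton_eq_iff by (metis option.inject)
  have gen: "a \<in> sgrp_gen S {a, b}" "b \<in> sgrp_gen S {a, b}" by (auto intro: sgrp_gen.base)
  show "S\<lparr>carrier := sgrp_gen S {a, b}\<rparr> \<notin> TM" unfolding TM_iff using gen neq by auto
  show "S\<lparr>carrier := sgrp_gen S {a, b}\<rparr> \<notin> PE"
  proof
    assume "S\<lparr>carrier := sgrp_gen S {a, b}\<rparr> \<in> PE"
    then have "\<forall>c\<in>with_None (sgrp_gen S {a, b}). \<exists>n. lam_eq_rho (OM (sgmult S)) (Some a) (Some b) (PE_seq (OM (sgmult S)) c) n"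
      unfolding PE_iff using gen by simp
    from bspec[OF this, of None] show False using neq by (simp add: PE_seq_OM_None)
  qed
qed

lemma rank_at_mostI:
  assumes "\<And>S. finite_sgrp S \<Longrightarrow>
      (\<And>A. A \<subseteq> carrier S \<Longrightarrow> A \<noteq> {} \<Longrightarrow> finite A \<Longrightarrow> card A \<le> n \<Longrightarrow> S\<lparr>carrier := sgrp_gen S A\<rparr> \<in> V) \<Longrightarrow> S \<in> V"
  shows "rank_at_most V n"
  unfolding rank_at_most_def
proof (intro allI impI)
  fix S assume S: "finite_sgrp S"
    and T: "\<forall>T. subsgrp T S \<and> n_generated n (S\<lparr>carrier := T\<rparr>) \<longrightarrow> S\<lparr>carrier := T\<rparr> \<in> V"
  show "S \<in> V"
  proof (rule assms[OF S])
    fix A assume A: "A \<subseteq> carrier S" "A \<noteq> {}" "finite A" "card A \<le> n"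
    show "S\<lparr>carrier := sgrp_gen S A\<rparr> \<in> V"
      by (rule T[rule_format, OF conjI[OF finite_sgrp.subsgrp_sgrp_gen[OF S A(1,2)] n_generated_sgrp_gen[OF A(3,4)]]])
  qed
qed

section \<open>A finite semigroup inside a total monoid\<close>

locale finite_sgrp_ext = finite_sgrp S for S :: "'a sgrp" (structure) +
  fixes out :: 'a
  assumes out_notin: "out \<notin> carrier S"
begin

text \<open>Products involving an element outside the carrier collapse to \<open>out\<close>, which makes the
  multiplication associative on the whole type.\<close>

definition ext_mult :: "'a \<Rightarrow> 'a \<Rightarrow> 'a" where
  "ext_mult x y = (if x \<in> carrier S \<and> y \<in> carrier S then x \<cdot> y else out)"

lemma ext_mult_assoc: "ext_mult (ext_mult x y) z = ext_mult x (ext_mult y z)"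
  using out_notin closed assoc by (auto simp: ext_mult_def)

lemma omul_ext_mult_assoc: "omul ext_mult (omul ext_mult x y) z = omul ext_mult x (omul ext_mult y z)"
  by (cases x; cases y; cases z) (simp_all add: ext_mult_assoc)

lemma ext_mult_closed: "x \<in> carrier S \<Longrightarrow> y \<in> carrier S \<Longrightarrow> ext_mult x y \<in> carrier S"
  using closed by (simp add: ext_mult_def)

sublocale fin_monoid "omul ext_mult" None "Some ` carrier S"
  using finite_carrier ext_mult_closed by unfold_locales (auto simp: omul_ext_mult_assoc)

lemma C_eq: "C = with_None (carrier S)" by (simp add: C_def)

lemma omul_ext_mult: "x \<in> C \<Longrightarrow> y \<in> C \<Longrightarrow> omul ext_mult x y = omul (sgmult S) x y"
  by (auto simp: C_eq ext_mult_def)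

lemma lam_rho_M:
  assumes "a \<in> Some ` carrier S" "b \<in> Some ` carrier S" "\<And>i. z i \<in> C"
  shows "lam M a b z n = lam (OM (sgmult S)) a b z n \<and> rho M a b z n = rho (OM (sgmult S)) a b z n"
proof -
  have "lam M a b z n = lam (OM (sgmult S)) a b z n \<and> rho M a b z n = rho (OM (sgmult S)) a b z n \<and>
    lam M a b z n \<in> Some ` carrier S \<and> rho M a b z n \<in> Some ` carrier S"
  proof (rule lam_rho_transfer)
    show "p \<otimes>\<^bsub>M\<^esub> z i = p \<otimes>\<^bsub>OM (sgmult S)\<^esub> z i \<and> p \<otimes>\<^bsub>M\<^esub> z i \<in> Some ` carrier S"
      if "p \<in> Some ` carrier S" for i p
      using omul_ext_mult[OF I_C[OF that] assms(3)[of i]] I_ideal(1)[OF that assms(3)[of i]] by simp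
    show "x \<otimes>\<^bsub>M\<^esub> y = x \<otimes>\<^bsub>OM (sgmult S)\<^esub> y \<and> x \<otimes>\<^bsub>M\<^esub> y \<in> Some ` carrier S"
      if "x \<in> Some ` carrier S" "y \<in> Some ` carrier S" for x y
      using omul_ext_mult[OF I_C[OF that(1)] I_C[OF that(2)]] I_closed[OF that] by simp
  qed (use assms in auto)
  then show ?thesis by blast
qed

lemma PE_seq_M:
  assumes "c \<in> C" shows "PE_seq M c = PE_seq (OM (sgmult S)) c"
proof -
  have "c [^]\<^bsub>M\<^esub> k = c [^]\<^bsub>OM (sgmult S)\<^esub> k" for k :: nat
  proof (induction k)
    case 0 then show ?case by (simp add: nat_pow_def)
  next
    case (Suc k)
    have "c [^]\<^bsub>M\<^esub> Suc k = omul (sgmult S) (c [^]\<^bsub>M\<^esub> k) c"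
      using omul_ext_mult[OF pow_C[OF assms, of k] assms] by simp
    then show ?case using Suc by (simp add: nat_pow_OM_Suc)
  qed
  then show ?thesis by (auto simp: PE_seq_def)
qed

lemma PE_seq_C: "c \<in> C \<Longrightarrow> PE_seq M c i \<in> C" by (simp add: PE_seq_def)

lemma M_eq_iff:
  assumes "a \<in> carrier S" "b \<in> carrier S" "\<And>i. z i \<in> C"
  shows "lam_eq_rho M (Some a) (Some b) z n \<longleftrightarrow>
    lam_eq_rho (OM (sgmult S)) (Some a) (Some b) z n"
  using lam_rho_M[of "Some a" "Some b" z n] assms by auto

lemma M_PE_eq_iff:
  assumes "a \<in> carrier S" "b \<in> carrier S" "c \<in> C"
  shows "lam_eq_rho M (Some a) (Some b) (PE_seq M c) n \<longleftrightarrow>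
    lam_eq_rho (OM (sgmult S)) (Some a) (Some b) (PE_seq (OM (sgmult S)) c) n"
  using M_eq_iff[OF assms(1,2), of "PE_seq M c" n] PE_seq_C[OF assms(3)] unfolding PE_seq_M[OF assms(3)] by blast

text \<open>Taking for \<open>T\<close> the subsemigroup generated by the two witnesses turns the
  obstruction into a two-generated failure of PE. It is also a failure of MN, because the letters of
  the PE sequence lie in that subsemigroup with an identity adjoined.\<close>

lemma PE_obstructionE:
  assumes PE_obstruction
  obtains A where "A \<subseteq> carrier S" "A \<noteq> {}" "finite A" "card A \<le> 2"
    "S\<lparr>carrier := sgrp_gen S A\<rparr> \<notin> PE" "S\<lparr>carrier := sgrp_gen S A\<rparr> \<notin> MN"
proof -
  from assms obtain a c where ac: "a \<in> carrier S" "c \<in> carrier S" and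
    T: "\<And>T. T \<subseteq> Some ` carrier S \<Longrightarrow> Some a \<in> T \<Longrightarrow> Some c \<in> T \<Longrightarrow> (\<forall>p\<in>T. \<forall>q\<in>T. omul ext_mult p q \<in> T) \<Longrightarrow>
     (\<exists>a'\<in>T. \<exists>b'\<in>T. \<exists>c'\<in>T. \<forall>n. \<not> lam_eq_rho M a' b' (PE_seq M c') n)"
    unfolding PE_obstruction_def by blast
  define U where "U = sgrp_gen S {a, c}"
  have U: "subsgrp U S" unfolding U_def by (rule subsgrp_sgrp_gen) (use ac in auto)
  then have UC: "U \<subseteq> carrier S" "\<And>x y. x \<in> U \<Longrightarrow> y \<in> U \<Longrightarrow> x \<cdot> y \<in> U" by (auto simp: subsgrp_def)
  have "a \<in> U" "c \<in> U" unfolding U_def by (auto intro: sgrp_gen.base)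
  then obtain a' b' c' where abc: "a' \<in> U" "b' \<in> U" "c' \<in> U"
     "\<And>n. \<not> lam_eq_rho M (Some a') (Some b') (PE_seq M (Some c')) n"
    using T[of "Some ` U"] UC by (fastforce simp: ext_mult_def)
  have c': "Some c' \<in> C" using abc(3) UC(1) by (auto simp: C_eq)
  have bad: "\<not> lam_eq_rho (OM (sgmult S)) (Some a') (Some b') (PE_seq (OM (sgmult S)) (Some c')) n" for n
    using abc(4)[of n] M_PE_eq_iff[OF subsetD[OF UC(1) abc(1)] subsetD[OF UC(1) abc(2)] c', of n] by simp
  have "S\<lparr>carrier := U\<rparr> \<notin> PE" using bad abc(1-3) unfolding PE_iff by auto
  moreover have "PE_seq (OM (sgmult S)) (Some c') i \<in> with_None U" for i
    by (rule PE_seq_OM_closed) (use UC abc in auto)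
  then have "S\<lparr>carrier := U\<rparr> \<notin> MN" using bad abc(1,2) unfolding MN_iff by auto
  ultimately show thesis using that[of "{a, c}"] ac by (simp add: U_def card_insert_if)
qed

text \<open>R-related idempotents are left identities of each other, hence form a right zero band.
  The adjoined identity is excluded, since it would make the two equal.\<close>

lemma R_idempotents:
  assumes "e \<in> C" "g \<in> C" "omul ext_mult e e = e" "omul ext_mult g g = g" "R e g" "e \<noteq> g"
  obtains a b where "a \<in> carrier S" "b \<in> carrier S" "a \<noteq> b" "a \<cdot> a = a" "b \<cdot> b = b" "a \<cdot> b = b" "b \<cdot> a = a"
proof -
  obtain s t where st: "s \<in> C" "t \<in> C" "e = omul ext_mult g s" "g = omul ext_mult e t"
    using assms(5) by (auto simp: R_def)
  have eg: "omul ext_mult g e = e" "omul ext_mult e g = g"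
    using assms(3,4) st(3,4) omul_ext_mult_assoc by metis+
  obtain a b where ab: "e = Some a" "g = Some b"
    using assms(6) eg by (cases e; cases g) auto
  with assms(1,2) have "a \<in> carrier S" "b \<in> carrier S" by (auto simp: C_eq)
  then show thesis using that[of a b] assms(3,4,6) eg ab by (simp add: ext_mult_def)
qed

lemma L_idempotents:
  assumes "e \<in> C" "g \<in> C" "omul ext_mult e e = e" "omul ext_mult g g = g" "L e g" "e \<noteq> g"
  obtains a b where "a \<in> carrier S" "b \<in> carrier S" "a \<noteq> b" "a \<cdot> a = a" "b \<cdot> b = b" "a \<cdot> b = a" "b \<cdot> a = b"
proof -
  obtain s t where st: "s \<in> C" "t \<in> C" "e = omul ext_mult s g" "g = omul ext_mult t e"
    using assms(5) by (auto simp: L_def)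
  have eg: "omul ext_mult g e = g" "omul ext_mult e g = e"
    using assms(3,4) st(3,4) omul_ext_mult_assoc by metis+
  obtain a b where ab: "e = Some a" "g = Some b"
    using assms(6) eg by (cases e; cases g) auto
  with assms(1,2) have "a \<in> carrier S" "b \<in> carrier S" by (auto simp: C_eq)
  then show thesis using that[of a b] assms(3,4,6) eg ab by (simp add: ext_mult_def)
qed

text \<open>Two distinct R- or L-related idempotents would generate a failing band, so the
  hypothesis supplies the uniqueness of idempotents that \<open>PE_failure\<close> demands.\<close>

lemma PE_rank:
  assumes "\<And>A. A \<subseteq> carrier S \<Longrightarrow> A \<noteq> {} \<Longrightarrow> finite A \<Longrightarrow> card A \<le> 2 \<Longrightarrow> S\<lparr>carrier := sgrp_gen S A\<rparr> \<in> PE"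
  shows "S \<in> PE"
proof (rule ccontr)
  assume "S \<notin> PE"
  then obtain a b c where abc: "a \<in> carrier S" "b \<in> carrier S" "c \<in> with_None (carrier S)"
    "\<And>n. \<not> lam_eq_rho (OM (sgmult S)) (Some a) (Some b) (PE_seq (OM (sgmult S)) c) n"
    unfolding PE_iff using finite_sgrp_axioms by blast
  have c: "c \<in> C" using abc(3) by (simp add: C_eq)
  have no_band: False if "p \<in> carrier S" "q \<in> carrier S" "p \<noteq> q" "p \<cdot> p = p" "q \<cdot> q = q"
    "p \<cdot> q = p \<and> q \<cdot> p = q \<or> p \<cdot> q = q \<and> q \<cdot> p = p" for p q
    using band_not_PE(1)[OF that] assms[of "{p, q}"] that(1-3) by (simp add: card_insert_if)
  have PE_obstruction
  proof (rule PE_failure[of "Some a" "Some b" c])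
    show "\<not> lam_eq_rho M (Some a) (Some b) (PE_seq M c) n" for n
      using abc(4)[of n] M_PE_eq_iff[OF abc(1,2) c, of n] by simp
    show "e = g" if "e \<in> C" "g \<in> C" "omul ext_mult e e = e" "omul ext_mult g g = g" "R e g" for e g
      using R_idempotents[OF that] no_band by metis
    show "e = g" if "e \<in> C" "g \<in> C" "omul ext_mult e e = e" "omul ext_mult g g = g" "L e g" for e g
      using L_idempotents[OF that] no_band by metis
  qed (use abc c in auto)
  then show False using PE_obstructionE assms by metis
qed

lemma MN_rank:
  assumes "\<And>A. A \<subseteq> carrier S \<Longrightarrow> A \<noteq> {} \<Longrightarrow> finite A \<Longrightarrow> card A \<le> 4 \<Longrightarrow> S\<lparr>carrier := sgrp_gen S A\<rparr> \<in> MN"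
  shows "S \<in> MN"
proof (rule ccontr)
  assume "S \<notin> MN"
  then obtain a b z where abz: "a \<in> carrier S" "b \<in> carrier S" "\<And>i. z i \<in> with_None (carrier S)"
    "\<And>n. \<not> lam_eq_rho (OM (sgmult S)) (Some a) (Some b) z n"
    unfolding MN_iff using finite_sgrp_axioms by blast
  have z: "z i \<in> C" for i using abz(3) by (simp add: C_eq)
  have bad: "\<not> lam_eq_rho M (Some a) (Some b) z n" for n
    using abz(4)[of n] M_eq_iff[OF abz(1,2), of z n] z by simp
  have "Some a \<in> Some ` carrier S" "Some b \<in> Some ` carrier S" using abz by auto
  from MN_failure[where z = z, OF this z bad] show False
  proof
    assume PE_obstruction
    then show False by (rule PE_obstructionE) (use assms in force)
  next
    assume "\<exists>x\<in>Some ` carrier S. \<exists>y\<in>Some ` carrier S. \<exists>w1\<in>C. \<exists>w2\<in>C. \<forall>n.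
       \<not> lam_eq_rho M x y (\<lambda>i. if odd i then w1 else w2) n"
    then obtain x y w1 w2 where xy: "x \<in> carrier S" "y \<in> carrier S" and w: "w1 \<in> C" "w2 \<in> C"
      and neq: "\<And>n. \<not> lam_eq_rho M (Some x) (Some y) (\<lambda>i. if odd i then w1 else w2) n" by blast
    \<comment> \<open>\<open>set_option\<close> drops a letter equal to the adjoined identity; at
      most 2 + 1 + 1 generators occur.\<close>
    define A where "A = {x, y} \<union> set_option w1 \<union> set_option w2"
    have A: "A \<subseteq> carrier S" "A \<noteq> {}" using xy w by (auto simp: A_def C_eq)
    have "card A \<le> card {x, y} + card (set_option w1) + card (set_option w2)"
      unfolding A_def by (meson card_Un_le le_trans add_le_mono1)
    also have "\<dots> \<le> 2 + 1 + 1"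
      by (intro add_mono) (cases w1; cases w2; simp add: card_insert_if)+
    finally have "card A \<le> 4" by simp
    moreover have "finite A" by (simp add: A_def)
    ultimately have "S\<lparr>carrier := sgrp_gen S A\<rparr> \<in> MN" using assms A by blast
    moreover have "(if odd i then w1 else w2) \<in> with_None (sgrp_gen S A)" for i :: nat
      by (cases w1; cases w2) (auto simp: A_def intro!: sgrp_gen.base)
    moreover have "x \<in> sgrp_gen S A" "y \<in> sgrp_gen S A" by (auto simp: A_def intro!: sgrp_gen.base)
    ultimately obtain n where "lam_eq_rho (OM (sgmult S)) (Some x) (Some y) (\<lambda>i. if odd i then w1 else w2) n"
      unfolding MN_iff by fastforce
    then show False using neq[of n] M_eq_iff[OF xy, of "\<lambda>i. if odd i then w1 else w2" n] w by simp
  qed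
qed

end

lemma TM_rank_le: "rank_at_most TM 2"
proof (rule rank_at_mostI)
  fix S :: "'a sgrp" assume S: "finite_sgrp S"
    and A: "\<And>A. A \<subseteq> carrier S \<Longrightarrow> A \<noteq> {} \<Longrightarrow> finite A \<Longrightarrow> card A \<le> 2 \<Longrightarrow> S\<lparr>carrier := sgrp_gen S A\<rparr> \<in> TM"
  show "S \<in> TM" unfolding TM_iff
  proof (intro conjI ballI S)
    fix a b assume ab: "a \<in> carrier S" "b \<in> carrier S"
    have "S\<lparr>carrier := sgrp_gen S {a, b}\<rparr> \<in> TM" using ab by (intro A) (auto simp: card_insert_if)
    then show "\<exists>n. lam_eq_rho (OM (sgmult S)) (Some a) (Some b) (\<lambda>_. None) n"
      unfolding TM_iff by (auto intro: sgrp_gen.base)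
  qed
qed

lemma ex_finite_sgrp_ext:
  assumes "infinite (UNIV :: 'a set)" "finite_sgrp (S :: 'a sgrp)"
  obtains out where "finite_sgrp_ext S out"
proof -
  obtain out where "out \<notin> carrier S"
    using ex_new_if_finite[OF assms(1) finite_sgrp.finite_carrier[OF assms(2)]] by blast
  then show thesis using that assms(2) by (auto simp: finite_sgrp_ext_def finite_sgrp_ext_axioms_def)
qed

lemma PE_rank_le:
  assumes "infinite (UNIV :: 'a set)"
  shows "rank_at_most (PE :: 'a sgrp set) 2"
proof (rule rank_at_mostI)
  fix S :: "'a sgrp" assume S: "finite_sgrp S"
    and A: "\<And>A. A \<subseteq> carrier S \<Longrightarrow> A \<noteq> {} \<Longrightarrow> finite A \<Longrightarrow> card A \<le> 2 \<Longrightarrow> S\<lparr>carrier := sgrp_gen S A\<rparr> \<in> PE"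
  obtain out where "finite_sgrp_ext S out" by (rule ex_finite_sgrp_ext[OF assms S])
  then show "S \<in> PE" by (rule finite_sgrp_ext.PE_rank) (rule A)
qed

lemma MN_rank_le:
  assumes "infinite (UNIV :: 'a set)"
  shows "rank_at_most (MN :: 'a sgrp set) 4"
proof (rule rank_at_mostI)
  fix S :: "'a sgrp" assume S: "finite_sgrp S"
    and A: "\<And>A. A \<subseteq> carrier S \<Longrightarrow> A \<noteq> {} \<Longrightarrow> finite A \<Longrightarrow> card A \<le> 4 \<Longrightarrow> S\<lparr>carrier := sgrp_gen S A\<rparr> \<in> MN"
  obtain out where "finite_sgrp_ext S out" by (rule ex_finite_sgrp_ext[OF assms S])
  then show "S \<in> MN" by (rule finite_sgrp_ext.MN_rank) (rule A)
qed

section \<open>Upper bound for NMN4\<close>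

lemma (in group) nilpotent_imp_engel_like:
  assumes "nilpotent_group G" shows "engel_like G"
  unfolding engel_like_def
proof (intro ballI)
  fix a c assume ac: "a \<in> carrier G" "c \<in> carrier G"
  obtain n where "\<forall>x\<in>carrier G. \<forall>y\<in>carrier G. \<forall>z. (\<forall>i. z i \<in> carrier G) \<longrightarrow> lam_eq_rho G x y z n"
    using nilpotent_imp_lam_eq_rho[OF assms] by blast
  then show "\<exists>n. lam_eq_rho G a (inv c) (PE_seq G c) n"
    using ac PE_seq_closed[OF ac(2)] by blast
qed

text \<open>For fixed \<open>a\<close> and \<open>c\<close> the words stay in any subgroup
  containing both. With \<open>engel_like_imp_nilpotent\<close> this reduces nilpotency to
  two-generated subgroups.\<close>

lemma (in group) engel_like_two_generated:
  assumes "\<And>a c. a \<in> carrier G \<Longrightarrow> c \<in> carrier G \<Longrightarrow>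
    \<exists>T. subgroup T G \<and> a \<in> T \<and> c \<in> T \<and> engel_like (G\<lparr>carrier := T\<rparr>)"
  shows "engel_like G"
  unfolding engel_like_def
proof (intro ballI)
  fix a c assume "a \<in> carrier G" "c \<in> carrier G"
  then obtain T where T: "subgroup T G" "a \<in> T" "c \<in> T" "engel_like (G\<lparr>carrier := T\<rparr>)" using assms by blast
  have "PE_seq (G\<lparr>carrier := T\<rparr>) c = PE_seq G c"
    by (auto simp: PE_seq_def fun_eq_iff simp flip: nat_pow_consistent)
  moreover obtain n where "lam_eq_rho (G\<lparr>carrier := T\<rparr>) a (inv\<^bsub>G\<lparr>carrier := T\<rparr>\<^esub> c) (PE_seq (G\<lparr>carrier := T\<rparr>) c) n"
    using T unfolding engel_like_def by auto
  ultimately show "\<exists>n. lam_eq_rho G a (inv c) (PE_seq G c) n"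
    using m_inv_consistent[OF T(1,3)] by (auto simp: lam_rho_carrier_update)
qed

text \<open>One preimage is chosen for each generator; the subsemigroup generated by them maps onto
  all of \<open>F\<close>.\<close>

lemma divides_generated:
  assumes S: "finite_sgrp S" and F: "F \<prec> S" "carrier F = sgrp_gen F G" "finite G" "G \<noteq> {}" "card G \<le> n"
  obtains A where "A \<subseteq> carrier S" "A \<noteq> {}" "finite A" "card A \<le> n" "F \<prec> S\<lparr>carrier := sgrp_gen S A\<rparr>"
proof -
  obtain U h where Uh: "subsgrp U S \<and> h ` U = carrier F \<and> (\<forall>x\<in>U. \<forall>y\<in>U. h (x \<cdot>\<^bsub>S\<^esub> y) = h x \<cdot>\<^bsub>F\<^esub> h y)"
    using F(1) unfolding divides_def by (elim exE)
  then have U: "subsgrp U S" "h ` U = carrier F"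
    "\<And>x y. x \<in> U \<Longrightarrow> y \<in> U \<Longrightarrow> h (x \<cdot>\<^bsub>S\<^esub> y) = h x \<cdot>\<^bsub>F\<^esub> h y" by simp_all
  have "\<forall>g\<in>G. \<exists>u\<in>U. h u = g"
  proof
    fix g assume "g \<in> G"
    then have "g \<in> h ` U" unfolding U(2) F(2) by (rule sgrp_gen.base)
    then show "\<exists>u\<in>U. h u = g" by blast
  qed
  then obtain k where k: "\<And>g. g \<in> G \<Longrightarrow> k g \<in> U" "\<And>g. g \<in> G \<Longrightarrow> h (k g) = g" by metis
  define A where "A = k ` G"
  have AU: "A \<subseteq> U" using k by (auto simp: A_def)
  have TU: "sgrp_gen S A \<subseteq> U" by (rule sgrp_gen_least[OF AU]) (use U(1) in \<open>auto simp: subsgrp_def\<close>)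
  have A: "A \<subseteq> carrier S" "A \<noteq> {}" "finite A" "card A \<le> n"
    using AU U(1) F(3-5) card_image_le[OF F(3), of k] by (auto simp: A_def subsgrp_def)
  have "h ` sgrp_gen S A = carrier F"
  proof
    show "h ` sgrp_gen S A \<subseteq> carrier F" using TU U(2) by blast
    show "carrier F \<subseteq> h ` sgrp_gen S A"
    proof
      fix x assume "x \<in> carrier F"
      then have "x \<in> sgrp_gen F G" using F(2) by simp
      then show "x \<in> h ` sgrp_gen S A"
      proof induction
        case (base g)
        have "k g \<in> sgrp_gen S A" using base by (intro sgrp_gen.base) (simp add: A_def)
        then show ?case using k(2)[OF base] by force
      next
        case (mult x y)
        then obtain p q where pq: "p \<in> sgrp_gen S A" "x = h p" "q \<in> sgrp_gen S A" "y = h q" by blast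
        then have "x \<cdot>\<^bsub>F\<^esub> y = h (p \<cdot>\<^bsub>S\<^esub> q)"
          using U(3)[OF subsetD[OF TU pq(1)] subsetD[OF TU pq(3)]] by simp
        then show ?case using sgrp_gen.mult[OF pq(1,3)] by blast
      qed
    qed
  qed
  moreover have "subsgrp (sgrp_gen S A) (S\<lparr>carrier := sgrp_gen S A\<rparr>)"
    using finite_sgrp.subsgrp_sgrp_gen[OF S A(1,2)] by (simp add: subsgrp_def)
  ultimately have "F \<prec> S\<lparr>carrier := sgrp_gen S A\<rparr>"
    unfolding divides_def using U(3)[OF subsetD[OF TU] subsetD[OF TU]]
    by (intro exI[of _ "sgrp_gen S A"] exI[of _ h]) simp
  with A that show thesis by blast
qed

section \<open>Computing in F7 and F12\<close>

lemma sgmult_transf [simp]: "f \<cdot>\<^bsub>transf_sgrp\<^esub> g = g \<circ> f"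
  by (simp add: transf_sgrp_def)

lemma sgmult_F7 [simp]: "f \<cdot>\<^bsub>F7\<^esub> g = g \<circ> f"
  by (simp add: F7_def transf_sgrp_def)

lemma sgmult_F12 [simp]: "f \<cdot>\<^bsub>F12\<^esub> g = g \<circ> f"
  by (simp add: F12_def transf_sgrp_def)

lemma F7_generated: "carrier F7 = sgrp_gen F7 {F7_u, F7_e}"
  by (simp add: F7_def)

lemma all_pt3: "(\<forall>p. P p) \<longleftrightarrow> P B1 \<and> P B2 \<and> P B3 \<and> P B\<theta>"
  by (metis pt3.exhaust)

lemma F12_unit_mult [simp]:
  "k \<noteq> B\<theta> \<Longrightarrow> F12_unit k l \<circ> F12_unit i j = (if j = k then F12_unit i l else (\<lambda>_. B\<theta>))"
  by (auto simp: F12_unit_def fun_eq_iff)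

lemma F12_products:
  "F12_w1 \<circ> F12_w1 = F12_unit B1 B1" "F12_w2 \<circ> F12_w1 = F12_unit B1 B2"
  "F12_w1 \<circ> F12_w2 = F12_unit B3 B1" "F12_w2 \<circ> F12_w2 = F12_unit B3 B2"
  "F12_w1 \<circ> F12_unit i j = F12_unit i (F12_w1 j)" "F12_w2 \<circ> F12_unit i j = F12_unit i (F12_w2 j)"
  "F12_unit B1 j \<circ> F12_w1 = F12_unit B1 j" "F12_unit B1 j \<circ> F12_w2 = F12_unit B3 j"
  "F12_unit B2 j \<circ> F12_w1 = F12_unit B3 j" "F12_unit B2 j \<circ> F12_w2 = F12_unit B1 j"
  "F12_unit B3 j \<circ> F12_w1 = (\<lambda>_. B\<theta>)" "F12_unit B3 j \<circ> F12_w2 = (\<lambda>_. B\<theta>)"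
  by (simp_all add: F12_unit_def F12_w1_def F12_w2_def fun_eq_iff all_pt3)

lemma F12_apply [simp]:
  "F12_w1 B1 = B1" "F12_w1 B2 = B\<theta>" "F12_w1 B3 = B2" "F12_w1 B\<theta> = B\<theta>"
  "F12_w2 B1 = B2" "F12_w2 B2 = B\<theta>" "F12_w2 B3 = B1" "F12_w2 B\<theta> = B\<theta>"
  "i \<noteq> B\<theta> \<Longrightarrow> F12_unit i j B\<theta> = B\<theta>"
  by (simp_all add: F12_w1_def F12_w2_def F12_unit_def)

lemma const_comp: "(\<lambda>_. c) \<circ> h = (\<lambda>_. c)" "h \<circ> (\<lambda>_. c) = (\<lambda>_. h c)"
  by auto

lemma comp_F12_unit: "g B\<theta> = B\<theta> \<Longrightarrow> g \<circ> F12_unit i j = F12_unit i (g j)"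
  by (auto simp: F12_unit_def fun_eq_iff)

lemma F12_unit_zero: "F12_unit i B\<theta> = (\<lambda>_. B\<theta>)"
  by (simp add: F12_unit_def)

text \<open>An explicit list of the twelve elements: beyond the two generators only zero and the
  nine matrix units occur, as every product is one of these.\<close>

definition F12_set :: "(pt3 \<Rightarrow> pt3) set" where
  "F12_set = insert F12_w1 (insert F12_w2 (insert (\<lambda>_. B\<theta>)
     {F12_unit i j | i j. i \<in> {B1, B2, B3} \<and> j \<in> {B1, B2, B3}}))"

lemma F12_set_fix: "g \<in> F12_set \<Longrightarrow> g B\<theta> = B\<theta>"
  by (auto simp: F12_set_def)

lemma F12_set_closed:
  assumes f: "f \<in> F12_set" and g: "g \<in> F12_set"
  shows "g \<circ> f \<in> F12_set"
proof -
  have u: "F12_unit i j \<in> F12_set" if "i \<in> {B1, B2, B3}" for i j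
    using that by (cases j) (auto simp: F12_unit_zero F12_set_def)
  have zero: "(\<lambda>_. B\<theta>) \<in> F12_set" by (simp add: F12_set_def)
  consider "f = (\<lambda>_. B\<theta>)" | i j where "f = F12_unit i j" "i \<in> {B1, B2, B3}" | "f \<in> {F12_w1, F12_w2}"
    using f unfolding F12_set_def by blast
  then show ?thesis
  proof cases
    case 1 then show ?thesis using F12_set_fix[OF g] zero by (simp add: const_comp)
  next
    case 2 then show ?thesis using u F12_set_fix[OF g] by (simp only: comp_F12_unit)
  next
    case 3
    consider "g = (\<lambda>_. B\<theta>)" | i j where "g = F12_unit i j" "i \<in> {B1, B2, B3}" | "g \<in> {F12_w1, F12_w2}"
      using g unfolding F12_set_def by blast
    then show ?thesis
    proof cases
      case 1 then show ?thesis using zero by (simp add: const_comp)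
    next
      case 2 then show ?thesis using 3 u zero by (auto simp: F12_products)
    next
      case g: 3
      then show ?thesis using 3 u zero by (auto simp: F12_products)
    qed
  qed
qed

lemma F12_carrier: "carrier F12 = F12_set"
proof
  have "sgrp_gen transf_sgrp {F12_w1, F12_w2} \<subseteq> F12_set"
    by (rule sgrp_gen_least) (use F12_set_closed in \<open>auto simp: F12_set_def\<close>)
  then show "carrier F12 \<subseteq> F12_set" by (auto simp: F12_def F12_set_def)
  show "F12_set \<subseteq> carrier F12" by (auto simp: F12_def F12_set_def intro: sgrp_gen.base)
qed

text \<open>The third generator is the matrix unit from 2 to 3 because \<open>F12_w1\<close> and
  \<open>F12_w2\<close> are undefined at 2 and never reach 3. Multiplying it on either side yields
  all units out of 2 and into 2, and these give the rest.\<close>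

lemma F12_generated: "carrier F12 = sgrp_gen F12 {F12_w1, F12_w2, F12_unit B2 B3}"
proof -
  let ?g = "sgrp_gen F12 {F12_w1, F12_w2, F12_unit B2 B3}"
  have mult: "g \<circ> f \<in> ?g" if "f \<in> ?g" "g \<in> ?g" for f g using sgrp_gen.mult[OF that] by simp
  have base: "F12_w1 \<in> ?g" "F12_w2 \<in> ?g" "F12_unit B2 B3 \<in> ?g" by (auto intro: sgrp_gen.base)
  have r: "F12_unit B2 B2 \<in> ?g" "F12_unit B2 B1 \<in> ?g"
    using mult[OF base(3,1)] mult[OF base(3,2)] by (simp_all add: F12_products)
  have l: "F12_unit B3 B2 \<in> ?g" "F12_unit B1 B2 \<in> ?g"
    using mult[OF base(1) r(1)] mult[OF base(2) r(1)] by (simp_all add: F12_products)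
  have units: "F12_unit i j \<in> ?g" if "i \<in> {B1, B2, B3}" "j \<in> {B1, B2, B3}" for i j
  proof -
    have "F12_unit i B2 \<in> ?g" "F12_unit B2 j \<in> ?g" using that r l base by auto
    from mult[OF this] show ?thesis by simp
  qed
  have "F12_unit B2 B3 \<circ> F12_unit B2 B3 = (\<lambda>_. B\<theta>)" by (auto simp: F12_unit_def)
  then have zero: "(\<lambda>_. B\<theta>) \<in> ?g" using mult[OF base(3,3)] by simp
  show ?thesis
  proof
    show "carrier F12 \<subseteq> ?g" using units zero base by (auto simp: F12_carrier F12_set_def)
    show "?g \<subseteq> carrier F12" unfolding F12_carrier
      by (rule sgrp_gen_least) (use F12_set_closed in \<open>auto simp: F12_set_def\<close>)
  qed
qed

text \<open>Each defect is visible on few elements: \<open>x\<close>, \<open>y\<close>,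
  \<open>y'\<close> for two inverses, two elements for a non-nilpotent subgroup, preimages of at
  most three generators for a division.\<close>

lemma NMN4_rank_le: "rank_at_most NMN4 3"
proof (rule rank_at_mostI, rule ccontr)
  fix S :: "'a sgrp" assume S: "finite_sgrp S"
    and A: "\<And>A. A \<subseteq> carrier S \<Longrightarrow> A \<noteq> {} \<Longrightarrow> finite A \<Longrightarrow> card A \<le> 3 \<Longrightarrow> S\<lparr>carrier := sgrp_gen S A\<rparr> \<in> NMN4"
    and "S \<notin> NMN4"
  interpret finite_sgrp S by fact
  have block: "block_group S" unfolding block_group_def
  proof (intro conjI S ballI impI)
    fix x y y' assume xy: "x \<in> carrier S" "y \<in> carrier S" "y' \<in> carrier S" and inv: "is_inverse S x y \<and> is_inverse S x y'"
    have "S\<lparr>carrier := sgrp_gen S {x, y, y'}\<rparr> \<in> NMN4" using xy by (intro A) (auto simp: card_insert_if)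
    then have "block_group (S\<lparr>carrier := sgrp_gen S {x, y, y'}\<rparr>)" by (simp add: NMN4_def BG_nil_def)
    moreover have "x \<in> sgrp_gen S {x, y, y'}" "y \<in> sgrp_gen S {x, y, y'}" "y' \<in> sgrp_gen S {x, y, y'}"
      by (auto intro: sgrp_gen.base)
    ultimately show "y = y'" using inv by (auto simp: block_group_def is_inverse_def)
  qed
  have "nilpotent_group \<lparr>carrier = H, monoid.mult = sgmult S, one = e\<rparr>"
    if H: "H \<subseteq> carrier S" "group \<lparr>carrier = H, monoid.mult = sgmult S, one = e\<rparr>" for H e
  proof -
    let ?G = "\<lparr>carrier = H, monoid.mult = sgmult S, one = e\<rparr>"
    interpret G: group ?G by fact
    have finH: "finite H" using H(1) finite_carrier by (rule finite_subset)
    have "engel_like ?G"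
    proof (rule G.engel_like_two_generated)
      fix a c assume "a \<in> carrier ?G" "c \<in> carrier ?G"
      then have ac: "a \<in> H" "c \<in> H" by auto
      let ?T = "sgrp_gen S {a, c}"
      have acT: "a \<in> ?T" "c \<in> ?T" by (auto intro: sgrp_gen.base)
      have TH: "?T \<subseteq> H" by (rule sgrp_gen_least) (use ac G.m_closed in auto)
      have sub: "subgroup ?T ?G"
        by (rule G.finite_closed_subgroup) (use TH finH acT finite_subset in \<open>auto intro: sgrp_gen.mult\<close>)
      have "S\<lparr>carrier := ?T\<rparr> \<in> NMN4" using ac H(1) by (intro A) (auto simp: card_insert_if)
      moreover have grp: "group (?G\<lparr>carrier := ?T\<rparr>)" using sub by (rule G.subgroup_imp_group)
      ultimately have "nilpotent_group (?G\<lparr>carrier := ?T\<rparr>)" by (simp add: NMN4_def BG_nil_def)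
      then have "engel_like (?G\<lparr>carrier := ?T\<rparr>)" by (rule group.nilpotent_imp_engel_like[OF grp])
      then show "\<exists>T. subgroup T ?G \<and> a \<in> T \<and> c \<in> T \<and> engel_like (?G\<lparr>carrier := T\<rparr>)"
        using sub acT by blast
    qed
    then show ?thesis using G.engel_like_imp_nilpotent finH by simp
  qed
  with block \<open>S \<notin> NMN4\<close> consider "F7 \<prec> S" | "F12 \<prec> S" by (auto simp: NMN4_def BG_nil_def)
  then show False
  proof cases
    case 1
    obtain A' where A': "A' \<subseteq> carrier S" "A' \<noteq> {}" "finite A'" "card A' \<le> 3" "F7 \<prec> S\<lparr>carrier := sgrp_gen S A'\<rparr>"
      by (rule divides_generated[OF S 1 F7_generated, of 3]) (auto simp: card_insert_if)
    from A[OF A'(1-4)] A'(5) show False by (simp add: NMN4_def)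
  next
    case 2
    obtain A' where A': "A' \<subseteq> carrier S" "A' \<noteq> {}" "finite A'" "card A' \<le> 3" "F12 \<prec> S\<lparr>carrier := sgrp_gen S A'\<rparr>"
      by (rule divides_generated[OF S 2 F12_generated, of 3]) (auto simp: card_insert_if)
    from A[OF A'(1-4)] A'(5) show False by (simp add: NMN4_def)
  qed
qed

section \<open>Lower bounds\<close>

text \<open>More generators test more subsemigroups, so a bound that fails rules out all smaller
  ones.\<close>

lemma has_rankI:
  assumes "rank_at_most V (Suc k)" "\<not> rank_at_most V k"
  shows "has_rank V (Suc k)"
  unfolding has_rank_def
proof (intro conjI allI impI assms(1))
  fix m assume m: "rank_at_most V m"
  show "Suc k \<le> m"
  proof (rule ccontr)
    assume "\<not> Suc k \<le> m"
    then have "n_generated m S \<Longrightarrow> n_generated k S" for S :: "'a sgrp"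
      unfolding n_generated_def by (meson le_trans not_less_eq_eq)
    then have "rank_at_most V k" using m unfolding rank_at_most_def by blast
    with assms(2) show False by simp
  qed
qed

lemma not_rank_at_mostI:
  assumes "finite_sgrp S" "S \<notin> V"
    and "\<And>A. A \<subseteq> carrier S \<Longrightarrow> A \<noteq> {} \<Longrightarrow> finite A \<Longrightarrow> card A \<le> n \<Longrightarrow> subsgrp (sgrp_gen S A) S \<Longrightarrow>
       S\<lparr>carrier := sgrp_gen S A\<rparr> \<in> V"
  shows "\<not> rank_at_most V n"
proof
  assume *: "rank_at_most V n"
  have "S\<lparr>carrier := T\<rparr> \<in> V" if T: "subsgrp T S" "n_generated n (S\<lparr>carrier := T\<rparr>)" for T
  proof -
    obtain A where A: "A \<subseteq> T" "finite A" "card A \<le> n" "sgrp_gen S A = T"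
      using T(2) by (auto simp: n_generated_def)
    have "A \<noteq> {}"
    proof
      assume "A = {}"
      then have "sgrp_gen S A \<subseteq> {}" by (intro sgrp_gen_least) auto
      then show False using A(4) T(1) by (simp add: subsgrp_def)
    qed
    then show ?thesis using assms(3)[of A] A T(1) by (auto simp: subsgrp_def)
  qed
  then show False using * assms(1,2) unfolding rank_at_most_def by blast
qed

text \<open>Words in the two-element left zero band never meet, while its one-generated
  subsemigroups are single idempotents.\<close>

lemma not_rank_1:
  assumes "infinite (UNIV :: 'a set)"
  shows "\<not> rank_at_most (PE :: 'a sgrp set) 1" "\<not> rank_at_most (TM :: 'a sgrp set) 1"
proof -
  obtain a b :: 'a where ab: "a \<noteq> b"
    using assms by (metis ex_new_if_finite finite.emptyI finite_insert insertI1)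
  define S where "S = \<lparr>carrier = {a, b}, sgmult = (\<lambda>x y :: 'a. x)\<rparr>"
  have S: "finite_sgrp S" by unfold_locales (auto simp: S_def)
  interpret finite_sgrp S by fact
  have gen: "sgrp_gen S A = A" for A
  proof
    show "sgrp_gen S A \<subseteq> A" by (rule sgrp_gen_least) (auto simp: S_def)
  qed (auto intro: sgrp_gen.base)
  have "S\<lparr>carrier := {a, b}\<rparr> = S" by (simp add: S_def)
  then have "S \<notin> PE" "S \<notin> TM"
    using band_not_PE[of a b] ab unfolding gen by (simp_all add: S_def)
  moreover have "S\<lparr>carrier := sgrp_gen S A\<rparr> \<in> PE \<and> S\<lparr>carrier := sgrp_gen S A\<rparr> \<in> TM"
    if "A \<noteq> {}" "card A \<le> 1" "finite A" "subsgrp (sgrp_gen S A) S" for A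
  proof -
    have "card A = 1" using that by (metis card_0_eq le_antisym less_one linorder_not_le)
    then obtain p where p: "A = {p}" by (auto simp: card_1_singleton_iff)
    have "\<exists>n. lam_eq_rho (OM (sgmult S)) (Some p) (Some p) z n" for z
      by (rule exI[of _ 0]) simp
    then show ?thesis unfolding PE_iff TM_iff
      using finite_sgrp_subsgrp[OF that(4)] by (simp add: p gen)
  qed
  ultimately show "\<not> rank_at_most (PE :: 'a sgrp set) 1" "\<not> rank_at_most (TM :: 'a sgrp set) 1"
    using not_rank_at_mostI[OF S, of _ 1] by blast+
qed

section \<open>Copying a finite semigroup to the given type\<close>

locale sgrp_copy = finite_sgrp S for S :: "'b sgrp" +
  fixes \<phi> :: "'b \<Rightarrow> 'a"
  assumes inj: "inj_on \<phi> (carrier S)"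
begin

definition \<psi> :: "'a \<Rightarrow> 'b" where "\<psi> = inv_into (carrier S) \<phi>"

text \<open>The examples consist of relations or functions, whereas ranks refer to semigroups on
  \<open>'a\<close>; the structure is carried over along an injection of the carrier.\<close>

definition copy :: "'a sgrp" where
  "copy = \<lparr>carrier = \<phi> ` carrier S, sgmult = (\<lambda>x y. \<phi> (\<psi> x \<cdot>\<^bsub>S\<^esub> \<psi> y))\<rparr>"

lemma \<psi>_\<phi> [simp]: "x \<in> carrier S \<Longrightarrow> \<psi> (\<phi> x) = x"
  using inj by (simp add: \<psi>_def)

lemma \<phi>_\<psi> [simp]: "x \<in> carrier copy \<Longrightarrow> \<phi> (\<psi> x) = x"
  by (auto simp: copy_def)

lemma \<psi>_mem [simp]: "x \<in> carrier copy \<Longrightarrow> \<psi> x \<in> carrier S"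
  by (auto simp: copy_def)

lemma \<phi>_mem [simp]: "x \<in> carrier S \<Longrightarrow> \<phi> x \<in> carrier copy"
  by (auto simp: copy_def)

lemma \<phi>_mult: "x \<in> carrier S \<Longrightarrow> y \<in> carrier S \<Longrightarrow> \<phi> (x \<cdot>\<^bsub>S\<^esub> y) = \<phi> x \<cdot>\<^bsub>copy\<^esub> \<phi> y"
  by (simp add: copy_def)

lemma \<psi>_mult: "x \<in> carrier copy \<Longrightarrow> y \<in> carrier copy \<Longrightarrow> \<psi> (x \<cdot>\<^bsub>copy\<^esub> y) = \<psi> x \<cdot>\<^bsub>S\<^esub> \<psi> y"
  by (auto simp: copy_def closed)

lemma \<psi>_inj: "x \<in> carrier copy \<Longrightarrow> y \<in> carrier copy \<Longrightarrow> \<psi> x = \<psi> y \<Longrightarrow> x = y"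
  by (metis \<phi>_\<psi>)

lemma finite_sgrp_copy: "finite_sgrp copy"
proof
  show "finite (carrier copy)" "carrier copy \<noteq> {}"
    using finite_carrier nonempty by (auto simp: copy_def)
  show cl: "x \<cdot>\<^bsub>copy\<^esub> y \<in> carrier copy" if "x \<in> carrier copy" "y \<in> carrier copy" for x y
    using that by (auto simp: copy_def closed)
  fix x y z assume xyz: "x \<in> carrier copy" "y \<in> carrier copy" "z \<in> carrier copy"
  show "x \<cdot>\<^bsub>copy\<^esub> y \<cdot>\<^bsub>copy\<^esub> z = x \<cdot>\<^bsub>copy\<^esub> (y \<cdot>\<^bsub>copy\<^esub> z)"
    by (rule \<psi>_inj) (use xyz in \<open>simp_all add: cl \<psi>_mult assoc\<close>)
qed

lemma \<psi>_sgrp_gen: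
  assumes "A \<subseteq> carrier copy" shows "sgrp_gen S (\<psi> ` A) = \<psi> ` sgrp_gen copy A"
proof -
  interpret copy: finite_sgrp copy by (rule finite_sgrp_copy)
  have sub: "sgrp_gen copy A \<subseteq> carrier copy" by (rule sgrp_gen_least[OF assms copy.closed])
  show ?thesis
  proof
    show "sgrp_gen S (\<psi> ` A) \<subseteq> \<psi> ` sgrp_gen copy A"
    proof (rule sgrp_gen_least)
      show "\<psi> ` A \<subseteq> \<psi> ` sgrp_gen copy A" by (auto intro: sgrp_gen.base)
      fix x y assume "x \<in> \<psi> ` sgrp_gen copy A" "y \<in> \<psi> ` sgrp_gen copy A"
      then obtain p q where pq: "p \<in> sgrp_gen copy A" "x = \<psi> p" "q \<in> sgrp_gen copy A" "y = \<psi> q" by blast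
      then have "x \<cdot>\<^bsub>S\<^esub> y = \<psi> (p \<cdot>\<^bsub>copy\<^esub> q)" using \<psi>_mult[OF subsetD[OF sub] subsetD[OF sub]] by simp
      then show "x \<cdot>\<^bsub>S\<^esub> y \<in> \<psi> ` sgrp_gen copy A" using sgrp_gen.mult[OF pq(1,3)] by blast
    qed
    show "\<psi> ` sgrp_gen copy A \<subseteq> sgrp_gen S (\<psi> ` A)"
    proof (intro image_subsetI)
      fix x assume "x \<in> sgrp_gen copy A"
      then show "\<psi> x \<in> sgrp_gen S (\<psi> ` A)"
      proof induction
        case (mult p q)
        then show ?case using sgrp_gen.mult[of "\<psi> p" S "\<psi> ` A" "\<psi> q"] \<psi>_mult[OF subsetD[OF sub] subsetD[OF sub]] by simp
      qed (auto intro: sgrp_gen.base)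
    qed
  qed
qed

end

lemma ex_sgrp_copy:
  assumes "infinite (UNIV :: 'a set)" "finite_sgrp (S :: 'b sgrp)"
  obtains \<phi> :: "'b \<Rightarrow> 'a" where "sgrp_copy S \<phi>"
proof -
  interpret finite_sgrp S by fact
  obtain B :: "'a set" where "finite B" "card B = card (carrier S)"
    using infinite_arbitrarily_large[OF assms(1)] by blast
  then obtain h :: "'b \<Rightarrow> 'a" where "bij_betw h (carrier S) B"
    using finite_carrier finite_same_card_bij by metis
  then have "sgrp_copy S h" using assms(2) by (auto simp: sgrp_copy_def sgrp_copy_axioms_def bij_betw_def)
  then show thesis by (rule that)
qed

text \<open>Letters lift along \<open>h\<close>, with \<open>None\<close> to \<open>None\<close>,
  and words commute with \<open>h\<close>. It serves to carry MN between a semigroup and its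
  copy.\<close>

lemma MN_hom_image:
  assumes "S \<in> MN" "finite_sgrp K" and h: "h ` carrier S = carrier K"
    "\<And>x y. x \<in> carrier S \<Longrightarrow> y \<in> carrier S \<Longrightarrow> h (x \<cdot>\<^bsub>S\<^esub> y) = h x \<cdot>\<^bsub>K\<^esub> h y"
  shows "K \<in> MN"
  unfolding MN_iff
proof (intro conjI assms(2) ballI allI impI)
  interpret S: finite_sgrp S using assms(1) by (simp add: MN_iff)
  fix a b and z :: "nat \<Rightarrow> _"
  assume ab: "a \<in> carrier K" "b \<in> carrier K" and z: "\<forall>i. z i \<in> with_None (carrier K)"
  obtain a' b' where ab': "a' \<in> carrier S" "a = h a'" "b' \<in> carrier S" "b = h b'" using ab h(1) by blast
  have "\<exists>w\<in>with_None (carrier S). z i = map_option h w" for i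
  proof -
    consider "z i = None" | k where "z i = Some k" "k \<in> carrier K" using z[rule_format, of i] by (cases "z i") auto
    then show ?thesis
    proof cases
      case 1 then show ?thesis by (intro bexI[of _ None]) auto
    next
      case 2
      then obtain s where "s \<in> carrier S" "k = h s" using h(1) by blast
      then show ?thesis using 2 by (intro bexI[of _ "Some s"]) auto
    qed
  qed
  then obtain w where w: "\<And>i. w i \<in> with_None (carrier S)" "\<And>i. z i = map_option h (w i)" by metis
  have hom: "omul (sgmult K) (map_option h p) (map_option h q) = map_option h (omul (sgmult S) p q)"
    if "p \<in> with_None (carrier S)" "q \<in> with_None (carrier S)" for p q
    using that h(2) by auto
  have "lam (OM (sgmult K)) (Some a) (Some b) z n = map_option h (lam (OM (sgmult S)) (Some a') (Some b') w n) \<and>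
     rho (OM (sgmult K)) (Some a) (Some b) z n = map_option h (rho (OM (sgmult S)) (Some a') (Some b') w n) \<and>
     lam (OM (sgmult S)) (Some a') (Some b') w n \<in> with_None (carrier S) \<and>
     rho (OM (sgmult S)) (Some a') (Some b') w n \<in> with_None (carrier S)" for n
  proof (induction n)
    case 0 then show ?case using ab' by simp
  next
    case (Suc n)
    note cl = omul_with_None(1)[where f = "sgmult S" and T = "carrier S", OF S.closed]
    from Suc show ?case using w(1)[of "Suc n"] w(2)[of "Suc n"] by (simp add: hom cl del: insert_iff)
  qed
  moreover obtain n where "lam_eq_rho (OM (sgmult S)) (Some a') (Some b') w n"
    using assms(1) ab'(1,3) w(1) unfolding MN_iff by blast
  ultimately show "\<exists>n. lam_eq_rho (OM (sgmult K)) (Some a) (Some b) z n"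
    by metis
qed

text \<open>Partial injections of \<open>{1..4}\<close> as relations: the matrix units together with \<open>E4_w1\<close> and \<open>E4_w2\<close>, both
  irreducible, which act as \<open>z\<^sub>1, z\<^sub>2, z\<^sub>1, z\<^sub>2, \<dots>\<close> on \<open>(1,2), (3,4)\<close>. A failing sequence also needs matrix
  units starting in 1 and in 3, hence a fourth generator.\<close>

definition E4_w1 :: "(nat \<times> nat) set" where "E4_w1 = {(2, 3), (4, 1)}"
definition E4_w2 :: "(nat \<times> nat) set" where "E4_w2 = {(4, 3), (2, 1)}"

definition E4 :: "(nat \<times> nat) set sgrp" where
  "E4 = \<lparr>carrier = {E4_w1, E4_w2, {}} \<union> {{(i, j)} | i j. i \<in> {1..4} \<and> j \<in> {1..4}}, sgmult = (O)\<rparr>"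

lemma sgmult_E4 [simp]: "r \<cdot>\<^bsub>E4\<^esub> s = r O s" by (simp add: E4_def)

lemma E4_cases:
  assumes "r \<in> carrier E4"
  obtains "r = E4_w1" | "r = E4_w2" | "r = {}" | i j where "r = {(i, j)}" "i \<in> {1..4}" "j \<in> {1..4}"
  using assms unfolding E4_def by auto

text \<open>The domain {2, 4} of \<open>E4_w1\<close> and \<open>E4_w2\<close> misses their range
  {1, 3}, so products of these two are empty; every other nonempty product involves a single
  pair.\<close>

lemma E4_products:
  assumes "r \<in> carrier E4" "s \<in> carrier E4"
  shows "r O s = {} \<or> (\<exists>i\<in>{1..4}. \<exists>j\<in>{1..4}. r O s = {(i, j)})"
proof -
  have single: "{(i, j)} O s = {} \<or> (\<exists>k\<in>{1..4}. {(i, j)} O s = {(i, k)})" for i j :: nat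
    using assms(2)
  proof (cases rule: E4_cases)
    case 1
    have "{(i, j)} O E4_w1 = (if j = 2 then {(i, 3)} else if j = 4 then {(i, 1)} else {})"
      by (auto simp: E4_w1_def)
    then show ?thesis using 1 by auto
  next
    case 2
    have "{(i, j)} O E4_w2 = (if j = 4 then {(i, 3)} else if j = 2 then {(i, 1)} else {})"
      by (auto simp: E4_w2_def)
    then show ?thesis using 2 by auto
  next
    case (4 k l)
    then have "{(i, j)} O s = (if j = k then {(i, l)} else {})" by auto
    then show ?thesis using 4 by auto
  qed auto
  have two: "w O s = {} \<or> (\<exists>i\<in>{1..4}. \<exists>j\<in>{1..4}. w O s = {(i, j)})" if w: "w = E4_w1 \<or> w = E4_w2" for w
    using assms(2)
  proof (cases rule: E4_cases)
    case (4 k l)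
    have "E4_w1 O {(k, l)} = (if k = 3 then {(2, l)} else if k = 1 then {(4, l)} else {})"
      "E4_w2 O {(k, l)} = (if k = 3 then {(4, l)} else if k = 1 then {(2, l)} else {})"
      by (auto simp: E4_w1_def E4_w2_def)
    then have "w O s = {} \<or> w O s = {(2, l)} \<or> w O s = {(4, l)}"
      using w unfolding 4(1) by metis
    then show ?thesis using 4(3) by (elim disjE) simp_all
  qed (use w in \<open>auto simp: E4_w1_def E4_w2_def\<close>)
  show ?thesis using assms(1)
  proof (cases rule: E4_cases)
    case (4 i j)
    then show ?thesis using single[of i j] by auto
  qed (use two in auto)
qed

lemma E4_products_neq: "r \<in> carrier E4 \<Longrightarrow> s \<in> carrier E4 \<Longrightarrow> r O s \<noteq> E4_w1 \<and> r O s \<noteq> E4_w2"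
  using E4_products[of r s] by (auto simp: E4_w1_def E4_w2_def)

lemma finite_sgrp_E4: "finite_sgrp E4"
proof
  show "finite (carrier E4)"
    by (rule finite_subset[of _ "Pow ({1..4} \<times> {1..4})"]) (auto simp: E4_def E4_w1_def E4_w2_def)
  show "carrier E4 \<noteq> {}" by (simp add: E4_def)
  show "r \<cdot>\<^bsub>E4\<^esub> s \<in> carrier E4" if "r \<in> carrier E4" "s \<in> carrier E4" for r s
    using E4_products[OF that] by (auto simp: E4_def)
qed (auto simp: O_assoc)

interpretation E4: finite_sgrp E4 by (rule finite_sgrp_E4)

text \<open>The words alternate between (1,2), (1,4) and between (3,4), (3,2): first coordinates
  stay, second ones are exchanged.\<close>

lemma E4_not_MN: "E4 \<notin> MN"
proof
  assume MN: "E4 \<in> MN"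
  define z where "z i = Some (if odd i then E4_w1 else E4_w2)" for i :: nat
  have *: "lam (OM (sgmult E4)) (Some {(1, 2)}) (Some {(3, 4)}) z n = Some (if even n then {(1, 2)} else {(1, 4)}) \<and>
     rho (OM (sgmult E4)) (Some {(1, 2)}) (Some {(3, 4)}) z n = Some (if even n then {(3, 4)} else {(3, 2)})" for n
  proof (induction n)
    case (Suc n)
    then show ?case by (auto simp: z_def E4_w1_def E4_w2_def)
  qed simp
  have mem: "{(1, 2)} \<in> carrier E4" "{(3, 4)} \<in> carrier E4" "\<And>i. z i \<in> with_None (carrier E4)"
    by (auto simp: E4_def z_def)
  obtain n where "lam_eq_rho (OM (sgmult E4)) (Some {(1, 2)}) (Some {(3, 4)}) z n"
    using MN mem unfolding MN_iff by blast
  then show False using *[of n] by (auto split: if_splits)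
qed

definition opt_rel :: "(nat \<times> nat) set option \<Rightarrow> (nat \<times> nat) set" where
  "opt_rel w = (case w of None \<Rightarrow> Id | Some r \<Rightarrow> r)"

text \<open>If the words after step 1 are (i,j) and (k,l), the membership hypotheses say that the
  letters \<open>r\<close> and \<open>s\<close> keep the words nonempty at steps 2 and 3. An
  identity letter would make the other contain (i,k) and (k,i), which no candidate does; equal
  letters would force i = k by functionality.\<close>

lemma swap_pattern:
  assumes "(j, k) \<in> r" "(l, i) \<in> r" "(l, k) \<in> s" "(j, i) \<in> s" "i \<noteq> k"
    and "r = Id \<or> r = E4_w1 \<or> r = E4_w2" "s = Id \<or> s = E4_w1 \<or> s = E4_w2"
  shows "(r = E4_w1 \<and> s = E4_w2 \<or> r = E4_w2 \<and> s = E4_w1) \<and> (i = 1 \<and> k = 3 \<or> i = 3 \<and> k = 1)"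
proof -
  have w: "(p, q) \<in> E4_w1 \<longleftrightarrow> p = 2 \<and> q = 3 \<or> p = 4 \<and> q = 1" "(p, q) \<in> E4_w2 \<longleftrightarrow> p = 4 \<and> q = 3 \<or> p = 2 \<and> q = 1"
    for p q by (auto simp: E4_w1_def E4_w2_def)
  from assms(6) show ?thesis
  proof (elim disjE)
    assume r: "r = Id"
    with assms(1-5) have "(i, k) \<in> s" "(k, i) \<in> s" by auto
    with assms(5,7) show ?thesis by (auto simp: w)
  next
    assume r: "r = E4_w1"
    with assms(1,2) have "j = 2 \<and> k = 3 \<or> j = 4 \<and> k = 1" "l = 2 \<and> i = 3 \<or> l = 4 \<and> i = 1" by (simp_all add: w)
    with assms(3,4,5,7) r show ?thesis by (elim disjE conjE) (simp_all add: w)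
  next
    assume r: "r = E4_w2"
    with assms(1,2) have "j = 4 \<and> k = 3 \<or> j = 2 \<and> k = 1" "l = 4 \<and> i = 3 \<or> l = 2 \<and> i = 1" by (simp_all add: w)
    with assms(3,4,5,7) r show ?thesis by (elim disjE conjE) (simp_all add: w)
  qed
qed

text \<open>The words never become empty, for then they would agree one step later. After one step
  they are single pairs, and steps 2 and 3 pin the letters down to \<open>E4_w1\<close> and
  \<open>E4_w2\<close> and the first coordinates to 1 and 3.\<close>

lemma E4_bad_sequence:
  assumes T: "T \<subseteq> carrier E4" "\<And>r s. r \<in> T \<Longrightarrow> s \<in> T \<Longrightarrow> r O s \<in> T"
    and ab: "a \<in> T" "b \<in> T" and z: "\<And>i. z i \<in> with_None T"
    and neq: "\<And>n. \<not> lam_eq_rho (OM (sgmult E4)) (Some a) (Some b) z n"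
  shows "E4_w1 \<in> T \<and> E4_w2 \<in> T \<and> (\<exists>j. {(1, j)} \<in> T) \<and> (\<exists>j. {(3, j)} \<in> T)"
proof -
  let ?l = "lam (OM (sgmult E4)) (Some a) (Some b) z" and ?r = "rho (OM (sgmult E4)) (Some a) (Some b) z"
  have mid: "omul (sgmult E4) (omul (sgmult E4) (Some p) w) (Some q) = Some (p O opt_rel w O q)" for p q w
    by (cases w) (auto simp: opt_rel_def O_assoc)
  have step: "\<exists>p'\<in>T. \<exists>q'\<in>T. ?l (Suc n) = Some p' \<and> ?r (Suc n) = Some q' \<and> p' = p O opt_rel (z (Suc n)) O q \<and>
      q' = q O opt_rel (z (Suc n)) O p"
    if "p \<in> T" "q \<in> T" "?l n = Some p" "?r n = Some q" for p q n
  proof -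
    have "p O opt_rel (z (Suc n)) O q \<in> T" "q O opt_rel (z (Suc n)) O p \<in> T"
      using z[of "Suc n"] that(1,2) T(2) by (auto simp: opt_rel_def)
    then show ?thesis using that(3,4) by (simp add: mid del: omul.simps)
  qed
  have ne: "p \<noteq> {} \<and> q \<noteq> {}" if "?l n = Some p" "?r n = Some q" for p q n
  proof (rule ccontr)
    assume "\<not> ?thesis"
    then have "?l (Suc n) = ?r (Suc n)" using that by (auto simp: mid simp del: omul.simps)
    with neq show False by blast
  qed
  obtain p1 q1 where 1: "p1 \<in> T" "q1 \<in> T" "?l 1 = Some p1" "?r 1 = Some q1"
     "p1 = a O opt_rel (z 1) O b" "q1 = b O opt_rel (z 1) O a"
    using step[of a b 0] ab by auto
  have single: "\<exists>i j. p O opt_rel w O q = {(i, j)}"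
    if "p \<in> T" "q \<in> T" "w \<in> with_None T" "p O opt_rel w O q \<noteq> {}" for p q w
  proof -
    have "opt_rel w O q \<in> T" using that T(2) by (auto simp: opt_rel_def)
    then show ?thesis using E4_products[of p "opt_rel w O q"] that T(1) by blast
  qed
  obtain i j where p1: "p1 = {(i, j)}"
    using single[OF ab z[of 1]] ne[OF 1(3,4)] 1(5) by auto
  obtain k l where q1: "q1 = {(k, l)}"
    using single[OF ab(2,1) z[of 1]] ne[OF 1(3,4)] 1(6) by auto
  obtain p2 q2 where 2: "p2 \<in> T" "q2 \<in> T" "?l 2 = Some p2" "?r 2 = Some q2"
     "p2 = p1 O opt_rel (z 2) O q1" "q2 = q1 O opt_rel (z 2) O p1"
    using step[OF 1(1-4)] by (auto simp: numeral_2_eq_2)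
  have p2: "p2 = {(i, l)}" "(j, k) \<in> opt_rel (z 2)" and q2: "q2 = {(k, j)}" "(l, i) \<in> opt_rel (z 2)"
    using ne[OF 2(3,4)] 2(5,6) unfolding p1 q1 by auto
  obtain p3 q3 where 3: "?l 3 = Some p3" "?r 3 = Some q3"
     "p3 = p2 O opt_rel (z 3) O q2" "q3 = q2 O opt_rel (z 3) O p2"
    using step[OF 2(1-4)] by (auto simp: numeral_2_eq_2 numeral_3_eq_3)
  have 33: "(l, k) \<in> opt_rel (z 3)" "(j, i) \<in> opt_rel (z 3)"
    using ne[OF 3(1,2)] 3(3,4) unfolding p2 q2 by auto
  have W: "w = None \<or> w = Some E4_w1 \<and> E4_w1 \<in> T \<or> w = Some E4_w2 \<and> E4_w2 \<in> T \<or> (\<exists>i j. w = Some {(i, j)}) \<or> w = Some {}"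
    if "w \<in> with_None T" for w
    using that T(1) unfolding E4_def by auto
  have inj: "c = d" if "w \<in> with_None T" "(c, e) \<in> opt_rel w" "(d, e) \<in> opt_rel w" for w c d e
    using W[OF that(1)] that(2,3) by (auto simp: opt_rel_def E4_w1_def E4_w2_def)
  have "p1 \<noteq> q1" using neq[of 1] 1 by auto
  \<comment> \<open>All elements are partial injections: i = k would give j = l through
    \<open>z 3\<close>, and the words after step 1 would agree.\<close>
  then have ik: "i \<noteq> k" using inj[OF z[of 3], of l k j] 33 p1 q1 by auto
  then have z2: "z 2 = None \<or> z 2 = Some E4_w1 \<and> E4_w1 \<in> T \<or> z 2 = Some E4_w2 \<and> E4_w2 \<in> T"
    and z3: "z 3 = None \<or> z 3 = Some E4_w1 \<and> E4_w1 \<in> T \<or> z 3 = Some E4_w2 \<and> E4_w2 \<in> T"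
    using W[OF z[of 2]] W[OF z[of 3]] p2(2) q2(2) 33 by (auto simp: opt_rel_def)
  have "opt_rel (z 2) = Id \<or> opt_rel (z 2) = E4_w1 \<or> opt_rel (z 2) = E4_w2"
    "opt_rel (z 3) = Id \<or> opt_rel (z 3) = E4_w1 \<or> opt_rel (z 3) = E4_w2"
    using z2 z3 by (auto simp: opt_rel_def)
  from swap_pattern[OF p2(2) q2(2) 33 ik this]
  have R: "opt_rel (z 2) = E4_w1 \<and> opt_rel (z 3) = E4_w2 \<or> opt_rel (z 2) = E4_w2 \<and> opt_rel (z 3) = E4_w1"
    and ik': "i = 1 \<and> k = 3 \<or> i = 3 \<and> k = 1" by blast+
  have "(2, 3) \<in> E4_w1" "(2, 3) \<notin> E4_w2" "(4, 3) \<in> E4_w2" "(2 :: nat, 3 :: nat) \<notin> Id" "(4 :: nat, 3 :: nat) \<notin> Id"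
    by (simp_all add: E4_w1_def E4_w2_def)
  then have neqs: "E4_w1 \<noteq> Id" "E4_w2 \<noteq> Id" "E4_w1 \<noteq> E4_w2" by metis+
  have "w \<in> T" if "opt_rel c = w" "w \<noteq> Id" "c = None \<or> c = Some E4_w1 \<and> E4_w1 \<in> T \<or> c = Some E4_w2 \<and> E4_w2 \<in> T" for c w
    using that by (elim disjE conjE) (simp_all add: opt_rel_def)
  then have "E4_w1 \<in> T" "E4_w2 \<in> T" using R z2 z3 neqs(1,2) by metis+
  then show ?thesis using ik' 1(1,2) unfolding p1 q1 by blast
qed

text \<open>Irreducibility puts \<open>E4_w1\<close> and \<open>E4_w2\<close> among the generators.
  The domain of a product lies in that of its first factor, so the points 1 and 3 need generators
  defined there; these are single pairs, distinct from each other and from the first two.\<close>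

lemma E4_three_generated:
  assumes "A \<subseteq> carrier E4" "finite A" "card A \<le> 3" and T: "subsgrp (sgrp_gen E4 A) E4"
  shows "E4\<lparr>carrier := sgrp_gen E4 A\<rparr> \<in> MN"
proof (rule ccontr)
  let ?T = "sgrp_gen E4 A"
  assume "\<not> ?thesis"
  then obtain a b z where abz: "a \<in> ?T" "b \<in> ?T" "\<And>i. z i \<in> with_None ?T"
     "\<And>n. \<not> lam_eq_rho (OM (sgmult E4)) (Some a) (Some b) z n"
    unfolding MN_iff using E4.finite_sgrp_subsgrp[OF T] by auto
  have "E4_w1 \<in> ?T \<and> E4_w2 \<in> ?T \<and> (\<exists>j. {(1, j)} \<in> ?T) \<and> (\<exists>j. {(3, j)} \<in> ?T)"
    by (rule E4_bad_sequence[where z = z, OF _ _ abz]) (use T in \<open>auto simp: subsgrp_def\<close>)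
  then obtain j1 j3 where bad: "E4_w1 \<in> ?T" "E4_w2 \<in> ?T" "{(1, j1)} \<in> ?T" "{(3, j3)} \<in> ?T" by blast
  have TE: "?T \<subseteq> carrier E4" using T by (simp add: subsgrp_def)
  have irr: "r \<in> A" if "r \<in> ?T" "r = E4_w1 \<or> r = E4_w2" for r
    using that(1)
  proof cases
    case (mult p q)
    then have "p O q \<noteq> E4_w1 \<and> p O q \<noteq> E4_w2" using TE by (intro E4_products_neq) auto
    then show ?thesis using mult that(2) by simp
  qed
  have dom: "\<exists>s\<in>A. Domain r \<inter> {i} \<subseteq> Domain s" if "r \<in> ?T" for r and i :: nat
    using that by induction auto
  obtain s1 where s1: "s1 \<in> A" "1 \<in> Domain s1" using dom[OF bad(3), of 1] by auto
  obtain s3 where s3: "s3 \<in> A" "3 \<in> Domain s3" using dom[OF bad(4), of 3] by auto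
  have "s1 \<in> carrier E4" "s3 \<in> carrier E4" using s1 s3 assms(1) by auto
  then have "card {E4_w1, E4_w2, s1, s3} = 4"
    using s1(2) s3(2) unfolding E4_def by (auto simp: E4_w1_def E4_w2_def doubleton_eq_iff)
  moreover have "{E4_w1, E4_w2, s1, s3} \<subseteq> A" using irr bad s1 s3 by auto
  from card_mono[OF assms(2) this] assms(3) have "card {E4_w1, E4_w2, s1, s3} \<le> 3" by simp
  ultimately show False by simp
qed

lemma MN_not_rank_3:
  assumes "infinite (UNIV :: 'a set)"
  shows "\<not> rank_at_most (MN :: 'a sgrp set) 3"
proof -
  obtain \<phi> :: "(nat \<times> nat) set \<Rightarrow> 'a" where "sgrp_copy E4 \<phi>"
    using ex_sgrp_copy[OF assms finite_sgrp_E4] by blast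
  then interpret sgrp_copy E4 \<phi> .
  interpret copy: finite_sgrp copy by (rule finite_sgrp_copy)
  show ?thesis
  proof (rule not_rank_at_mostI[OF finite_sgrp_copy])
    show "copy \<notin> MN"
    proof
      assume "copy \<in> MN"
      then have "E4 \<in> MN"
      proof (rule MN_hom_image[OF _ finite_sgrp_E4])
        show "\<psi> ` carrier copy = carrier E4"
          using \<psi>_\<phi> \<phi>_mem \<psi>_mem by (metis image_subsetI rev_image_eqI subsetI subset_antisym)
      qed (rule \<psi>_mult)
      with E4_not_MN show False by simp
    qed
    fix A assume A: "A \<subseteq> carrier copy" "A \<noteq> {}" "finite A" "card A \<le> 3" and T: "subsgrp (sgrp_gen copy A) copy"
    let ?T = "sgrp_gen copy A"
    have TC: "?T \<subseteq> carrier copy" using T by (simp add: subsgrp_def)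
    have gen: "sgrp_gen E4 (\<psi> ` A) = \<psi> ` ?T" by (rule \<psi>_sgrp_gen[OF A(1)])
    have A': "\<psi> ` A \<subseteq> carrier E4" "\<psi> ` A \<noteq> {}" using A(1,2) by auto
    have "E4\<lparr>carrier := sgrp_gen E4 (\<psi> ` A)\<rparr> \<in> MN"
      by (rule E4_three_generated[OF A'(1) _ _ E4.subsgrp_sgrp_gen[OF A']])
        (use A card_image_le[OF A(3), of \<psi>] in auto)
    then show "copy\<lparr>carrier := ?T\<rparr> \<in> MN"
    proof (rule MN_hom_image)
      show "finite_sgrp (copy\<lparr>carrier := ?T\<rparr>)" by (rule copy.finite_sgrp_subsgrp[OF T])
      show "\<phi> ` carrier (E4\<lparr>carrier := sgrp_gen E4 (\<psi> ` A)\<rparr>) = carrier (copy\<lparr>carrier := ?T\<rparr>)"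
        unfolding gen using TC by (auto simp: image_image subset_iff)
      fix x y assume "x \<in> carrier (E4\<lparr>carrier := sgrp_gen E4 (\<psi> ` A)\<rparr>)" "y \<in> carrier (E4\<lparr>carrier := sgrp_gen E4 (\<psi> ` A)\<rparr>)"
      then have "x \<in> carrier E4" "y \<in> carrier E4" unfolding gen using TC by auto
      then show "\<phi> (x \<cdot>\<^bsub>E4\<lparr>carrier := sgrp_gen E4 (\<psi> ` A)\<rparr>\<^esub> y) = \<phi> x \<cdot>\<^bsub>copy\<lparr>carrier := ?T\<rparr>\<^esub> \<phi> y"
        using \<phi>_mult by simp
    qed
  qed
qed

section \<open>F12 as the example for the lower bound of NMN4\<close>

lemma F12_set_inj_on:
  assumes "x \<in> F12_set" "x p = x q" "x p \<noteq> B\<theta>" shows "p = q"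
  using assms by (cases p; cases q) (auto simp: F12_set_def F12_unit_def split: if_splits)

text \<open>Away from the sink \<open>B\<theta>\<close> the elements are partial injections: where
  one inverse is defined, the other is forced to agree with it, and the argument is
  symmetric.\<close>

lemma F12_unique_inverse:
  assumes "x \<in> F12_set" "y \<in> F12_set" "y' \<in> F12_set"
    and xy: "x \<circ> (y \<circ> x) = x" "y \<circ> (x \<circ> y) = y" and xy': "x \<circ> (y' \<circ> x) = x" "y' \<circ> (x \<circ> y') = y'"
  shows "y = y'"
proof -
  have sub: "v q = w q" if "v q \<noteq> B\<theta>" "v \<in> F12_set" "w \<in> F12_set" "x \<circ> (v \<circ> x) = x" "v \<circ> (x \<circ> v) = v"
    "x \<circ> (w \<circ> x) = x" for v w q
  proof -
    have vx: "v (x (v q)) = v q" "x (w (x (v q))) = x (v q)"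
      using fun_cong[OF that(5), of q] fun_cong[OF that(6), of "v q"] by simp_all
    have xq: "x (v q) = q" by (rule F12_set_inj_on[OF that(2) vx(1)]) (simp add: vx(1) that(1))
    have "q \<noteq> B\<theta>" using that(1) F12_set_fix[OF that(2)] by auto
    have "w (x (v q)) = v q"
      by (rule F12_set_inj_on[OF assms(1) vx(2)]) (use vx(2) xq \<open>q \<noteq> B\<theta>\<close> in simp)
    then show ?thesis by (simp add: xq)
  qed
  show ?thesis
  proof
    fix q
    show "y q = y' q"
      using sub[OF _ assms(2,3) xy xy'(1), of q] sub[OF _ assms(3,2) xy' xy(1), of q] by metis
  qed
qed

lemma F12_aperiodic: "x \<in> F12_set \<Longrightarrow> x \<circ> (x \<circ> (x \<circ> x)) = x \<circ> (x \<circ> x)"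
  by (auto simp: F12_set_def fun_eq_iff all_pt3 F12_unit_def)

text \<open>This makes \<open>F12_w1\<close> and \<open>F12_w2\<close>, which are defined at both
  points, irreducible.\<close>

lemma F12_irreducible:
  "f \<in> F12_set \<Longrightarrow> g \<in> F12_set \<Longrightarrow> (g \<circ> f) B1 = B\<theta> \<or> (g \<circ> f) B3 = B\<theta>"
  by (auto simp: F12_set_def F12_unit_def)

lemma finite_sgrp_F12: "finite_sgrp F12"
proof
  have eq: "F12_set = {F12_w1, F12_w2, \<lambda>_. B\<theta>} \<union> (\<lambda>(i, j). F12_unit i j) ` ({B1, B2, B3} \<times> {B1, B2, B3})"
    by (auto simp: F12_set_def)
  show "finite (carrier F12)" unfolding F12_carrier eq by simp
  show "carrier F12 \<noteq> {}" unfolding F12_carrier eq by simp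
qed (auto simp: F12_carrier F12_set_closed comp_assoc)

interpretation F12: finite_sgrp F12 by (rule finite_sgrp_F12)

text \<open>Irreducibility forces the generators to be \<open>F12_w1\<close> and
  \<open>F12_w2\<close>; both are undefined at 2, and so is everything they generate.\<close>

lemma F12_not_two_generated:
  assumes "A \<subseteq> carrier F12" "finite A" "card A \<le> 2"
  shows "sgrp_gen F12 A \<noteq> carrier F12"
proof
  assume gen: "sgrp_gen F12 A = carrier F12"
  have "w \<in> A" if w: "w \<in> {F12_w1, F12_w2}" for w
  proof -
    have "w \<in> sgrp_gen F12 A" using w unfolding gen F12_carrier by (auto simp: F12_set_def)
    then show ?thesis
    proof cases
      case (mult f g)
      then have "w = g \<circ> f" "f \<in> F12_set" "g \<in> F12_set" using gen F12_carrier by auto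
      then have "w B1 = B\<theta> \<or> w B3 = B\<theta>" using F12_irreducible by blast
      then show ?thesis using w by auto
    qed
  qed
  then have sub: "{F12_w1, F12_w2} \<subseteq> A" by blast
  have "F12_w1 B1 \<noteq> F12_w2 B1" by simp
  then have "card {F12_w1, F12_w2} = 2" by (metis card_2_iff)
  then have A: "A = {F12_w1, F12_w2}" using card_seteq[OF assms(2) sub] assms(3) by simp
  have "sgrp_gen F12 A \<subseteq> {t. t B2 = B\<theta> \<and> t B\<theta> = B\<theta>}"
    by (rule sgrp_gen_least) (auto simp: A)
  moreover have "F12_unit B2 B3 \<in> sgrp_gen F12 A" unfolding gen F12_carrier by (auto simp: F12_set_def)
  ultimately show False by (auto simp: F12_unit_def)
qed

text \<open>In a subgroup x^4 = x^3 cancels to x = 1, so all subgroups are trivial.\<close>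

lemma BG_nil_aperiodic:
  assumes "finite_sgrp S"
    and inverse: "\<And>x y y'. x \<in> carrier S \<Longrightarrow> y \<in> carrier S \<Longrightarrow> y' \<in> carrier S \<Longrightarrow>
       is_inverse S x y \<Longrightarrow> is_inverse S x y' \<Longrightarrow> y = y'"
    and aperiodic: "\<And>x. x \<in> carrier S \<Longrightarrow> x \<cdot>\<^bsub>S\<^esub> x \<cdot>\<^bsub>S\<^esub> x \<cdot>\<^bsub>S\<^esub> x = x \<cdot>\<^bsub>S\<^esub> x \<cdot>\<^bsub>S\<^esub> x"
  shows "S \<in> BG_nil"
proof -
  have "nilpotent_group \<lparr>carrier = H, monoid.mult = sgmult S, one = e\<rparr>"
    if H: "H \<subseteq> carrier S" "group \<lparr>carrier = H, monoid.mult = sgmult S, one = e\<rparr>" for H e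
  proof -
    interpret G: group "\<lparr>carrier = H, monoid.mult = sgmult S, one = e\<rparr>" by fact
    have "x = e" if x: "x \<in> H" for x
    proof -
      let ?y = "x \<cdot>\<^bsub>S\<^esub> x \<cdot>\<^bsub>S\<^esub> x"
      have "?y \<in> H" using x G.m_closed by simp
      moreover have "?y \<cdot>\<^bsub>S\<^esub> x = ?y \<cdot>\<^bsub>S\<^esub> e" using aperiodic x H(1) G.r_one[of ?y] \<open>?y \<in> H\<close> by auto
      ultimately show ?thesis using G.inv_cancel_left(1)[of ?y x] G.inv_cancel_left(1)[of ?y e] x G.one_closed by simp
    qed
    then show ?thesis using G.nilpotentI[of 0] by auto
  qed
  then show ?thesis using assms by (auto simp: BG_nil_def block_group_def)
qed

text \<open>A two-generated subsemigroup is proper, hence has too few elements to be divided by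
  \<open>F12\<close>. It is aperiodic, which excludes division by \<open>F7\<close> with its element
  of order 2, and uniqueness of inverses is inherited.\<close>

lemma NMN4_not_rank_2:
  assumes "infinite (UNIV :: 'a set)"
  shows "\<not> rank_at_most (NMN4 :: 'a sgrp set) 2"
proof -
  obtain \<phi> :: "(pt3 \<Rightarrow> pt3) \<Rightarrow> 'a" where "sgrp_copy F12 \<phi>"
    using ex_sgrp_copy[OF assms finite_sgrp_F12] by blast
  then interpret sgrp_copy F12 \<phi> .
  interpret copy: finite_sgrp copy by (rule finite_sgrp_copy)
  have surj: "\<psi> ` carrier copy = carrier F12"
    using \<psi>_\<phi> \<phi>_mem \<psi>_mem by (metis image_subsetI rev_image_eqI subsetI subset_antisym)
  have \<psi>_set: "\<psi> x \<in> F12_set" if "x \<in> carrier copy" for x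
    using \<psi>_mem[OF that] by (simp add: F12_carrier)
  have card: "card (carrier copy) = card (carrier F12)"
    using card_image[OF inj] by (simp add: copy_def)
  show ?thesis
  proof (rule not_rank_at_mostI[OF finite_sgrp_copy])
    have "F12 \<prec> copy" unfolding divides_def
      using surj \<psi>_mult copy.nonempty copy.closed
      by (intro exI[of _ "carrier copy"] exI[of _ \<psi>]) (auto simp: subsgrp_def)
    then show "copy \<notin> NMN4" by (simp add: NMN4_def)
    fix A assume A: "A \<subseteq> carrier copy" "A \<noteq> {}" "finite A" "card A \<le> 2" and T: "subsgrp (sgrp_gen copy A) copy"
    let ?T = "sgrp_gen copy A"
    have TC: "?T \<subseteq> carrier copy" and Tcl: "\<And>x y. x \<in> ?T \<Longrightarrow> y \<in> ?T \<Longrightarrow> x \<cdot>\<^bsub>copy\<^esub> y \<in> ?T"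
      using T by (auto simp: subsgrp_def)
    have "sgrp_gen F12 (\<psi> ` A) \<noteq> carrier F12"
      by (rule F12_not_two_generated) (use A card_image_le[OF A(3), of \<psi>] in auto)
    then have "?T \<noteq> carrier copy" using \<psi>_sgrp_gen[OF A(1)] surj by auto
    then have T_card: "card ?T < card (carrier F12)"
      unfolding card[symmetric] using TC copy.finite_carrier by (intro psubset_card_mono) auto
    have finT: "finite ?T" using TC copy.finite_carrier by (rule finite_subset)
    have aper: "x \<cdot>\<^bsub>copy\<^esub> x \<cdot>\<^bsub>copy\<^esub> x \<cdot>\<^bsub>copy\<^esub> x = x \<cdot>\<^bsub>copy\<^esub> x \<cdot>\<^bsub>copy\<^esub> x" if x: "x \<in> carrier copy" for x
      by (rule \<psi>_inj) (use x F12_aperiodic[OF \<psi>_set[OF x]] in \<open>simp_all add: \<psi>_mult copy.closed comp_assoc\<close>)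
    have "copy\<lparr>carrier := ?T\<rparr> \<in> BG_nil"
    proof (rule BG_nil_aperiodic)
      show "finite_sgrp (copy\<lparr>carrier := ?T\<rparr>)" by (rule copy.finite_sgrp_subsgrp[OF T])
      show "y = y'" if "x \<in> carrier (copy\<lparr>carrier := ?T\<rparr>)" "y \<in> carrier (copy\<lparr>carrier := ?T\<rparr>)"
        "y' \<in> carrier (copy\<lparr>carrier := ?T\<rparr>)" and inv: "is_inverse (copy\<lparr>carrier := ?T\<rparr>) x y"
        "is_inverse (copy\<lparr>carrier := ?T\<rparr>) x y'" for x y y'
      proof -
        have C: "x \<in> carrier copy" "y \<in> carrier copy" "y' \<in> carrier copy" using that TC by auto
        have i: "\<psi> p \<circ> (\<psi> q \<circ> \<psi> p) = \<psi> p"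
          if "p \<in> carrier copy" "q \<in> carrier copy" "p \<cdot>\<^bsub>copy\<^esub> q \<cdot>\<^bsub>copy\<^esub> p = p" for p q
          using arg_cong[OF that(3), of \<psi>] that(1,2) by (simp add: \<psi>_mult copy.closed)
        have "\<psi> y = \<psi> y'"
          by (rule F12_unique_inverse[OF \<psi>_set[OF C(1)] \<psi>_set[OF C(2)] \<psi>_set[OF C(3)]])
            (use inv C in \<open>auto simp: is_inverse_def intro!: i\<close>)
        then show ?thesis using \<psi>_inj C by blast
      qed
    qed (use aper TC in auto)
    moreover have "\<not> F7 \<prec> copy\<lparr>carrier := ?T\<rparr>"
    proof
      assume "F7 \<prec> copy\<lparr>carrier := ?T\<rparr>"
      then obtain U f where Uf: "subsgrp U (copy\<lparr>carrier := ?T\<rparr>) \<and> f ` U = carrier F7 \<and>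
         (\<forall>x\<in>U. \<forall>y\<in>U. f (x \<cdot>\<^bsub>copy\<^esub> y) = f y \<circ> f x)"
        unfolding divides_def by auto
      have "F7_u \<in> carrier F7" by (auto simp: F7_def intro: sgrp_gen.base)
      then have "F7_u \<in> f ` U" using Uf by simp
      then obtain v where v: "v \<in> U" "f v = F7_u" by auto
      have UT: "U \<subseteq> ?T" "\<And>x y. x \<in> U \<Longrightarrow> y \<in> U \<Longrightarrow> x \<cdot>\<^bsub>copy\<^esub> y \<in> U" using Uf by (auto simp: subsgrp_def)
      have hom: "f (x \<cdot>\<^bsub>copy\<^esub> y) = f y \<circ> f x" if "x \<in> U" "y \<in> U" for x y using Uf that by blast
      have "f (v \<cdot>\<^bsub>copy\<^esub> v \<cdot>\<^bsub>copy\<^esub> v \<cdot>\<^bsub>copy\<^esub> v) = f (v \<cdot>\<^bsub>copy\<^esub> v \<cdot>\<^bsub>copy\<^esub> v)"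
        using aper[of v] v(1) UT(1) TC by auto
      then have "(F7_u \<circ> (F7_u \<circ> (F7_u \<circ> F7_u))) A1 = (F7_u \<circ> (F7_u \<circ> F7_u)) A1"
        using v UT(2) by (simp add: hom)
      then show False by (simp add: F7_u_def)
    qed
    moreover have "\<not> F12 \<prec> copy\<lparr>carrier := ?T\<rparr>"
    proof
      assume "F12 \<prec> copy\<lparr>carrier := ?T\<rparr>"
      then obtain U and f :: "'a \<Rightarrow> pt3 \<Rightarrow> pt3" where Uf: "U \<subseteq> ?T" "f ` U = carrier F12"
        unfolding divides_def subsgrp_def by auto
      have "card (carrier F12) \<le> card U"
        unfolding Uf(2)[symmetric] using finT Uf(1) finite_subset by (intro card_image_le) auto
      also have "\<dots> \<le> card ?T" using finT Uf(1) by (intro card_mono)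
      finally show False using T_card by simp
    qed
    ultimately show "copy\<lparr>carrier := ?T\<rparr> \<in> NMN4" by (simp add: NMN4_def)
  qed
qed

theorem corollary7p2:
  assumes "infinite (UNIV :: 'a set)"
  shows "has_rank (MN :: 'a sgrp set) 4 \<and> has_rank (PE :: 'a sgrp set) 2 \<and>
         has_rank (NMN4 :: 'a sgrp set) 3 \<and> has_rank (TM :: 'a sgrp set) 2"
  using has_rankI[of "MN :: 'a sgrp set" 3] has_rankI[of "PE :: 'a sgrp set" 1]
    has_rankI[of "NMN4 :: 'a sgrp set" 2] has_rankI[of "TM :: 'a sgrp set" 1]
    MN_rank_le[OF assms] PE_rank_le[OF assms] NMN4_rank_le[where 'a = 'a] TM_rank_le[where 'a = 'a]
    MN_not_rank_3[OF assms] NMN4_not_rank_2[OF assms] not_rank_1[OF assms]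
  by (simp add: numeral_eq_Suc)

end
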